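(* Let $V:\mathbb{R}\to\mathbb{R}$ satisfy Assumption (V) of the context. Let $\bar x>0$ be fixed and let $$\Omega=\big\{(s,x,w)\in\mathbb{R}^3:\ s\in(-1,1),\ x\in(0,\bar x],\ V(f^{-1}(s))\,x^2+w^2=1\big\}.$$ Then every collapsing scalar field in the flat case $\kappa=0$ (as defined in the context) with initial data $(s(0),x(0),w(0))\in\Omega$ remains in $\Omega$ for all $\tau\ge 0$, and generically (with respect to the initial data in $\Omega$) it approaches, as $\tau\to+\infty$, the set $M_0\subseteq\overline\Omega\setminus\Omega$ defined by $$M_0=\overline\Omega\cap\big(\{|s|=1\}\cup\{|w|=1\}\big)\cap\{x=0\},$$ where $\overline\Omega$ is the closure of $\Omega$ in $\mathbb{R}^3$. In particular, generically $$\lim_{\tau\to\infty}x(\tau)=0^+.$$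
   Context: **Compactification.** $f:\mathbb{R}\to(-1,1)$ is a fixed strictly increasing $C^2$ bijection with $f'>0$ and $$\lim_{\phi\to-\infty}\frac{f''(\phi)}{f'(\phi)}=\lambda_->0,\qquad \lim_{\phi\to+\infty}\frac{f''(\phi)}{f'(\phi)}=\lambda_+<0.$$ The variable $s=f(\phi)$ replaces the scalar field $\phi$. The function $s\mapsto f'(f^{-1}(s))$ is extended by continuity by the value $0$ at $s=\pm1$. Set $$u(s)=\frac{V'(f^{-1}(s))}{\sqrt6\,V(f^{-1}(s))}$$ wherever $V(f^{-1}(s))\neq 0$. **Assumption (V).** $V:\mathbb{R}\to\mathbb{R}$ is of class $C^2$ and: (1) $V(\phi)>0$ for all $|\phi|$ sufficiently large, $V'(\phi)<0$ for all $\phi$ sufficiently close to $-\infty$, and $V'(\phi)>0$ for all $\phi$ sufficiently close to $+\infty$; (2) the limits $u(-1):=\lim_{s\to-1}u(s)$ and $u(1):=\lim_{s\to1}u(s)$ exist and are finite. **Cutoff.** Fix $\delta>0$ such that $V(f^{-1}(s))>0$ and $V'(f^{-1}(s))\ne0$ for all $s\in(-1,-1+\delta)\cup(1-\delta,1)$, and a smooth function $\psi:[-1,1]\to[0,1]$ with $\psi(s)=1$ if $|s|\le1-\delta$ and $\psi(s)=0$ if $|s|\in(1-\delta/2,1]$. **Collapsing scalar field in the flat case ($\kappa=0$).** A solution $\tau\mapsto(s(\tau),x(\tau),w(\tau))$ of $$\frac{ds}{d\tau}=f'(f^{-1}(s))\,w,\qquad \frac{dx}{d\tau}=-\sqrt{\tfrac32}\,x\,w^2,\qquad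 \frac{dw}{d\tau}=(1-\psi(s))\,\theta_1(s,w)+\psi(s)\,\theta_2(s,x,w),$$ where $$\theta_1(s,w)=\sqrt{\tfrac32}\,(w-u(s))(1-w^2),\qquad \theta_2(s,x,w)=\sqrt{\tfrac32}\,w(1-w^2)-\tfrac12V'(f^{-1}(s))\,x^2,$$ with initial data satisfying $x(0)>0$ and the (flow-invariant) constraint $V(f^{-1}(s))x^2+w^2=1$. (The term $(1-\psi)\theta_1$ is read as $0$ where $\psi=1$.) **Conventions.** A solution approaches a set $M$ if its distance to $M$ tends to $0$ as $\tau\to+\infty$. "Generically" refers to small perturbations of the initial data: a property holds generically if it is stable under sufficiently small perturbations of the initial data, and initial data for which it fails can be turned into data for which it holds by arbitrarily small perturbations; i.e. the set of initial data (in the set of admissible data, here $\Omega$ with the topology induced from $\mathbb{R}^3$) for which the property holds is open and dense.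
   Formalization: Adds that the system's right-hand side is continuous for s in [-1,1]; this can fail only if V vanishes at f^{-1}(1-δ) or f^{-1}(-1+δ), e.g. V=exp(-exp(1/|φ|)) near such a point with 1-ψ much larger, where solutions can leave the constraint surface and hence Ω. *)

theory Defs
  imports "HOL-Analysis.Analysis"
begin

definition C2 :: "(real \<Rightarrow> real) \<Rightarrow> bool" where
  "C2 g \<longleftrightarrow> g differentiable_on UNIV \<and> deriv g C1_differentiable_on UNIV"

text \<open>Smoothness on a closed interval, with one-sided derivatives at the end points:
  \<open>D n\<close> is the \<open>n\<close>-th derivative.\<close>

definition smooth_on_Icc :: "real \<Rightarrow> real \<Rightarrow> (real \<Rightarrow> real) \<Rightarrow> bool" where
  "smooth_on_Icc a b g \<longleftrightarrow>
     (\<exists>D. D (0::nat) = g \<and>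
       (\<forall>n. \<forall>s\<in>{a..b}. (D n has_real_derivative D (Suc n) s) (at s within {a..b})))"

definition compactification :: "(real \<Rightarrow> real) \<Rightarrow> bool" where
  "compactification f \<longleftrightarrow>
     bij_betw f UNIV {-1<..<1} \<and> strict_mono f \<and> C2 f \<and> (\<forall>\<phi>. deriv f \<phi> > 0) \<and>
     (\<exists>lm>0. ((\<lambda>\<phi>. deriv (deriv f) \<phi> / deriv f \<phi>) \<longlongrightarrow> lm) at_bot) \<and>
     (\<exists>lp<0. ((\<lambda>\<phi>. deriv (deriv f) \<phi> / deriv f \<phi>) \<longlongrightarrow> lp) at_top)"

definition f_speed :: "(real \<Rightarrow> real) \<Rightarrow> real \<Rightarrow> real" where
  "f_speed f s = (if \<bar>s\<bar> < 1 then deriv f (inv f s) else 0)"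

definition u_raw :: "(real \<Rightarrow> real) \<Rightarrow> (real \<Rightarrow> real) \<Rightarrow> real \<Rightarrow> real" where
  "u_raw f V s = deriv V (inv f s) / (sqrt 6 * V (inv f s))"

text \<open>The function \<open>u\<close> on \<open>[-1,1]\<close>, where \<open>u(-1)\<close> and \<open>u(1)\<close> denote the limits.\<close>

definition u_ext :: "(real \<Rightarrow> real) \<Rightarrow> (real \<Rightarrow> real) \<Rightarrow> real \<Rightarrow> real" where
  "u_ext f V s =
     (if \<bar>s\<bar> < 1 then u_raw f V s else Lim (at s within {-1<..<1}) (u_raw f V))"

definition assumption_V :: "(real \<Rightarrow> real) \<Rightarrow> (real \<Rightarrow> real) \<Rightarrow> bool" where
  "assumption_V f V \<longleftrightarrow>
     C2 V \<and>
     (\<forall>\<^sub>F \<phi> in at_infinity. V \<phi> > 0) \<and>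
     (\<forall>\<^sub>F \<phi> in at_bot. deriv V \<phi> < 0) \<and>
     (\<forall>\<^sub>F \<phi> in at_top. deriv V \<phi> > 0) \<and>
     (\<exists>l. (u_raw f V \<longlongrightarrow> l) (at (-1) within {-1<..<1})) \<and>
     (\<exists>l. (u_raw f V \<longlongrightarrow> l) (at 1 within {-1<..<1}))"

definition cutoff ::
  "(real \<Rightarrow> real) \<Rightarrow> (real \<Rightarrow> real) \<Rightarrow> real \<Rightarrow> (real \<Rightarrow> real) \<Rightarrow> bool" where
  "cutoff f V \<delta> \<psi> \<longleftrightarrow>
     \<delta> > 0 \<and>
     (\<forall>s\<in>{-1<..<-1+\<delta>} \<union> {1-\<delta><..<1}. V (inv f s) > 0 \<and> deriv V (inv f s) \<noteq> 0) \<and>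
     smooth_on_Icc (-1) 1 \<psi> \<and>
     \<psi> ` {-1..1} \<subseteq> {0..1} \<and>
     (\<forall>s\<in>{-1..1}. \<bar>s\<bar> \<le> 1 - \<delta> \<longrightarrow> \<psi> s = 1) \<and>
     (\<forall>s\<in>{-1..1}. \<bar>s\<bar> > 1 - \<delta>/2 \<longrightarrow> \<psi> s = 0)"

definition theta1 ::
  "(real \<Rightarrow> real) \<Rightarrow> (real \<Rightarrow> real) \<Rightarrow> real \<Rightarrow> real \<Rightarrow> real" where
  "theta1 f V s w = sqrt (3/2) * (w - u_ext f V s) * (1 - w\<^sup>2)"

definition theta2 ::
  "(real \<Rightarrow> real) \<Rightarrow> (real \<Rightarrow> real) \<Rightarrow> real \<Rightarrow> real \<Rightarrow> real \<Rightarrow> real" where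
  "theta2 f V s x w = sqrt (3/2) * w * (1 - w\<^sup>2) - 1/2 * deriv V (inv f s) * x\<^sup>2"

text \<open>The right-hand side of the system for \<open>(s, x, w)\<close>, with \<open>s\<close> ranging over \<open>[-1,1]\<close>.
  Under \<open>cutoff\<close> the junk values are harmless: \<open>inv f s\<close> for \<open>\<bar>s\<bar> = 1\<close> enters only through
  \<open>\<psi> s * theta2\<close> with \<open>\<psi> s = 0\<close>, and division by \<open>V (inv f s) = 0\<close> only
  through \<open>(1 - \<psi> s) * theta1\<close> with \<open>\<psi> s = 1\<close>.
  The field is continuous on \<open>[-1,1] \<times> UNIV\<close> whenever \<open>V (inv f s) \<noteq> 0\<close> at \<open>s = -1+\<delta>\<close> and \<open>s = 1-\<delta>\<close>.
  If \<open>V\<close> vanishes at one of these points, \<open>(1 - \<psi> s) * u_ext f V s\<close> can be unbounded near it, and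
  solutions may then leave the constraint surface \<open>V (inv f s) * x\<^sup>2 + w\<^sup>2 = 1\<close>. Continuity of the
  field, implicit in the flow-invariance of the constraint, is therefore a separate hypothesis.\<close>

definition flat_field ::
  "(real \<Rightarrow> real) \<Rightarrow> (real \<Rightarrow> real) \<Rightarrow> (real \<Rightarrow> real) \<Rightarrow>
    real \<times> real \<times> real \<Rightarrow> real \<times> real \<times> real" where
  "flat_field f V \<psi> = (\<lambda>(s, x, w).
     (f_speed f s * w,
      - sqrt (3/2) * x * w\<^sup>2,
      (1 - \<psi> s) * theta1 f V s w + \<psi> s * theta2 f V s x w))"

text \<open>The constraint is imposed on the initial value only.\<close>

definition collapsing_scalar_field ::
  "(real \<Rightarrow> real) \<Rightarrow> (real \<Rightarrow> real) \<Rightarrow> (real \<Rightarrow> real) \<Rightarrow>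
    real set \<Rightarrow> (real \<Rightarrow> real \<times> real \<times> real) \<Rightarrow> bool" where
  "collapsing_scalar_field f V \<psi> I y \<longleftrightarrow>
     is_interval I \<and> 0 \<in> I \<and> I \<subseteq> {0..} \<and>
     (\<forall>t\<in>I. fst (y t) \<in> {-1..1} \<and>
        (y has_vector_derivative flat_field f V \<psi> (y t)) (at t within I)) \<and>
     (case y 0 of (s, x, w) \<Rightarrow> \<bar>s\<bar> < 1 \<and> x > 0 \<and> V (inv f s) * x\<^sup>2 + w\<^sup>2 = 1)"

definition Omega ::
  "(real \<Rightarrow> real) \<Rightarrow> (real \<Rightarrow> real) \<Rightarrow> real \<Rightarrow> (real \<times> real \<times> real) set" where
  "Omega f V xbar =
     {(s, x, w). s \<in> {-1<..<1} \<and> x \<in> {0<..xbar} \<and> V (inv f s) * x\<^sup>2 + w\<^sup>2 = 1}"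

definition M0 ::
  "(real \<Rightarrow> real) \<Rightarrow> (real \<Rightarrow> real) \<Rightarrow> real \<Rightarrow> (real \<times> real \<times> real) set" where
  "M0 f V xbar =
     closure (Omega f V xbar) \<inter> ({(s, x, w). \<bar>s\<bar> = 1} \<union> {(s, x, w). \<bar>w\<bar> = 1}) \<inter> {(s, x, w). x = 0}"

text \<open>Nonemptiness is required because \<open>infdist\<close> to the empty set is \<open>0\<close>.\<close>

definition approaches :: "(real \<Rightarrow> 'a::metric_space) \<Rightarrow> 'a set \<Rightarrow> bool" where
  "approaches y M \<longleftrightarrow> M \<noteq> {} \<and> ((\<lambda>t. infdist (y t) M) \<longlongrightarrow> 0) at_top"

definition generically_in :: "'a::topological_space set \<Rightarrow> ('a \<Rightarrow> bool) \<Rightarrow> bool" where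
  "generically_in S P \<longleftrightarrow>
     openin (top_of_set S) {p \<in> S. P p} \<and> S \<subseteq> closure {p \<in> S. P p}"

end

theory Submission
  imports Defs
begin

text \<open>
  On the constraint surface use the coordinates \<open>\<phi> = inv f s\<close> and \<open>v = w / x\<close>, and put
  \<open>G = v\<^sup>2 + V(\<phi>) = 1 / x\<^sup>2\<close>, \<open>H = sqrt G\<close>. The system becomes \<open>\<phi>' = v / H\<close>,
  \<open>v' = \<kappa> v - V'(\<phi>) / (2 H)\<close> with \<open>\<kappa> = sqrt (3/2)\<close>, a Hamiltonian field for \<open>H\<close> plus an
  anti-damping term: \<open>G' = 2 \<kappa> v\<^sup>2 \<ge> 0\<close> and the divergence is the constant \<open>\<kappa>\<close>.

  If \<open>G\<close> stays bounded along a solution, then \<open>v \<rightarrow> 0\<close> and \<open>V(\<phi>)\<close> tends to \<open>lim G\<close>, which cannot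
  be a large value, because \<open>V\<close> is strictly monotone outside a compact set. So there is a constant
  \<open>C\<close> such that \<open>x \<rightarrow> 0\<close> as soon as \<open>G > C\<close> at one time; by continuous dependence this is an
  open condition on the initial data. If it failed on a whole ball of initial data, the image of
  the ball under the flow would stay in a box whose area grows linearly in time, whereas areas grow
  exponentially. Finally, \<open>V x\<^sup>2 + w\<^sup>2 = 1\<close> turns \<open>x \<rightarrow> 0\<close> into convergence to \<open>M\<^sub>0\<close>.
\<close>

subsection \<open>Comparison lemmas on intervals\<close>

text \<open>The choice v = w/x makes the divergence constant, so that areas grow at the same rate
  wherever the trajectories run; \<open>f\<close> only conjugates \<phi> to s and drops out. The
  bound x \<le> \<open>xbar\<close> becomes G \<ge> 1/\<open>xbar\<close>^2, which keeps
  trajectories away from the singularity G = 0 of the planar field. That field is still neither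
  bounded nor globally Lipschitz, so all equations are solved for a truncated field, and a priori
  bounds show that the truncation is not felt. The finite limits of u at both ends enter as |V'|
  \<le> M (1 + |V|): this bounds v' along a trajectory with bounded G even if \<phi> should be
  unbounded. Since |w| is bounded where G is bounded below, \<phi> moves at bounded speed, which is
  why the box grows only linearly. The cutoff is invisible on the constraint surface, where both
  formulas for w' agree; off the surface it contributes a multiple of the constraint defect. The
  surface is invariant because (1 - \<psi>) u is bounded, and continuity of the field provides this
  bound.\<close>

text \<open>A bootstrap: estimates that are valid only while the curve stays in \<open>U\<close>
  place it in the smaller closed set \<open>K\<close>. At a first exit time from \<open>U\<close>
  all earlier values lie in \<open>K\<close>, hence so does the value at that time, which
  contradicts \<open>K\<close> \<subseteq> \<open>U\<close>.\<close>

lemma continuous_induction_Icc: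
  fixes y :: "real \<Rightarrow> 'a::topological_space"
  assumes cont: "continuous_on {0..T} y"
    and K: "closed K" and U: "open U" and KU: "K \<subseteq> U" and y0: "y 0 \<in> K"
    and step: "\<And>t. t \<in> {0..T} \<Longrightarrow> (\<And>r. r \<in> {0..t} \<Longrightarrow> y r \<in> U) \<Longrightarrow> y t \<in> K"
    and t: "t \<in> {0..T}"
  shows "y t \<in> K"
proof (rule ccontr)
  assume nt: "y t \<notin> K"
  define B where "B = {r \<in> {0..t}. y r \<notin> U}"
  have contt: "continuous_on {0..t} y"
    by (rule continuous_on_subset[OF cont]) (use t in auto)
  have B: "B = {0..t} \<inter> y -` (- U)" by (auto simp: B_def)
  have "closed B"
    unfolding B using contt U by (intro continuous_closed_preimage) auto
  then have cB: "compact B"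
    using compact_Icc[of 0 t] unfolding B
    by (metis closed_Int_compact inf.left_idem inf_commute)
  have "B \<noteq> {}" using step[OF t] nt by (auto simp: B_def)
  then obtain b where b: "b \<in> B" and bmin: "\<And>r. r \<in> B \<Longrightarrow> b \<le> r"
    using compact_attains_inf[OF cB] by blast
  have b0: "0 < b" "b \<le> t" "y b \<notin> U"
    using b y0 KU unfolding B_def by (auto simp: less_le)
  have before: "y r \<in> K" if r: "r \<in> {0..<b}" for r
  proof (rule step)
    show "r \<in> {0..T}" using r b0 t by auto
    show "y q \<in> U" if "q \<in> {0..r}" for q
    proof (rule ccontr)
      assume "y q \<notin> U"
      then have "q \<in> B" using that r b0 by (auto simp: B_def)
      then show False using bmin[of q] that r by auto
    qed
  qed
  have "b \<in> closure {0..<b}" using b0 by simp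
  moreover have "continuous_on (closure {0..<b}) y"
    by (rule continuous_on_subset[OF contt]) (use b0 in auto)
  then have "y ` closure {0..<b} \<subseteq> closure (y ` {0..<b})"
    by (rule image_closure_subset) (use closure_subset[of "y ` {0..<b}"] in auto)
  ultimately have "y b \<in> closure (y ` {0..<b})" by blast
  also have "\<dots> \<subseteq> K" using before K by (intro closure_minimal) auto
  finally show False using b0 KU by auto
qed

lemma deriv_within_nonneg_imp_le:
  fixes g :: "real \<Rightarrow> real"
  assumes der: "\<And>t. t \<in> {a..b} \<Longrightarrow> (g has_real_derivative g' t) (at t within {a..b})"
    and nn: "\<And>t. t \<in> {a..b} \<Longrightarrow> g' t \<ge> 0" and rt: "a \<le> r" "r \<le> t" "t \<le> b"
  shows "g r \<le> g t"
proof (rule DERIV_nonneg_imp_increasing_open[OF \<open>r \<le> t\<close>])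
  have "continuous_on {a..b} g"
    using der by (meson DERIV_continuous continuous_on_eq_continuous_within)
  then show "continuous_on {r..t} g" by (rule continuous_on_subset) (use rt in auto)
  show "\<exists>y. DERIV g x :> y \<and> 0 \<le> y" if "r < x" "x < t" for x
  proof -
    have "x \<in> {a..b}" "x \<in> interior {a..b}" using that rt by auto
    then show ?thesis using der[of x] nn[of x] at_within_interior[of x "{a..b}"] by auto
  qed
qed

text \<open>The derivative of g exp(-A t) is (g' - A g) exp(-A t) \<le> 0. The rate \<open>A\<close>
  may be negative, as in the lower bound for x^2 in \<open>solution_in_Omega\<close>.\<close>

lemma gronwall_le:
  fixes g :: "real \<Rightarrow> real"
  assumes der: "\<And>t. t \<in> {0..T} \<Longrightarrow> (g has_real_derivative g' t) (at t within {0..T})"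
    and le: "\<And>t. t \<in> {0..T} \<Longrightarrow> g' t \<le> A * g t" and t: "t \<in> {0..T}"
  shows "g t \<le> g 0 * exp (A * t)"
proof -
  have "- (g 0 * exp (- A * 0)) \<le> - (g t * exp (- A * t))"
  proof (rule deriv_within_nonneg_imp_le[where a=0 and b=T
        and g = "\<lambda>t. - (g t * exp (- A * t))" and g' = "\<lambda>t. (A * g t - g' t) * exp (- A * t)"])
    fix r assume r: "r \<in> {0..T}"
    show "((\<lambda>t. - (g t * exp (- A * t))) has_real_derivative (A * g r - g' r) * exp (- A * r))
        (at r within {0..T})"
      by (rule derivative_eq_intros der[OF r] refl)+ (simp add: algebra_simps)
    show "0 \<le> (A * g r - g' r) * exp (- A * r)" using le[OF r] by simp
  qed (use t in auto)
  then have "g t * exp (- A * t) * exp (A * t) \<le> g 0 * exp (A * t)"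
    by (intro mult_right_mono) auto
  then show ?thesis by (simp add: mult.assoc flip: exp_add)
qed

lemma gronwall_ge:
  fixes g :: "real \<Rightarrow> real"
  assumes der: "\<And>t. t \<in> {0..T} \<Longrightarrow> (g has_real_derivative g' t) (at t within {0..T})"
    and ge: "\<And>t. t \<in> {0..T} \<Longrightarrow> g' t \<ge> A * g t" and t: "t \<in> {0..T}"
  shows "g t \<ge> g 0 * exp (A * t)"
  using gronwall_le[of T "\<lambda>t. - g t" "\<lambda>t. - g' t" A t] der ge t by (force intro: DERIV_minus)

text \<open>The squared norm is differentiable also where \<open>e\<close> vanishes. By
  Cauchy-Schwarz it satisfies a Gronwall inequality with rate 2 L, and the root is taken at the
  end.\<close>

lemma gronwall_norm:
  fixes e :: "real \<Rightarrow> 'a::real_inner"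
  assumes der: "\<And>t. t \<in> {0..T} \<Longrightarrow> (e has_vector_derivative e' t) (at t within {0..T})"
    and le: "\<And>t. t \<in> {0..T} \<Longrightarrow> norm (e' t) \<le> L * norm (e t)" and t: "t \<in> {0..T}"
  shows "norm (e t) \<le> norm (e 0) * exp (L * t)"
proof -
  have "(norm (e t))\<^sup>2 \<le> (norm (e 0))\<^sup>2 * exp (2 * L * t)"
  proof (rule gronwall_le[where g = "\<lambda>t. (norm (e t))\<^sup>2" and g' = "\<lambda>t. 2 * (e t \<bullet> e' t)" and T=T])
    fix r assume r: "r \<in> {0..T}"
    show "((\<lambda>t. (norm (e t))\<^sup>2) has_real_derivative 2 * (e r \<bullet> e' r)) (at r within {0..T})"
      unfolding power2_norm_eq_inner has_field_derivative_def
      using der[OF r] unfolding has_vector_derivative_def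
      by (auto intro!: derivative_eq_intros simp: inner_commute algebra_simps fun_eq_iff)
    have "e r \<bullet> e' r \<le> norm (e r) * norm (e' r)" by (rule norm_cauchy_schwarz)
    also have "\<dots> \<le> norm (e r) * (L * norm (e r))" using le[OF r] by (intro mult_left_mono) auto
    finally show "2 * (e r \<bullet> e' r) \<le> 2 * L * (norm (e r))\<^sup>2"
      by (simp add: power2_eq_square mult.left_commute)
  qed (use t in auto)
  also have "\<dots> = (norm (e 0) * exp (L * t))\<^sup>2"
    by (simp add: power_mult_distrib exp_double[symmetric] mult.assoc)
  finally show ?thesis by (rule power2_le_imp_le) simp
qed

subsection \<open>Globally Lipschitz fields\<close>

text \<open>Picard iteration with an exponential weight: the substitution y = p + exp(K t) z turns
  the integral equation into a fixed point equation for a bounded z on the whole half line, with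
  contraction factor L/K. One application of Banach's theorem then gives a global solution.\<close>

lemma lipschitz_ode_exists:
  fixes F :: "'a::euclidean_space \<Rightarrow> 'a"
  assumes lip: "L-lipschitz_on UNIV F" and bd: "\<And>q. norm (F q) \<le> M"
  obtains y where "y 0 = p"
    and "\<And>t. t \<ge> 0 \<Longrightarrow> (y has_vector_derivative F (y t)) (at t within {0..})"
proof -
  \<comment> \<open>This gives L/K \<le> 1/2 and a positive weight also for L = 0.\<close>
  define K where "K = 2 * L + 1"
  have L0: "L \<ge> 0" by (rule lipschitz_on_nonneg[OF lip])
  have K0: "K > 0" using L0 by (simp add: K_def)
  have M0: "M \<ge> 0" using bd[of p] norm_ge_zero order_trans by blast
  have contF: "continuous_on UNIV F" by (rule lipschitz_on_continuous_on[OF lip])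
  define I :: "(real \<Rightarrow> 'a) \<Rightarrow> real \<Rightarrow> 'a"
    where "I z t = integral {0..t} (\<lambda>r. F (p + exp (K * r) *\<^sub>R z r))" for z t
  have contI: "continuous_on {0..t} (\<lambda>r. F (p + exp (K * r) *\<^sub>R z r))"
    if "continuous_on UNIV z" for z :: "real \<Rightarrow> 'a" and t
    by (intro continuous_on_compose2[OF contF] continuous_intros continuous_on_subset[OF that]) auto
  have Ider: "(I z has_vector_derivative F (p + exp (K * t) *\<^sub>R z t)) (at t within {0..b})"
    if "continuous_on UNIV z" "t \<in> {0..b}" for z t b
    using integral_has_vector_derivative[OF contI[OF that(1)] that(2)] by (simp add: I_def[abs_def])
  \<comment> \<open>Bounded continuous functions live on the whole line, so negative times are given
    the value at 0.\<close>
  define G :: "(real \<Rightarrow> 'a) \<Rightarrow> real \<Rightarrow> 'a"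
    where "G z t = exp (- K * max 0 t) *\<^sub>R I z (max 0 t)" for z t
  have contIz: "continuous_on {0..} (I z)" if "continuous_on UNIV z" for z
  proof -
    have "(I z has_vector_derivative F (p + exp (K * t) *\<^sub>R z t)) (at t within {0..})"
      if t: "t \<ge> 0" for t
    proof -
      have "at t within {0..t+1} = at t within {0..}"
        by (rule at_within_nhd[of t "{..<t+1}"]) auto
      then show ?thesis using Ider[OF \<open>continuous_on UNIV z\<close>, of t "t+1"] t by simp
    qed
    then show ?thesis
      by (meson atLeast_iff continuous_on_eq_continuous_within has_vector_derivative_continuous)
  qed
  have Gbc: "G z \<in> bcontfun" if z: "continuous_on UNIV z" for z
  proof (rule bcontfun_normI)
    show "continuous_on UNIV (G z)"
      unfolding G_def
      by (intro continuous_intros continuous_on_compose2[OF contIz[OF z]]) auto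
    fix t :: real
    let ?t = "max 0 t"
    have "norm (I z ?t) \<le> M * (?t - 0)"
      unfolding I_def by (rule integral_bound[OF _ contI[OF z]]) (use bd in auto)
    then have "norm (G z t) \<le> exp (- K * ?t) * (M * ?t)"
      by (simp add: G_def)
    also have "\<dots> = M * (exp (- K * ?t) * ?t)" by simp
    also have "exp (- K * ?t) * ?t \<le> 1 / K"
    proof -
      have "K * ?t \<le> exp (K * ?t)" using exp_ge_add_one_self[of "K * ?t"] by linarith
      then show ?thesis using K0 by (simp add: exp_minus field_simps)
    qed
    finally show "norm (G z t) \<le> M * (1 / K)" using M0 by (simp add: mult_left_mono)
  qed
  define \<Phi> where "\<Phi> z = Bcontfun (G (apply_bcontfun z))" for z :: "real \<Rightarrow>\<^sub>C 'a"
  have app: "apply_bcontfun (\<Phi> z) = G (apply_bcontfun z)" for z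
    unfolding \<Phi>_def by (rule Bcontfun_inverse[OF Gbc]) simp
  have contr: "dist (\<Phi> z1) (\<Phi> z2) \<le> (1/2) * dist z1 z2" for z1 z2
  proof (rule dist_bound)
    fix t :: real
    let ?t = "max 0 t" and ?d = "dist z1 z2"
    let ?f = "\<lambda>z r. F (p + exp (K * r) *\<^sub>R apply_bcontfun z r)"
    have int: "?f z integrable_on {0..?t}" for z
      by (rule integrable_continuous_real[OF contI]) simp
    have "norm (integral {0..?t} (\<lambda>r. ?f z1 r - ?f z2 r))
        \<le> integral {0..?t} (\<lambda>r. L * ?d * exp (K * r))"
    proof (rule integral_norm_bound_integral)
      show "(\<lambda>r. ?f z1 r - ?f z2 r) integrable_on {0..?t}" by (intro integrable_diff int)
      show "(\<lambda>r. L * ?d * exp (K * r)) integrable_on {0..?t}"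
        by (intro integrable_continuous_real continuous_intros)
      fix r
      have "norm (?f z1 r - ?f z2 r) \<le> L * norm (exp (K * r) *\<^sub>R (z1 r - z2 r))"
        using lipschitz_on_normD[OF lip, of "p + exp (K * r) *\<^sub>R z1 r" "p + exp (K * r) *\<^sub>R z2 r"]
        by (simp add: scaleR_diff_right)
      also have "\<dots> = L * exp (K * r) * dist (z1 r) (z2 r)" by (simp add: dist_norm)
      also have "\<dots> \<le> L * exp (K * r) * ?d"
        using L0 by (intro mult_left_mono dist_bounded) auto
      finally show "norm (?f z1 r - ?f z2 r) \<le> L * ?d * exp (K * r)" by (simp add: ac_simps)
    qed
    also have "((\<lambda>r. L * ?d * exp (K * r)) has_integral
        L * ?d * exp (K * ?t) / K - L * ?d * exp (K * 0) / K) {0..?t}"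
      by (rule fundamental_theorem_of_calculus)
        (use K0 in \<open>auto intro!: derivative_eq_intros simp flip: has_real_derivative_iff_has_vector_derivative\<close>)
    then have "integral {0..?t} (\<lambda>r. L * ?d * exp (K * r)) \<le> L * ?d * exp (K * ?t) / K"
      using K0 L0 by (simp add: has_integral_integrable_integral)
    finally have *: "norm (I (apply_bcontfun z1) ?t - I (apply_bcontfun z2) ?t)
        \<le> L * ?d * exp (K * ?t) / K"
      by (simp add: I_def integral_diff int)
    have "dist (\<Phi> z1 t) (\<Phi> z2 t)
        = exp (- K * ?t) * norm (I (apply_bcontfun z1) ?t - I (apply_bcontfun z2) ?t)"
      by (simp add: app G_def dist_norm flip: scaleR_diff_right)
    also have "\<dots> \<le> exp (- K * ?t) * (L * ?d * exp (K * ?t) / K)"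
      by (intro mult_left_mono *) auto
    also have "\<dots> = L / K * ?d" by (simp add: exp_minus field_simps)
    also have "\<dots> \<le> (1/2) * ?d"
      using L0 by (intro mult_right_mono) (auto simp: K_def field_simps)
    finally show "dist (\<Phi> z1 t) (\<Phi> z2 t) \<le> (1/2) * ?d" .
  qed
  obtain z where z: "\<Phi> z = z"
    using banach_fix_type[of "1/2" \<Phi>] contr by auto
  have contz: "continuous_on UNIV (apply_bcontfun z)" by simp
  have zeq: "apply_bcontfun z t = exp (- K * t) *\<^sub>R I (apply_bcontfun z) t" if "t \<ge> 0" for t
    proof -
    have "apply_bcontfun (\<Phi> z) t = exp (- K * t) *\<^sub>R I (apply_bcontfun z) t"
      unfolding app G_def using that by simp
    then show ?thesis unfolding z .
  qed
  define y where "y t = p + I (apply_bcontfun z) t" for t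
  have yz: "y t = p + exp (K * t) *\<^sub>R apply_bcontfun z t" if "t \<ge> 0" for t
    using zeq[OF that] by (simp add: y_def mult.commute flip: exp_add)
  show ?thesis
  proof (rule that[of y])
    show "y 0 = p" by (simp add: y_def I_def)
    fix t :: real assume t: "t \<ge> 0"
    have "(I (apply_bcontfun z) has_vector_derivative F (y t)) (at t within {0..t+1})"
      using Ider[OF contz, of t "t+1"] t by (simp add: yz[OF t])
    moreover have "at t within {0..t+1} = at t within {0..}"
      by (rule at_within_nhd[of t "{..<t+1}"]) auto
    ultimately show "(y has_vector_derivative F (y t)) (at t within {0..})"
      unfolding y_def[abs_def] by (auto intro!: derivative_eq_intros)
  qed
qed

lemma lipschitz_ode_diff_bound:
  fixes F :: "'a::euclidean_space \<Rightarrow> 'a"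
  assumes lip: "L-lipschitz_on S F"
    and y: "\<And>t. t \<in> {0..T} \<Longrightarrow> (y has_vector_derivative F (y t)) (at t within {0..T})"
      "\<And>t. t \<in> {0..T} \<Longrightarrow> y t \<in> S"
    and z: "\<And>t. t \<in> {0..T} \<Longrightarrow> (z has_vector_derivative F (z t)) (at t within {0..T})"
      "\<And>t. t \<in> {0..T} \<Longrightarrow> z t \<in> S"
    and t: "t \<in> {0..T}"
  shows "dist (y t) (z t) \<le> dist (y 0) (z 0) * exp (L * t)"
  unfolding dist_norm
proof (rule gronwall_norm[where e = "\<lambda>t. y t - z t" and T=T])
  fix r assume r: "r \<in> {0..T}"
  show "((\<lambda>t. y t - z t) has_vector_derivative F (y r) - F (z r)) (at r within {0..T})"
    by (intro derivative_intros y z r)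
  show "norm (F (y r) - F (z r)) \<le> L * norm (y r - z r)"
    by (rule lipschitz_on_normD[OF lip]) (use y z r in auto)
qed (use t in auto)

text \<open>One step commits an error of at most L M h^2, because meanwhile the solution moves by at
  most M h and \<open>F\<close> by L M h; each later step magnifies an error by at most 1 + h L. The
  total is of order h, uniformly in the starting point.\<close>

lemma euler_method_error:
  fixes F :: "'a::euclidean_space \<Rightarrow> 'a"
  assumes lip: "L-lipschitz_on UNIV F" and bd: "\<And>q. norm (F q) \<le> M"
    and y: "\<And>t. t \<in> {0..T} \<Longrightarrow> (y has_vector_derivative F (y t)) (at t within {0..T})"
    and h: "h > 0" "real n * h \<le> T"
  shows "dist (((\<lambda>q. q + h *\<^sub>R F q) ^^ n) (y 0)) (y (real n * h)) \<le> T * L * M * h * exp (L * T)"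
proof -
  let ?E = "\<lambda>q. q + h *\<^sub>R F q"
  have L0: "L \<ge> 0" by (rule lipschitz_on_nonneg[OF lip])
  have M0: "M \<ge> 0" using bd[of "y 0"] norm_ge_zero order_trans by blast
  have T0: "T \<ge> 0" using h by (meson mult_nonneg_nonneg less_imp_le of_nat_0_le_iff order_trans)
  have step: "dist (?E (y t)) (y (t + h)) \<le> L * M * h * h" if t: "t \<ge> 0" "t + h \<le> T" for t
  proof -
    have der: "(y has_vector_derivative F (y r)) (at r within {t..t+h})" if "r \<in> {t..t+h}" for r
      by (rule has_vector_derivative_within_subset[OF y]) (use t that in auto)
    have move: "norm (y r - y t) \<le> M * h" if r: "r \<in> {t..t+h}" for r
    proof -
      have "norm (y r - y t) \<le> M * norm (r - t)"
      proof (rule differentiable_bound[of "{t..t+h}" y "\<lambda>r x. x *\<^sub>R F (y r)"])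
        show "onorm (\<lambda>x. x *\<^sub>R F (y q)) \<le> M" for q
        proof (rule onorm_bound[OF M0])
          show "norm (x *\<^sub>R F (y q)) \<le> M * norm x" for x :: real
            using mult_right_mono[OF bd[of "y q"], of "\<bar>x\<bar>"] by (simp add: mult.commute)
        qed
      qed (use der r h in \<open>auto simp: has_vector_derivative_def\<close>)
      also have "\<dots> \<le> M * h" using r M0 by (simp add: mult_left_mono)
      finally show ?thesis .
    qed
    have "norm (y (t+h) - y t - (t + h - t) *\<^sub>R F (y t)) \<le> norm (t + h - t) * (L * (M * h))"
    proof (rule vector_differentiable_bound_linearization[of "{t..t+h}" y "\<lambda>r. F (y r)", OF der])
      show "closed_segment t (t+h) \<subseteq> {t..t+h}" using h by (simp add: closed_segment_eq_real_ivl)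
      show "norm (F (y r) - F (y t)) \<le> L * (M * h)" if "r \<in> {t..t+h}" for r
        using lipschitz_on_normD[OF lip, of "y r" "y t"] mult_left_mono[OF move[OF that] L0] by simp
    qed (use h in auto)
    then have "norm (y (t+h) - ?E (y t)) \<le> h * (L * (M * h))"
      using h by (simp add: algebra_simps)
    then show ?thesis by (simp add: dist_norm norm_minus_commute mult_ac)
  qed
  \<comment> \<open>The crude factor j (1 + h L)^j in place of the geometric sum avoids dividing by
    L, which may be 0.\<close>
  have "dist ((?E ^^ j) (y 0)) (y (real j * h)) \<le> real j * (L * M * h * h) * (1 + h * L) ^ j"
    if "real j * h \<le> T" for j
    using that
  proof (induction j)
    case (Suc j)
    have jh: "real j * h + h \<le> T" using Suc.prems by (simp add: algebra_simps)
    let ?p = "(?E ^^ j) (y 0)" and ?q = "y (real j * h)"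
    have IH: "dist ?p ?q \<le> real j * (L * M * h * h) * (1 + h * L) ^ j"
      by (rule Suc.IH) (use jh h in linarith)
    have "dist (?E ?p) (?E ?q) \<le> dist ?p ?q + h * dist (F ?p) (F ?q)"
    proof -
      have eq: "?E ?p - ?E ?q = (?p - ?q) + h *\<^sub>R (F ?p - F ?q)" by (simp add: algebra_simps)
      have "norm (?E ?p - ?E ?q) \<le> norm (?p - ?q) + norm (h *\<^sub>R (F ?p - F ?q))"
        unfolding eq by (rule norm_triangle_ineq)
      then show ?thesis using h by (simp only: norm_scaleR dist_norm abs_of_pos)
    qed
    also have "\<dots> \<le> dist ?p ?q + h * (L * dist ?p ?q)"
      using h lipschitz_onD[OF lip, of ?p ?q] by simp
    also have "\<dots> = (1 + h * L) * dist ?p ?q" by (simp add: algebra_simps)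
    also have "\<dots> \<le> (1 + h * L) * (real j * (L * M * h * h) * (1 + h * L) ^ j)"
      using h L0 by (intro mult_left_mono IH) auto
    finally have a: "dist (?E ?p) (?E ?q) \<le> real j * (L * M * h * h) * (1 + h * L) ^ Suc j"
      by (simp add: mult_ac)
    have "dist (?E ?q) (y (real j * h + h)) \<le> L * M * h * h * 1"
      using step[of "real j * h"] jh h by simp
    also have "\<dots> \<le> (L * M * h * h) * (1 + h * L) ^ Suc j"
      using h L0 M0 by (intro mult_left_mono one_le_power) auto
    finally have b: "dist (?E ?q) (y (real j * h + h)) \<le> (L * M * h * h) * (1 + h * L) ^ Suc j" .
    have "dist (?E ?p) (y (real j * h + h))
        \<le> real j * (L * M * h * h) * (1 + h * L) ^ Suc j + (L * M * h * h) * (1 + h * L) ^ Suc j"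
      using dist_triangle[of "?E ?p" "y (real j * h + h)" "?E ?q"] a b by linarith
    also have "\<dots> = real (Suc j) * (L * M * h * h) * (1 + h * L) ^ Suc j"
      by (simp add: algebra_simps)
    finally show ?case by (simp add: algebra_simps)
  qed simp
  from this[OF h(2)]
  have "dist ((?E ^^ n) (y 0)) (y (real n * h)) \<le> real n * h * (L * M * h) * (1 + h * L) ^ n"
    by (simp add: mult_ac)
  also have "\<dots> \<le> T * (L * M * h) * exp (L * T)"
  proof (intro mult_mono)
    have "(1 + h * L) ^ n \<le> exp (h * L) ^ n"
      using h L0 by (intro power_mono exp_ge_add_one_self) auto
    also have "\<dots> = exp (L * (real n * h))" by (simp add: mult_ac flip: exp_of_nat_mult)
    also have "\<dots> \<le> exp (L * T)" using h L0 by (simp add: mult_left_mono)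
    finally show "(1 + h * L) ^ n \<le> exp (L * T)" .
  qed (use h L0 M0 T0 in auto)
  finally show ?thesis by (simp add: mult_ac)
qed

subsection \<open>Area growth of Euler steps\<close>

lemma measure_image_ge_det:
  fixes E :: "real^'n::{finite,wellorder} \<Rightarrow> real^'n::_"
  assumes S: "compact S"
    and der: "\<And>x. x \<in> S \<Longrightarrow> (E has_derivative E' x) (at x within S)"
    and inj: "inj_on E S"
    and b: "\<And>x. x \<in> S \<Longrightarrow> b \<le> \<bar>det (matrix (E' x))\<bar>"
  shows "b * measure lebesgue S \<le> measure lebesgue (E ` S)"
proof -
  have contE: "continuous_on S E"
    using der by (meson continuous_on_eq_continuous_within has_derivative_continuous)
  have Sm: "S \<in> lmeasurable" "E ` S \<in> lmeasurable"
    using S contE by (auto intro: lmeasurable_compact compact_continuous_image)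
  have Sl: "S \<in> sets lebesgue" using Sm by auto
  have int: "(\<lambda>x. \<bar>det (matrix (E' x))\<bar>) integrable_on S"
    using measurable_differentiable_image_eq[OF Sl der inj] Sm by blast
  have "b * measure lebesgue S = integral S (\<lambda>x. b)"
    using lmeasure_integral[OF Sm(1)] integral_mult_right[of S b "\<lambda>_. 1"] by simp
  also have "\<dots> \<le> integral S (\<lambda>x. \<bar>det (matrix (E' x))\<bar>)"
    using Sm int b by (intro integral_le integrable_on_const) auto
  also have "\<dots> = measure lebesgue (E ` S)"
    using measure_differentiable_image_eq[OF Sl der inj int] by simp
  finally show ?thesis .
qed

lemma euler_step_inj:
  fixes F :: "'a::real_normed_vector \<Rightarrow> 'a"
  assumes lip: "L-lipschitz_on UNIV F" and h: "h > 0" "h * L < 1"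
  shows "inj (\<lambda>q. q + h *\<^sub>R F q)"
proof (rule injI)
  fix p q assume "p + h *\<^sub>R F p = q + h *\<^sub>R F q"
  then have "p - q = h *\<^sub>R (F q - F p)" by (simp add: algebra_simps)
  then have "norm (p - q) = h * norm (F q - F p)" using h by simp
  also have "\<dots> \<le> h * (L * norm (q - p))"
    using h lipschitz_on_normD[OF lip, of q p] by (intro mult_left_mono) auto
  finally have "(1 - h * L) * norm (p - q) \<le> 0" by (simp add: norm_minus_commute algebra_simps)
  then have "norm (p - q) \<le> 0" using h by (simp add: mult_le_0_iff)
  then show "p = q" by simp
qed

text \<open>In dimension two det(I + h A) = 1 + h tr A + h^2 det A. The trace contributes h k, and h
  D \<le> k/2 lets the quadratic term consume at most half of it.\<close>

lemma euler_step_measure: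
  fixes F :: "real^2 \<Rightarrow> real^2"
  assumes lip: "L-lipschitz_on UNIV F" and h: "h > 0" "h * L < 1" "h * D \<le> k / 2"
    and S: "compact S"
    and der: "\<And>q. q \<in> S \<Longrightarrow> (F has_derivative F' q) (at q)"
    and tr: "\<And>q. q \<in> S \<Longrightarrow> F' q (axis 1 1) $ 1 + F' q (axis 2 1) $ 2 = k"
    and det: "\<And>q. q \<in> S \<Longrightarrow> \<bar>det (matrix (F' q))\<bar> \<le> D"
  shows "(1 + h * (k / 2)) * measure lebesgue S \<le> measure lebesgue ((\<lambda>q. q + h *\<^sub>R F q) ` S)"
proof (rule measure_image_ge_det[OF S])
  fix q assume q: "q \<in> S"
  show "((\<lambda>q. q + h *\<^sub>R F q) has_derivative (\<lambda>x. x + h *\<^sub>R F' q x)) (at q within S)"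
    by (intro has_derivative_add has_derivative_ident has_derivative_scaleR_right
        has_derivative_at_withinI[OF der[OF q]])
  have "det (matrix (\<lambda>x. x + h *\<^sub>R F' q x))
      = 1 + h * (F' q (axis 1 1) $ 1 + F' q (axis 2 1) $ 2) + h * (h * det (matrix (F' q)))"
  proof -
    have comp: "matrix f $ i $ j = f (axis j 1) $ i" for f :: "real^2 \<Rightarrow> real^2" and i j
      by (simp add: matrix_def)
    have ax: "axis (1::2) (1::real) $ 1 = 1" "axis (1::2) (1::real) $ 2 = 0"
      "axis (2::2) (1::real) $ 1 = 0" "axis (2::2) (1::real) $ 2 = 1" by (auto simp: axis_def)
    show ?thesis
      unfolding det_2 comp vector_add_component vector_scaleR_component ax by (simp add: algebra_simps)
  qed
  moreover have "h * (h * - det (matrix (F' q))) \<le> h * (k / 2)"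
    using h det[OF q] by (intro mult_left_mono order_trans[OF _ h(3)]) auto
  ultimately have "1 + h * (k / 2) \<le> det (matrix (\<lambda>x. x + h *\<^sub>R F' q x))"
    using tr[OF q] by simp
  then show "1 + h * (k / 2) \<le> \<bar>det (matrix (\<lambda>x. x + h *\<^sub>R F' q x))\<bar>" by linarith
qed (use euler_step_inj[OF lip h(1,2)] in \<open>auto intro: inj_on_subset\<close>)

text \<open>A discrete form of Liouville's theorem: it needs no differentiability of the flow.\<close>

lemma area_growth:
  fixes F :: "real^2 \<Rightarrow> real^2"
  assumes lip: "L-lipschitz_on UNIV F" and bd: "\<And>q. norm (F q) \<le> M" and k: "k > 0"
    and T: "T > 0" and \<epsilon>: "\<epsilon> > 0" and B: "compact B"
    and flow: "\<And>p. p \<in> B \<Longrightarrow> \<exists>y. y 0 = p \<and>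
       (\<forall>t\<in>{0..T}. (y has_vector_derivative F (y t)) (at t within {0..T}) \<and> cball (y t) \<epsilon> \<subseteq> W)"
    and W: "bounded W"
    and der: "\<And>q. q \<in> W \<Longrightarrow> (F has_derivative F' q) (at q)"
    and tr: "\<And>q. q \<in> W \<Longrightarrow> F' q (axis 1 1) $ 1 + F' q (axis 2 1) $ 2 = k"
    and det: "\<And>q. q \<in> W \<Longrightarrow> \<bar>det (matrix (F' q))\<bar> \<le> D"
    and Q: "W \<subseteq> Q" "Q \<in> lmeasurable"
  shows "exp (k / 2 * T) * measure lebesgue B \<le> measure lebesgue Q"
proof -
  have contF: "continuous_on UNIV F" by (rule lipschitz_on_continuous_on[OF lip])
  define h where "h n = T / real n" for n
  have h0: "h \<longlonglongrightarrow> 0" unfolding h_def[abs_def] by (rule lim_const_over_n)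
  \<comment> \<open>For such n an Euler step is injective, its determinant is at least 1 + h k/2,
    and the iterates stay \<epsilon>-close to the exact solution.\<close>
  have ev: "\<forall>\<^sub>F n in sequentially. n > 0 \<and> h n * L < 1 \<and> h n * D < k / 2
      \<and> h n * (T * L * M * exp (L * T)) < \<epsilon>"
  proof -
    have "\<forall>\<^sub>F n in sequentially. h n * a < b" if "b > 0" for a b :: real
      using tendsto_mult_left_zero[OF h0, of a] that by (auto dest: order_tendstoD(2))
    from this[of 1 L] this[of "k / 2" D] this[OF \<epsilon>, of "T * L * M * exp (L * T)"] show ?thesis
      using k eventually_gt_at_top[of "0::nat"] by (intro eventually_conj) auto
  qed
  have bound: "(1 + (k / 2 * T) / real n) ^ n * measure lebesgue B \<le> measure lebesgue Q"
    if n: "n > 0" "h n * L < 1" "h n * D < k / 2" "h n * (T * L * M * exp (L * T)) < \<epsilon>" for n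
  proof -
    let ?h = "h n"
    let ?E = "\<lambda>q. q + ?h *\<^sub>R F q"
    have h: "?h > 0" "real n * ?h = T" using n T by (auto simp: h_def)
    have contE: "continuous_on UNIV ?E" by (intro continuous_intros contF)
    have comp: "compact ((?E ^^ j) ` B)" for j
    proof (induction j)
      case (Suc j)
      have "(?E ^^ Suc j) ` B = ?E ` ((?E ^^ j) ` B)" by (simp add: image_comp)
      then show ?case
        using compact_continuous_image[OF continuous_on_subset[OF contE] Suc] by simp
    qed (use B in simp)
    \<comment> \<open>The exact solution keeps its \<epsilon>-ball inside \<open>W\<close>, so the
      iterates remain where the trace of the derivative is known.\<close>
    have inW: "(?E ^^ j) ` B \<subseteq> W" if "j \<le> n" for j
    proof clarify
      fix p assume "p \<in> B"
      then obtain y where y: "y 0 = p" "\<And>t. t \<in> {0..T} \<Longrightarrow>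
          (y has_vector_derivative F (y t)) (at t within {0..T})"
        "\<And>t. t \<in> {0..T} \<Longrightarrow> cball (y t) \<epsilon> \<subseteq> W"
        using flow by blast
      have jT: "real j * ?h \<le> T"
        using that h mult_right_mono[of "real j" "real n" ?h] by simp
      have "dist ((?E ^^ j) (y 0)) (y (real j * ?h)) \<le> T * L * M * ?h * exp (L * T)"
        by (rule euler_method_error[OF lip bd y(2) h(1) jT])
      then have "(?E ^^ j) p \<in> cball (y (real j * ?h)) \<epsilon>"
        using n(4) y(1) by (simp add: dist_commute mult_ac)
      then show "(?E ^^ j) p \<in> W" using y(3)[of "real j * ?h"] jT h(1) by auto
    qed
    have "(1 + ?h * (k / 2)) ^ j * measure lebesgue B \<le> measure lebesgue ((?E ^^ j) ` B)"
      if "j \<le> n" for j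
      using that
    proof (induction j)
      case (Suc j)
      have "(1 + ?h * (k / 2)) ^ Suc j * measure lebesgue B
          \<le> (1 + ?h * (k / 2)) * measure lebesgue ((?E ^^ j) ` B)"
        using Suc h k by (simp add: mult.assoc mult_left_mono)
      also have "\<dots> \<le> measure lebesgue (?E ` ((?E ^^ j) ` B))"
        using inW[of j] Suc.prems n
        by (intro euler_step_measure[OF lip h(1) n(2) _ comp der tr det]) auto
      also have "?E ` ((?E ^^ j) ` B) = (?E ^^ Suc j) ` B" by (simp add: image_comp)
      finally show ?case .
    qed simp
    from this[of n] have "(1 + ?h * (k / 2)) ^ n * measure lebesgue B
        \<le> measure lebesgue ((?E ^^ n) ` B)" by simp
    also have "\<dots> \<le> measure lebesgue Q"
      using inW[of n] Q fmeasurableD[OF lmeasurable_compact[OF comp[of n]]]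
      by (intro measure_mono_fmeasurable) auto
    finally show ?thesis by (simp add: h_def mult.commute)
  qed
  have "(\<lambda>n. (1 + (k / 2 * T) / real n) ^ n * measure lebesgue B)
      \<longlonglongrightarrow> exp (k / 2 * T) * measure lebesgue B"
    by (intro tendsto_mult tendsto_exp_limit_sequentially tendsto_const)
  then show ?thesis
  proof (rule tendsto_upperbound)
    show "\<forall>\<^sub>F n in sequentially. (1 + (k / 2 * T) / real n) ^ n * measure lebesgue B
        \<le> measure lebesgue Q"
      using ev by eventually_elim (use bound in blast)
  qed simp
qed

subsection \<open>Bounded Lipschitz functions\<close>

text \<open>Boundedness is built in because the Lipschitz constant of a product is estimated through
  bounds of the factors. Hiding the constants turns closure under sums, products and C^1 maps into
  plain introduction rules.\<close>

definition bounded_lipschitz :: "('a::metric_space \<Rightarrow> real) \<Rightarrow> bool" where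
  "bounded_lipschitz g \<longleftrightarrow> (\<exists>L M. L-lipschitz_on UNIV g \<and> (\<forall>x. \<bar>g x\<bar> \<le> M))"

lemma bounded_lipschitzI:
  assumes "\<And>x y. \<bar>g x - g y\<bar> \<le> L * dist x y" "\<And>x. \<bar>g x\<bar> \<le> M"
  shows "bounded_lipschitz g"
proof -
  have "(max 0 L)-lipschitz_on UNIV g"
  proof (rule lipschitz_onI)
    show "dist (g x) (g y) \<le> max 0 L * dist x y" for x y
      using assms(1)[of x y] mult_right_mono[of L "max 0 L" "dist x y"] by (simp add: dist_real_def)
  qed simp
  then show ?thesis using assms(2) unfolding bounded_lipschitz_def by blast
qed

lemma bounded_lipschitzE:
  assumes "bounded_lipschitz g"
  obtains L M where "L \<ge> 0" "M \<ge> 0" "\<And>x y. \<bar>g x - g y\<bar> \<le> L * dist x y" "\<And>x. \<bar>g x\<bar> \<le> M"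
proof -
  obtain L M where L: "L-lipschitz_on UNIV g" and M: "\<And>x. \<bar>g x\<bar> \<le> M"
    using assms unfolding bounded_lipschitz_def by blast
  show ?thesis
  proof (rule that[of L "max 0 M"])
    show "\<bar>g x - g y\<bar> \<le> L * dist x y" for x y
      using lipschitz_onD[OF L, of x y] by (simp add: dist_real_def)
    show "\<bar>g x\<bar> \<le> max 0 M" for x using M[of x] by simp
  qed (use lipschitz_on_nonneg[OF L] in auto)
qed

lemma bounded_lipschitz_add:
  assumes "bounded_lipschitz f" "bounded_lipschitz g"
  shows "bounded_lipschitz (\<lambda>x. f x + g x)"
proof -
  obtain L M where f: "L \<ge> 0" "M \<ge> 0" "\<And>x y. \<bar>f x - f y\<bar> \<le> L * dist x y" "\<And>x. \<bar>f x\<bar> \<le> M"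
    using assms(1) by (rule bounded_lipschitzE) blast
  obtain L' M' where g: "L' \<ge> 0" "M' \<ge> 0" "\<And>x y. \<bar>g x - g y\<bar> \<le> L' * dist x y" "\<And>x. \<bar>g x\<bar> \<le> M'"
    using assms(2) by (rule bounded_lipschitzE) blast
  show ?thesis
  proof (rule bounded_lipschitzI)
    show "\<bar>f x + g x - (f y + g y)\<bar> \<le> (L + L') * dist x y" for x y
      using f(3)[of x y] g(3)[of x y] by (simp add: algebra_simps)
    show "\<bar>f x + g x\<bar> \<le> M + M'" for x using f(4)[of x] g(4)[of x] by linarith
  qed
qed

lemma bounded_lipschitz_mult:
  assumes "bounded_lipschitz f" "bounded_lipschitz g"
  shows "bounded_lipschitz (\<lambda>x. f x * g x)"
proof -
  obtain L M where f: "L \<ge> 0" "M \<ge> 0" "\<And>x y. \<bar>f x - f y\<bar> \<le> L * dist x y" "\<And>x. \<bar>f x\<bar> \<le> M"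
    using assms(1) by (rule bounded_lipschitzE) blast
  obtain L' M' where g: "L' \<ge> 0" "M' \<ge> 0" "\<And>x y. \<bar>g x - g y\<bar> \<le> L' * dist x y" "\<And>x. \<bar>g x\<bar> \<le> M'"
    using assms(2) by (rule bounded_lipschitzE) blast
  show ?thesis
  proof (rule bounded_lipschitzI)
    show "\<bar>f x * g x - f y * g y\<bar> \<le> (L * M' + M * L') * dist x y" for x y
    proof -
      have "\<bar>f x * g x - f y * g y\<bar> = \<bar>(f x - f y) * g x + f y * (g x - g y)\<bar>"
        by (simp add: algebra_simps)
      also have "\<dots> \<le> \<bar>f x - f y\<bar> * \<bar>g x\<bar> + \<bar>f y\<bar> * \<bar>g x - g y\<bar>"
        by (metis abs_mult abs_triangle_ineq)
      also have "\<dots> \<le> (L * dist x y) * M' + M * (L' * dist x y)"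
        by (intro add_mono mult_mono f g mult_nonneg_nonneg) auto
      finally show ?thesis by (simp add: algebra_simps)
    qed
    show "\<bar>f x * g x\<bar> \<le> M * M'" for x
      unfolding abs_mult by (intro mult_mono f g) auto
  qed
qed

lemma bounded_lipschitz_const: "bounded_lipschitz (\<lambda>x. c)"
  by (rule bounded_lipschitzI[of _ 0 "\<bar>c\<bar>"]) auto

lemma bounded_lipschitz_compose_C1:
  assumes f: "bounded_lipschitz f" and range: "\<And>x. f x \<in> {a..b}"
    and der: "\<And>z. z \<in> {a..b} \<Longrightarrow> (g has_real_derivative g' z) (at z within {a..b})"
    and cont: "continuous_on {a..b} g'"
  shows "bounded_lipschitz (\<lambda>x. g (f x))"
proof -
  obtain L M where L: "L \<ge> 0" "M \<ge> 0" "\<And>x y. \<bar>f x - f y\<bar> \<le> L * dist x y" "\<And>x. \<bar>f x\<bar> \<le> M"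
    using f by (rule bounded_lipschitzE) blast
  have "bounded (g' ` {a..b})" using cont by (intro compact_imp_bounded compact_continuous_image) auto
  then obtain B where B: "B > 0" "\<And>z. z \<in> {a..b} \<Longrightarrow> \<bar>g' z\<bar> \<le> B"
    unfolding bounded_pos by auto
  have "continuous_on {a..b} g"
    using der by (meson DERIV_continuous continuous_on_eq_continuous_within)
  then have "bounded (g ` {a..b})" by (intro compact_imp_bounded compact_continuous_image) auto
  then obtain N where N: "\<forall>z\<in>{a..b}. \<bar>g z\<bar> \<le> N" unfolding bounded_pos by auto
  have "\<bar>g (f x) - g (f y)\<bar> \<le> B * L * dist x y" for x y
  proof -
    have "norm (g (f x) - g (f y)) \<le> B * norm (f x - f y)"
      by (rule field_differentiable_bound[of "{a..b}"]) (use der B range in auto)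
    also have "\<dots> \<le> B * (L * dist x y)" using L(3)[of x y] B by (intro mult_left_mono) auto
    finally show ?thesis by simp
  qed
  then show ?thesis using N range by (intro bounded_lipschitzI[of _ "B * L" N]) auto
qed

lemma bounded_lipschitz_max:
  assumes "bounded_lipschitz f"
  shows "bounded_lipschitz (\<lambda>x. max c (f x))"
proof -
  obtain L M where f: "L \<ge> 0" "M \<ge> 0" "\<And>x y. \<bar>f x - f y\<bar> \<le> L * dist x y" "\<And>x. \<bar>f x\<bar> \<le> M"
    using assms(1) by (rule bounded_lipschitzE) blast
  show ?thesis
  proof (rule bounded_lipschitzI)
    show "\<bar>max c (f x) - max c (f y)\<bar> \<le> L * dist x y" for x y
      using f(3)[of x y] f(1) by (auto simp: max_def)
    show "\<bar>max c (f x)\<bar> \<le> max \<bar>c\<bar> M" for x using f(4)[of x] by (auto simp: max_def)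
  qed
qed

lemma bounded_lipschitz_clamp:
  fixes i :: 2
  shows "bounded_lipschitz (\<lambda>q::real^2. max (- R) (min R (q $ i)))"
proof (rule bounded_lipschitzI)
  show "\<bar>max (- R) (min R (p $ i)) - max (- R) (min R (q $ i))\<bar> \<le> 1 * dist p q" for p q :: "real^2"
    using dist_vec_nth_le[of p i q] by (auto simp: dist_real_def max_def min_def abs_if split: if_splits)
  show "\<bar>max (- R) (min R (p $ i))\<bar> \<le> \<bar>R\<bar>" for p :: "real^2" by (auto simp: max_def min_def)
qed

lemma bounded_lipschitz_vector2:
  fixes F :: "real^2 \<Rightarrow> real^2"
  assumes "bounded_lipschitz (\<lambda>q. F q $ 1)" "bounded_lipschitz (\<lambda>q. F q $ 2)"
  obtains L M where "L-lipschitz_on UNIV F" "\<And>q. norm (F q) \<le> M"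
proof -
  obtain L M where f: "L \<ge> 0" "M \<ge> 0" "\<And>x y. \<bar>F x $ 1 - F y $ 1\<bar> \<le> L * dist x y" "\<And>x. \<bar>F x $ 1\<bar> \<le> M"
    using assms(1) by (rule bounded_lipschitzE) blast
  obtain L' M' where g: "L' \<ge> 0" "M' \<ge> 0" "\<And>x y. \<bar>F x $ 2 - F y $ 2\<bar> \<le> L' * dist x y" "\<And>x. \<bar>F x $ 2\<bar> \<le> M'"
    using assms(2) by (rule bounded_lipschitzE) blast
  have l1: "norm x \<le> \<bar>x $ 1\<bar> + \<bar>x $ 2\<bar>" for x :: "real^2"
    using norm_le_l1_cart[of x] by (simp add: sum_2)
  show ?thesis
  proof (rule that[of "L + L'" "M + M'"])
    show "(L + L')-lipschitz_on UNIV F"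
    proof (rule lipschitz_onI)
      show "dist (F x) (F y) \<le> (L + L') * dist x y" for x y
        using l1[of "F x - F y"] f(3)[of x y] g(3)[of x y] by (simp add: dist_norm algebra_simps)
    qed (use f g in auto)
    show "norm (F q) \<le> M + M'" for q using l1[of "F q"] f(4)[of q] g(4)[of q] by linarith
  qed
qed

lemma has_vector_derivative_vec2:
  fixes q :: "real \<Rightarrow> real^2"
  shows "(q has_vector_derivative D) F \<longleftrightarrow>
    ((\<lambda>t. q t $ 1) has_real_derivative D $ 1) F \<and> ((\<lambda>t. q t $ 2) has_real_derivative D $ 2) F"
    (is "?l \<longleftrightarrow> ?r")
proof
  assume ?l
  then show ?r
    unfolding has_real_derivative_iff_has_vector_derivative
    by (auto intro: bounded_linear.has_vector_derivative[OF bounded_linear_vec_nth])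
next
  assume r: ?r
  have eq: "x = (x $ 1) *\<^sub>R axis 1 1 + (x $ 2) *\<^sub>R axis 2 1" for x :: "real^2"
    by (simp add: vec_eq_iff forall_2 axis_def)
  have "((\<lambda>t. (q t $ 1) *\<^sub>R axis 1 1 + (q t $ 2) *\<^sub>R axis 2 1 :: real^2) has_vector_derivative
      (D $ 1) *\<^sub>R axis 1 1 + (D $ 2) *\<^sub>R axis 2 1) F"
    using r unfolding has_real_derivative_iff_has_vector_derivative
    by (intro has_vector_derivative_add bounded_linear.has_vector_derivative[OF bounded_linear_scaleR_left])
      auto
  then show ?l using eq by simp
qed

lemma has_derivative_vec2:
  fixes F :: "'a::real_normed_vector \<Rightarrow> real^2"
  assumes "((\<lambda>t. F t $ 1) has_derivative (\<lambda>x. D x $ 1)) net"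
    "((\<lambda>t. F t $ 2) has_derivative (\<lambda>x. D x $ 2)) net"
  shows "(F has_derivative D) net"
proof -
  have eq: "x = (x $ 1) *\<^sub>R axis 1 1 + (x $ 2) *\<^sub>R axis 2 1" for x :: "real^2"
    by (simp add: vec_eq_iff forall_2 axis_def)
  have "((\<lambda>t. (F t $ 1) *\<^sub>R axis 1 1 + (F t $ 2) *\<^sub>R axis 2 (1::real) :: real^2) has_derivative
      (\<lambda>x. (D x $ 1) *\<^sub>R axis 1 1 + (D x $ 2) *\<^sub>R axis 2 (1::real))) net"
    using assms by (intro derivative_intros)
  then show ?thesis by (simp flip: eq)
qed

subsection \<open>The system in the coordinates \<open>(\<phi>, v)\<close> with \<open>v = w / x\<close>\<close>

text \<open>On the constraint surface \<open>1 / x\<^sup>2 = v\<^sup>2 + V \<phi>\<close>, which is the function \<open>G\<close> below.\<close>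

locale potential =
  fixes V V' V'' :: "real \<Rightarrow> real" and k m M R0 :: real
  assumes V_deriv: "\<And>x. (V has_real_derivative V' x) (at x)"
    and V'_deriv: "\<And>x. (V' has_real_derivative V'' x) (at x)"
    and V''_cont: "continuous_on UNIV V''"
    and k_pos: "k > 0"
    and V_ge: "\<And>x. V x \<ge> - m" and m_nonneg: "m \<ge> 0"
    and V'_bound: "\<And>x. \<bar>V' x\<bar> \<le> M * (1 + \<bar>V x\<bar>)"
    and V'_pos: "\<And>x. x \<ge> R0 \<Longrightarrow> V' x > 0" and V'_neg: "\<And>x. x \<le> - R0 \<Longrightarrow> V' x < 0"
begin

definition G :: "real^2 \<Rightarrow> real" where "G q = (q $ 2)\<^sup>2 + V (q $ 1)"

definition X :: "real^2 \<Rightarrow> real^2" where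
  "X q = vector [q $ 2 / sqrt (G q), k * q $ 2 - V' (q $ 1) / (2 * sqrt (G q))]"

text \<open>Derivatives are one-sided at the ends of the interval. A global trajectory is a curve
  with \<open>traj T q\<close> for every \<open>T\<close>; for negative \<open>T\<close> the
  condition is vacuous.\<close>

definition traj :: "real \<Rightarrow> (real \<Rightarrow> real^2) \<Rightarrow> bool" where
  "traj T q \<longleftrightarrow> (\<forall>t\<in>{0..T}. (q has_vector_derivative X (q t)) (at t within {0..T}))"

definition region :: "real \<Rightarrow> real \<Rightarrow> (real^2) set" where
  "region c R = {q. \<bar>q $ 1\<bar> \<le> R \<and> \<bar>q $ 2\<bar> \<le> R \<and> c \<le> G q}"

text \<open>An upper bound for |\<phi>| and |v| up to time \<open>T\<close> from |\<phi>| \<le> r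
  and c \<le> G \<le> g: \<phi> has speed |w| \<le> sqrt(1 + m/c), while v^2 \<le> G + m and G + m
  grows at rate at most 2 k.\<close>

definition reach :: "real \<Rightarrow> real \<Rightarrow> real \<Rightarrow> real \<Rightarrow> real" where
  "reach c r g T = max (r + sqrt (1 + m / c) * T) (sqrt ((g + m) * exp (2 * k * T)))"

lemma V_cont: "continuous_on S V" and V'_cont: "continuous_on S V'"
  using V_deriv V'_deriv
  by (meson DERIV_isCont continuous_at_imp_continuous_on)+

lemma G_cont: "continuous_on S G"
  unfolding G_def by (intro continuous_intros continuous_on_compose2[OF V_cont[of UNIV]]) auto

lemma traj_mono: "traj T q \<Longrightarrow> t \<le> T \<Longrightarrow> traj t q"
  unfolding traj_def by (auto intro: has_vector_derivative_within_subset[of q _ _ "{0..T}"])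

lemma traj_deriv:
  assumes "traj T q" "t \<in> {0..T}"
  shows "((\<lambda>t. q t $ 1) has_real_derivative q t $ 2 / sqrt (G (q t))) (at t within {0..T})"
    and "((\<lambda>t. q t $ 2) has_real_derivative
      k * q t $ 2 - V' (q t $ 1) / (2 * sqrt (G (q t)))) (at t within {0..T})"
    and "((\<lambda>t. G (q t)) has_real_derivative 2 * k * (q t $ 2)\<^sup>2) (at t within {0..T})"
proof -
  have "(q has_vector_derivative X (q t)) (at t within {0..T})"
    using assms by (auto simp: traj_def)
  then show 1: "((\<lambda>t. q t $ 1) has_real_derivative q t $ 2 / sqrt (G (q t))) (at t within {0..T})"
    and 2: "((\<lambda>t. q t $ 2) has_real_derivative
      k * q t $ 2 - V' (q t $ 1) / (2 * sqrt (G (q t)))) (at t within {0..T})"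
    by (auto simp: has_vector_derivative_vec2 X_def)
  have "((\<lambda>t. V (q t $ 1)) has_real_derivative V' (q t $ 1) * (q t $ 2 / sqrt (G (q t))))
      (at t within {0..T})"
    by (rule DERIV_chain2[OF V_deriv 1])
  then have "((\<lambda>t. (q t $ 2)\<^sup>2 + V (q t $ 1)) has_real_derivative
      2 * q t $ 2 * (k * q t $ 2 - V' (q t $ 1) / (2 * sqrt (G (q t))))
      + V' (q t $ 1) * (q t $ 2 / sqrt (G (q t)))) (at t within {0..T})"
    by (auto intro!: derivative_eq_intros 2)
  \<comment> \<open>The two terms with \<open>b\<close> are the Hamiltonian part and cancel. For c =
    0 both quotients are 0 by convention, so the identity persists.\<close>
  moreover have "2 * a * (k * a - b / (2 * c)) + b * (a / c) = 2 * k * a\<^sup>2" for a b c :: real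
    by (cases "c = 0") (auto simp: field_simps power2_eq_square)
  ultimately show "((\<lambda>t. G (q t)) has_real_derivative 2 * k * (q t $ 2)\<^sup>2) (at t within {0..T})"
    by (simp add: G_def[abs_def])
qed

lemma traj_G_mono:
  assumes "traj T q" "0 \<le> r" "r \<le> t" "t \<le> T"
  shows "G (q r) \<le> G (q t)"
  using deriv_within_nonneg_imp_le[OF traj_deriv(3)[OF assms(1)] _ assms(2-4)] k_pos by simp

lemma v_sq_le: "(q $ 2)\<^sup>2 \<le> G q + m"
  using V_ge[of "q $ 1"] by (simp add: G_def)

lemma traj_G_growth:
  assumes "traj T q" "t \<in> {0..T}"
  shows "G (q t) + m \<le> (G (q 0) + m) * exp (2 * k * t)"
proof (rule gronwall_le[where g = "\<lambda>t. G (q t) + m" and T=T])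
  fix r assume r: "r \<in> {0..T}"
  show "((\<lambda>t. G (q t) + m) has_real_derivative 2 * k * (q r $ 2)\<^sup>2) (at r within {0..T})"
    using DERIV_add[OF traj_deriv(3)[OF assms(1) r] DERIV_const[of m]] by simp
  show "2 * k * (q r $ 2)\<^sup>2 \<le> 2 * k * (G (q r) + m)"
    using v_sq_le[of "q r"] k_pos by simp
qed (use assms in auto)

text \<open>The quotient is w, which is also the speed of \<phi>, and w^2 = 1 - V/G \<le> 1 +
  m/G.\<close>

lemma w_le:
  assumes "0 < c" "c \<le> G q"
  shows "\<bar>q $ 2 / sqrt (G q)\<bar> \<le> sqrt (1 + m / c)"
proof (rule real_le_rsqrt)
  have "(q $ 2)\<^sup>2 / G q \<le> (G q + m) / G q"
    using assms v_sq_le by (intro divide_right_mono) auto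
  also have "\<dots> = 1 + m / G q" using assms by (simp add: field_simps)
  also have "\<dots> \<le> 1 + m / c" using assms m_nonneg by (intro add_left_mono divide_left_mono) auto
  finally show "\<bar>q $ 2 / sqrt (G q)\<bar>\<^sup>2 \<le> 1 + m / c" using assms by (simp add: power_divide)
qed

lemma traj_phi_bound:
  assumes q: "traj T q" and c: "0 < c" "c \<le> G (q 0)" and t: "t \<in> {0..T}"
  shows "\<bar>q t $ 1 - q 0 $ 1\<bar> \<le> sqrt (1 + m / c) * t"
proof -
  have "norm (q t $ 1 - q 0 $ 1) \<le> sqrt (1 + m / c) * norm (t - 0)"
  proof (rule field_differentiable_bound[of "{0..T}" "\<lambda>t. q t $ 1"])
    fix r assume r: "r \<in> {0..T}"
    show "((\<lambda>t. q t $ 1) has_real_derivative q r $ 2 / sqrt (G (q r))) (at r within {0..T})"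
      by (rule traj_deriv[OF q r])
    have "G (q 0) \<le> G (q r)" by (rule traj_G_mono[OF q]) (use r in auto)
    then show "norm (q r $ 2 / sqrt (G (q r))) \<le> sqrt (1 + m / c)"
      using w_le[of c "q r"] c by simp
  qed (use t in auto)
  then show ?thesis using t by simp
qed

lemma traj_in_region:
  assumes q: "traj T q" and c: "0 < c" "c \<le> G (q 0)" and r: "\<bar>q 0 $ 1\<bar> \<le> r" and g: "G (q 0) \<le> g"
    and t: "t \<in> {0..T}"
  shows "q t \<in> region c (reach c r g T)"
proof -
  have "sqrt (1 + m / c) * t \<le> sqrt (1 + m / c) * T"
    using t c m_nonneg by (intro mult_left_mono) auto
  then have 1: "\<bar>q t $ 1\<bar> \<le> r + sqrt (1 + m / c) * T"
    using traj_phi_bound[OF q c t] r by linarith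
  have "(q t $ 2)\<^sup>2 \<le> (G (q 0) + m) * exp (2 * k * t)"
    using v_sq_le[of "q t"] traj_G_growth[OF q t] by linarith
  also have "\<dots> \<le> (g + m) * exp (2 * k * T)"
    using t c g m_nonneg k_pos by (intro mult_mono) auto
  finally have 2: "\<bar>q t $ 2\<bar> \<le> sqrt ((g + m) * exp (2 * k * T))"
    by (intro real_le_rsqrt) simp
  have "c \<le> G (q t)" using traj_G_mono[OF q, of 0 t] t c by simp
  then show ?thesis using 1 2 by (simp add: region_def reach_def le_max_iff_disj)
qed

lemma region_closed: "closed (region c R)"
proof -
  have "region c R = {q. \<bar>q $ 1\<bar> \<le> R} \<inter> {q. \<bar>q $ 2\<bar> \<le> R} \<inter> {q. c \<le> G q}"
    by (auto simp: region_def)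
  then show ?thesis
    by (auto intro!: closed_Int closed_Collect_le continuous_intros G_cont)
qed

text \<open>Clamping the coordinates to [-R, R] and replacing G by its maximum with \<open>c\<close>
  removes both the growth and the singularity of \<open>X\<close>, and changes nothing on
  \<open>region c R\<close>.\<close>

lemma truncation:
  assumes "c > 0"
  obtains F L B where "L-lipschitz_on UNIV F" "\<And>q. norm (F q) \<le> B"
    "\<And>q. q \<in> region c R \<Longrightarrow> F q = X q"
proof -
  define a where "a i q = max (- R) (min R (q $ i))" for i and q :: "real^2"
  define g where "g q = max c ((a 2 q)\<^sup>2 + V (a 1 q))" for q
  define F :: "real^2 \<Rightarrow> real^2" where
    "F q = vector [a 2 q * (1 / sqrt (g q)), k * a 2 q + (- 1/2 * V' (a 1 q)) * (1 / sqrt (g q))]" for q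
  have a: "bounded_lipschitz (a i)" for i
    unfolding a_def by (rule bounded_lipschitz_clamp)
  \<comment> \<open>\<open>R\<close> may be negative; the clamp is then constantly -R, whence the
    absolute values.\<close>
  have range: "a i q \<in> {-\<bar>R\<bar>..\<bar>R\<bar>}" for i q by (auto simp: a_def max_def min_def)
  have Va: "bounded_lipschitz (\<lambda>q. V (a 1 q))"
    by (rule bounded_lipschitz_compose_C1[OF a range]) (auto intro: V_deriv has_field_derivative_at_within V'_cont)
  have V'a: "bounded_lipschitz (\<lambda>q. V' (a 1 q))"
    by (rule bounded_lipschitz_compose_C1[OF a range, of _ V''])
      (auto intro: V'_deriv has_field_derivative_at_within continuous_on_subset[OF V''_cont])
  have g: "bounded_lipschitz g"
    unfolding g_def power2_eq_square
    by (intro bounded_lipschitz_max bounded_lipschitz_add bounded_lipschitz_mult a Va)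
  then obtain Bg where Bg: "\<And>q. \<bar>g q\<bar> \<le> Bg" unfolding bounded_lipschitz_def by blast
  have gr: "g q \<in> {c..Bg}" for q using Bg[of q] by (auto simp: g_def)
  have inv: "bounded_lipschitz (\<lambda>q. 1 / sqrt (g q))"
  proof (rule bounded_lipschitz_compose_C1[OF g gr, where g = "\<lambda>z. 1 / sqrt z"
        and g' = "\<lambda>z. - inverse (sqrt z) / 2 / z"])
    fix z assume z: "z \<in> {c..Bg}"
    then show "((\<lambda>z. 1 / sqrt z) has_real_derivative - inverse (sqrt z) / 2 / z) (at z within {c..Bg})"
      using assms by (auto intro!: derivative_eq_intros simp: field_simps)
  next
    show "continuous_on {c..Bg} (\<lambda>z. - inverse (sqrt z) / 2 / z)"
      using assms by (intro continuous_intros) auto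
  qed
  have "bounded_lipschitz (\<lambda>q. F q $ 1)"
    unfolding F_def vector_2 by (intro bounded_lipschitz_mult a inv)
  moreover have "bounded_lipschitz (\<lambda>q. F q $ 2)"
    unfolding F_def vector_2
    by (intro bounded_lipschitz_add bounded_lipschitz_mult bounded_lipschitz_const a V'a inv)
  ultimately obtain L B where LB: "L-lipschitz_on UNIV F" "\<And>q. norm (F q) \<le> B"
    using bounded_lipschitz_vector2[of F] by blast
  show ?thesis
  proof (rule that[OF LB])
    fix q assume q: "q \<in> region c R"
    then have "a 1 q = q $ 1" "a 2 q = q $ 2" by (auto simp: region_def a_def max_def min_def)
    moreover from this have "g q = G q" using q by (simp add: g_def G_def region_def)
    ultimately show "F q = X q" by (simp add: F_def X_def)
  qed
qed

text \<open>All trajectories starting in the given box solve the same truncated equation up to time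
  \<open>T\<close>, so one \<open>L\<close> serves them all. This uniformity gives continuous
  dependence on the initial data.\<close>

lemma traj_diff_bound:
  assumes "c > 0"
  obtains L where "\<And>q q' t. traj T q \<Longrightarrow> traj T q' \<Longrightarrow> c \<le> G (q 0) \<Longrightarrow> c \<le> G (q' 0) \<Longrightarrow>
     \<bar>q 0 $ 1\<bar> \<le> r \<Longrightarrow> \<bar>q' 0 $ 1\<bar> \<le> r \<Longrightarrow> G (q 0) \<le> g \<Longrightarrow> G (q' 0) \<le> g \<Longrightarrow> t \<in> {0..T} \<Longrightarrow>
     dist (q t) (q' t) \<le> dist (q 0) (q' 0) * exp (L * t)"
proof -
  obtain F L B where F: "L-lipschitz_on UNIV F"
    "\<And>q. q \<in> region c (reach c r g T) \<Longrightarrow> F q = X q"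
    using truncation[OF assms] by metis
  have Fder: "(q has_vector_derivative F (q t)) (at t within {0..T})"
    if "traj T q" "c \<le> G (q 0)" "\<bar>q 0 $ 1\<bar> \<le> r" "G (q 0) \<le> g" "t \<in> {0..T}" for q t
    using that F(2)[OF traj_in_region[OF that(1) assms that(2-5)]] by (simp add: traj_def)
  show ?thesis
    by (rule that, rule lipschitz_ode_diff_bound[OF F(1)]) (use Fder in auto)
qed

lemma traj_unique:
  assumes q: "traj T q" "G (q 0) > 0" and q': "traj T q'" and eq: "q 0 = q' 0" and t: "t \<in> {0..T}"
  shows "q t = q' t"
proof -
  obtain L where "dist (q t) (q' t) \<le> dist (q 0) (q' 0) * exp (L * t)"
    using traj_diff_bound[OF q(2), of T "\<bar>q 0 $ 1\<bar>" "G (q 0)"] q q' eq t by (metis order_refl)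
  then show ?thesis using eq by simp
qed

text \<open>The a priori bounds hold for trajectories, whereas the curve at hand solves only a
  truncated equation. The truncation therefore leaves a margin (G p / 2 below, R + 1 outside) around
  the region that the bounds predict, and continuous induction shows that the margin is never
  entered.\<close>

lemma traj_exists_Icc:
  assumes c: "G p > 0"
  obtains q where "q 0 = p" "traj T q"
proof (cases "T \<ge> 0")
  case False
  then show ?thesis using that[of "\<lambda>_. p"] by (simp add: traj_def)
next
  case T: True
  define R where "R = reach (G p) \<bar>p $ 1\<bar> (G p) T"
  obtain F L B where F: "L-lipschitz_on UNIV F" "\<And>q. norm (F q) \<le> B"
    "\<And>q. q \<in> region (G p / 2) (R + 1) \<Longrightarrow> F q = X q"
    using truncation[of "G p / 2" "R + 1"] c by (metis half_gt_zero)
  obtain y where y: "y 0 = p"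
    "\<And>t. t \<ge> 0 \<Longrightarrow> (y has_vector_derivative F (y t)) (at t within {0..})"
    using lipschitz_ode_exists[OF F(1,2)] by blast
  define U where "U = {q. \<bar>q $ 1\<bar> < R + 1} \<inter> {q. \<bar>q $ 2\<bar> < R + 1} \<inter> {q. G p / 2 < G q}"
  have U: "open U" unfolding U_def by (intro open_Int open_Collect_less continuous_intros G_cont)
  have UX: "F q = X q" if "q \<in> U" for q by (rule F(3)) (use that in \<open>auto simp: U_def region_def\<close>)
  have KU: "region (G p) R \<subseteq> U" using c by (auto simp: U_def region_def)
  have step: "traj t y" if t: "t \<in> {0..T}" and "\<And>r. r \<in> {0..t} \<Longrightarrow> y r \<in> U" for t
    unfolding traj_def
  proof
    fix r assume r: "r \<in> {0..t}"
    have "(y has_vector_derivative F (y r)) (at r within {0..t})"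
      by (rule has_vector_derivative_within_subset[OF y(2)]) (use r in auto)
    then show "(y has_vector_derivative X (y r)) (at r within {0..t})" using UX that(2)[OF r] by simp
  qed
  have cont: "continuous_on {0..T} y"
    using y(2) by (meson atLeastAtMost_iff atLeast_iff continuous_on_eq_continuous_within
      has_vector_derivative_continuous continuous_within_subset has_vector_derivative_within_subset
      subsetI)
  have Rmono: "reach (G p) \<bar>p $ 1\<bar> (G p) t \<le> R" if t: "t \<in> {0..T}" for t
    unfolding R_def reach_def using t c m_nonneg k_pos
    by (intro max.mono add_mono mult_mono real_sqrt_le_mono) auto
  have p0: "p \<in> region (G p) R"
  proof -
    have "R \<ge> \<bar>p $ 1\<bar>" "R \<ge> sqrt (G p + m)"
      using T c m_nonneg k_pos unfolding R_def reach_def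
      by (auto simp: le_max_iff_disj intro!: disjI2)
    moreover have "\<bar>p $ 2\<bar> \<le> sqrt (G p + m)" using v_sq_le[of p] by (intro real_le_rsqrt) simp
    ultimately show ?thesis by (auto simp: region_def)
  qed
  have "y t \<in> region (G p) R" if t: "t \<in> {0..T}" for t
  proof (rule continuous_induction_Icc[OF cont region_closed U KU _ _ t])
    show "y 0 \<in> region (G p) R" using p0 y by simp
    fix r assume r: "r \<in> {0..T}" and "\<And>q. q \<in> {0..r} \<Longrightarrow> y q \<in> U"
    then have "traj r y" by (rule step)
    then have "y r \<in> region (G p) (reach (G p) \<bar>p $ 1\<bar> (G p) r)"
      using traj_in_region[of r y "G p" "\<bar>p $ 1\<bar>" "G p" r] y(1) c r by simp
    then show "y r \<in> region (G p) R" using Rmono[OF r] by (auto simp: region_def)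
  qed
  then have "traj T y" using KU T by (intro step) auto
  then show ?thesis using that y(1) by blast
qed

lemma traj_exists:
  assumes p: "G p > 0"
  obtains q where "q 0 = p" "\<And>T. traj T q"
proof -
  have "\<exists>q. q 0 = p \<and> traj (real n) q" for n using traj_exists_Icc[OF p] by metis
  then obtain Q where Q: "\<And>n. Q n 0 = p" "\<And>n. traj (real n) (Q n)" by metis
  \<comment> \<open>Solutions on the intervals [0, n] are glued; by uniqueness every n \<ge> t gives
    the same value at t.\<close>
  define q where "q t = Q (nat \<lceil>t\<rceil>) t" for t
  have eq: "q t = Q n t" if "0 \<le> t" "t \<le> real n" for t n
  proof -
    have "nat \<lceil>t\<rceil> \<le> n" using that by (simp add: nat_le_iff ceiling_le_iff)
    then have "real (nat \<lceil>t\<rceil>) \<le> real n" by simp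
    then show ?thesis
      unfolding q_def
      using traj_unique[OF Q(2)[of "nat \<lceil>t\<rceil>"] _ traj_mono[OF Q(2)[of n]], of t] that p
      by (simp add: Q(1) of_nat_ceiling)
  qed
  show ?thesis
  proof (rule that[of q])
    show "q 0 = p" using eq[of 0 0] Q(1) by simp
    fix T
    obtain n where n: "T \<le> real n" using real_arch_simple by blast
    show "traj T q"
      unfolding traj_def
    proof
      fix t assume t: "t \<in> {0..T}"
      have "(Q n has_vector_derivative X (Q n t)) (at t within {0..T})"
        using traj_mono[OF Q(2) n] t by (simp add: traj_def)
      moreover have "Q n t = q t" using eq[of t n] t n by simp
      ultimately have "(Q n has_vector_derivative X (q t)) (at t within {0..T})" by simp
      then show "(q has_vector_derivative X (q t)) (at t within {0..T})"
        by (rule has_vector_derivative_transform[OF t, rotated]) (use n eq in auto)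
    qed
  qed
qed

end

section \<open>Levels of monotone functions and Barbalat's argument\<close>

text \<open>A monotone function bounded by B stays away from every level above B + 1; an unbounded
  one finally exceeds any level by more than 1. The first case matters: near a finite limit of
  \<open>g\<close> no uniform escape could be expected.\<close>

lemma eventually_escapes_level:
  fixes g :: "real \<Rightarrow> real"
  assumes mono: "\<And>x y. R \<le> x \<Longrightarrow> x \<le> y \<Longrightarrow> g x \<le> g y"
  obtains C where "\<And>L. L > C \<Longrightarrow> \<exists>N. \<forall>x>N. \<bar>g x - L\<bar> > 1"
proof (cases "\<exists>B. \<forall>x\<ge>R. g x \<le> B")
  case True
  then obtain B where B: "\<And>x. x \<ge> R \<Longrightarrow> g x \<le> B" by blast
  show ?thesis
  proof (rule that[of "B + 1"])
    fix L assume "L > B + 1"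
    then have "\<bar>g x - L\<bar> > 1" if "x > R" for x using B[of x] that by simp
    then show "\<exists>N. \<forall>x>N. \<bar>g x - L\<bar> > 1" by blast
  qed
next
  case False
  show ?thesis
  proof (rule that[of 0])
    fix L :: real
    obtain x0 where x0: "x0 \<ge> R" "g x0 > L + 1" using False by (meson not_le)
    have "\<bar>g x - L\<bar> > 1" if "x > x0" for x using mono[OF x0(1), of x] x0(2) that by simp
    then show "\<exists>N. \<forall>x>N. \<bar>g x - L\<bar> > 1" by blast
  qed
qed

text \<open>If |v| \<ge> e at some time, the Lipschitz bound keeps |v| \<ge> e/2 for a further time
  \<delta>, during which \<open>g\<close> gains at least k (e/2)^2 \<delta>. At late times a
  convergent \<open>g\<close> cannot gain that much.\<close>

lemma barbalat_square:
  fixes g v :: "real \<Rightarrow> real"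
  assumes der: "\<And>T t. t \<in> {0..T} \<Longrightarrow> (g has_real_derivative k * (v t)\<^sup>2) (at t within {0..T})"
    and k: "k > 0" and lim: "(g \<longlongrightarrow> L) at_top"
    and lip: "\<And>r t. 0 \<le> r \<Longrightarrow> r \<le> t \<Longrightarrow> \<bar>v t - v r\<bar> \<le> D * (t - r)"
  shows "(v \<longlongrightarrow> 0) at_top"
proof (rule tendstoI)
  fix e :: real assume e: "e > 0"
  have D0: "D \<ge> 0" using lip[of 0 1] by simp
  \<comment> \<open>The summand 1 covers D = 0.\<close>
  define \<delta> where "\<delta> = e / (2 * (D + 1))"
  have \<delta>: "\<delta> > 0" "D * \<delta> \<le> e / 2" using e D0 by (auto simp: \<delta>_def field_simps)
  define \<eta> where "\<eta> = k * (e / 2)\<^sup>2 * \<delta>"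
  have \<eta>: "\<eta> > 0" using e k \<delta> by (simp add: \<eta>_def)
  have "((\<lambda>t. g (t + \<delta>) - g t) \<longlongrightarrow> L - L) at_top"
  proof (intro tendsto_diff lim)
    show "((\<lambda>t. g (t + \<delta>)) \<longlongrightarrow> L) at_top"
      using filterlim_compose[OF lim filterlim_tendsto_add_at_top[OF tendsto_const[of \<delta>] filterlim_ident]]
      by (simp add: add.commute)
  qed
  then have "\<forall>\<^sub>F t in at_top. g (t + \<delta>) - g t < \<eta>" using \<eta> by (auto dest: order_tendstoD(2))
  then show "\<forall>\<^sub>F t in at_top. dist (v t) 0 < e"
    using eventually_ge_at_top[of 0]
  proof eventually_elim
    fix t assume t: "g (t + \<delta>) - g t < \<eta>" "0 \<le> t"
    show "dist (v t) 0 < e"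
    proof (rule ccontr)
      assume "\<not> dist (v t) 0 < e"
      then have vt: "\<bar>v t\<bar> \<ge> e" by simp
      have big: "(e / 2)\<^sup>2 \<le> (v r)\<^sup>2" if r: "r \<in> {t..t + \<delta>}" for r
      proof -
        have "D * (r - t) \<le> D * \<delta>" using r D0 by (intro mult_left_mono) auto
        then have "\<bar>v r - v t\<bar> \<le> e / 2" using lip[of t r] r t \<delta> by auto
        then have "e / 2 \<le> \<bar>v r\<bar>" using vt by linarith
        then show ?thesis using e by (metis abs_le_square_iff abs_of_pos half_gt_zero)
      qed
      have "g t - k * (e / 2)\<^sup>2 * t \<le> g (t + \<delta>) - k * (e / 2)\<^sup>2 * (t + \<delta>)"
      proof (rule deriv_within_nonneg_imp_le[where a=t and b="t + \<delta>"
            and g="\<lambda>t. g t - k * (e / 2)\<^sup>2 * t" and g'="\<lambda>r. k * (v r)\<^sup>2 - k * (e / 2)\<^sup>2"])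
        fix r assume r: "r \<in> {t..t + \<delta>}"
        have "(g has_real_derivative k * (v r)\<^sup>2) (at r within {t..t + \<delta>})"
          by (rule DERIV_subset[OF der[of r "t + \<delta>"]]) (use r t in auto)
        then show "((\<lambda>t. g t - k * (e / 2)\<^sup>2 * t) has_real_derivative k * (v r)\<^sup>2 - k * (e / 2)\<^sup>2)
            (at r within {t..t + \<delta>})"
          by (auto intro!: derivative_eq_intros)
        show "0 \<le> k * (v r)\<^sup>2 - k * (e / 2)\<^sup>2" using big[OF r] k by simp
      qed (use \<delta> in auto)
      then show False using t(1) by (simp add: \<eta>_def algebra_simps)
    qed
  qed
qed

context potential
begin

subsection \<open>Bounded trajectories\<close>

text \<open>If V has a finite limit at an end, V' may tend to 0 along levels near that limit;
  \<open>C\<close> lies above all such levels and above V on [-R0, R0] by more than the width of the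
  band. The band |V - L| \<le> 1 is then compact and contains no critical point, so |V'| has a
  positive minimum on it.\<close>

lemma regular_levels:
  obtains C where "\<And>L. L > C \<Longrightarrow>
    \<exists>N \<mu>. \<mu> > 0 \<and> (\<forall>x. \<bar>V x - L\<bar> \<le> 1 \<longrightarrow> \<bar>x\<bar> \<le> N \<and> \<bar>V' x\<bar> \<ge> \<mu>)"
proof -
  have mono: "V x \<le> V y" if "R0 \<le> x" "x \<le> y" for x y
    by (rule deriv_within_nonneg_imp_le[OF has_field_derivative_at_within[OF V_deriv], of x y])
      (use that V'_pos in \<open>auto intro: less_imp_le\<close>)
  have anti: "V (- x) \<le> V (- y)" if "R0 \<le> x" "x \<le> y" for x y
  proof -
    have "- V (- y) \<le> - V (- x)"
      by (rule deriv_within_nonneg_imp_le[OF DERIV_minus[OF has_field_derivative_at_within[OF V_deriv]],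
            of "-y" "-x"])
        (use that in \<open>auto intro!: less_imp_le[OF V'_neg]\<close>)
    then show ?thesis by simp
  qed
  obtain C1 where C1: "\<And>L. L > C1 \<Longrightarrow> \<exists>N. \<forall>x>N. \<bar>V x - L\<bar> > 1"
    using eventually_escapes_level[of R0 V] mono by blast
  obtain C2 where C2: "\<And>L. L > C2 \<Longrightarrow> \<exists>N. \<forall>x>N. \<bar>V (- x) - L\<bar> > 1"
    using eventually_escapes_level[of R0 "\<lambda>x. V (- x)"] anti by blast
  have "bounded (V ` {-R0..R0})"
    by (intro compact_imp_bounded compact_continuous_image V_cont) auto
  then obtain B where B: "\<forall>x\<in>{-R0..R0}. \<bar>V x\<bar> \<le> B" unfolding bounded_iff by auto
  show ?thesis
  proof (rule that[of "max C1 (max C2 (B + 1))"])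
    fix L assume L: "max C1 (max C2 (B + 1)) < L"
    obtain N1 where N1: "\<And>x. x > N1 \<Longrightarrow> \<bar>V x - L\<bar> > 1" using C1[of L] L by auto
    obtain N2 where N2: "\<And>x. x > N2 \<Longrightarrow> \<bar>V (- x) - L\<bar> > 1" using C2[of L] L by auto
    define N where "N = max N1 N2"
    have N: "\<bar>x\<bar> \<le> N" if "\<bar>V x - L\<bar> \<le> 1" for x
      using N1[of x] N2[of "- x"] that unfolding N_def by fastforce
    define Z where "Z = {-N..N} \<inter> {x. \<bar>V x - L\<bar> \<le> 1}"
    have "compact Z"
      unfolding Z_def by (intro compact_Int_closed closed_Collect_le continuous_intros V_cont) auto
    moreover have ne: "V' x \<noteq> 0" if "x \<in> Z" for x
    proof -
      have "x \<notin> {-R0..R0}" using that L B by (force simp: Z_def)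
      then show ?thesis using V'_pos[of x] V'_neg[of x] by force
    qed
    ultimately obtain \<mu> where "\<mu> > 0" "\<And>x. x \<in> Z \<Longrightarrow> \<bar>V' x\<bar> \<ge> \<mu>"
    proof (cases "Z = {}")
      case False
      have "continuous_on Z (\<lambda>x. \<bar>V' x\<bar>)" by (intro continuous_intros V'_cont)
      then obtain z where "z \<in> Z" "\<And>x. x \<in> Z \<Longrightarrow> \<bar>V' z\<bar> \<le> \<bar>V' x\<bar>"
        using continuous_attains_inf[OF \<open>compact Z\<close> False] by blast
      then show ?thesis using that[of "\<bar>V' z\<bar>"] ne by auto
    qed (use that[of 1] in auto)
    moreover have "x \<in> Z" if "\<bar>V x - L\<bar> \<le> 1" for x
      using N[OF that] that by (simp add: Z_def abs_le_iff)
    ultimately show "\<exists>N \<mu>. \<mu> > 0 \<and> (\<forall>x. \<bar>V x - L\<bar> \<le> 1 \<longrightarrow> \<bar>x\<bar> \<le> N \<and> \<bar>V' x\<bar> \<ge> \<mu>)"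
      using N by blast
  qed
qed

text \<open>Barbalat's argument for G, whose derivative is 2 k v^2; it needs v' bounded. As \<phi>
  is not known to be bounded, V'(\<phi>) is controlled through \<open>V'_bound\<close> and |V| \<le>
  2 g + m, the latter from V = G - v^2.\<close>

lemma bounded_traj_v_tendsto_0:
  assumes q: "\<And>T. traj T q" and G0: "G (q 0) > 0" and g: "\<And>t. t \<ge> 0 \<Longrightarrow> G (q t) \<le> g"
    and lim: "((\<lambda>t. G (q t)) \<longlongrightarrow> L) at_top"
  shows "((\<lambda>t. q t $ 2) \<longlongrightarrow> 0) at_top"
proof -
  define a where "a = sqrt (g + m)"
  define D where "D = k * a + M * (1 + 2 * g + m) / (2 * sqrt (G (q 0)))"
  have "\<bar>V' 0\<bar> \<le> M * (1 + \<bar>V 0\<bar>)" by (rule V'_bound)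
  then have M0: "M \<ge> 0" by (smt (verit) mult_neg_pos)
  have v: "\<bar>q t $ 2\<bar> \<le> a" if "t \<ge> 0" for t
    unfolding a_def using v_sq_le[of "q t"] g[OF that] by (intro real_le_rsqrt) simp
  have D: "\<bar>k * q t $ 2 - V' (q t $ 1) / (2 * sqrt (G (q t)))\<bar> \<le> D" if t: "t \<ge> 0" for t
  proof -
    have Gt: "G (q 0) \<le> G (q t)" using traj_G_mono[OF q, of 0 t t] t by simp
    have "(q t $ 2)\<^sup>2 \<le> g + m" using v_sq_le[of "q t"] g[OF t] by simp
    moreover have "V (q t $ 1) = G (q t) - (q t $ 2)\<^sup>2" by (simp add: G_def)
    ultimately have "\<bar>V (q t $ 1)\<bar> \<le> 2 * g + m" using g[OF t] Gt G0 m_nonneg zero_le_power2[of "q t $ 2"] by linarith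
    then have "M * (1 + \<bar>V (q t $ 1)\<bar>) \<le> M * (1 + 2 * g + m)"
      using M0 by (intro mult_left_mono) auto
    then have V': "\<bar>V' (q t $ 1)\<bar> \<le> M * (1 + 2 * g + m)" using V'_bound[of "q t $ 1"] by linarith
    have "\<bar>V' (q t $ 1) / (2 * sqrt (G (q t)))\<bar> \<le> M * (1 + 2 * g + m) / (2 * sqrt (G (q 0)))"
      unfolding abs_divide using V' Gt G0 by (intro frac_le) auto
    moreover have "\<bar>k * q t $ 2\<bar> \<le> k * a" using v[OF t] k_pos by (simp add: abs_mult)
    ultimately show ?thesis unfolding D_def by linarith
  qed
  show ?thesis
  proof (rule barbalat_square[where k = "2 * k" and D = D, OF traj_deriv(3)[OF q] _ lim])
    show "2 * k > 0" using k_pos by simp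
    fix r t :: real assume rt: "0 \<le> r" "r \<le> t"
    have "norm (q t $ 2 - q r $ 2) \<le> D * norm (t - r)"
      by (rule field_differentiable_bound[of "{0..t}", OF _ traj_deriv(2)[OF q]]) (use D rt in auto)
    then show "\<bar>q t $ 2 - q r $ 2\<bar> \<le> D * (t - r)" using rt by simp
  qed
qed

lemma bounded_traj_G_limit:
  assumes q: "\<And>T. traj T q" and g: "\<And>t. t \<ge> 0 \<Longrightarrow> G (q t) \<le> g"
  obtains L where "((\<lambda>t. G (q t)) \<longlongrightarrow> L) at_top" "\<And>t. t \<ge> 0 \<Longrightarrow> G (q t) \<le> L"
proof -
  define L where "L = (SUP t\<in>{0..}. G (q t))"
  have bdd: "bdd_above ((\<lambda>t. G (q t)) ` {0..})" using g by (auto intro!: bdd_aboveI2)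
  have le: "G (q t) \<le> L" if "t \<ge> 0" for t
    unfolding L_def by (rule cSUP_upper[OF _ bdd]) (use that in simp)
  have "((\<lambda>t. G (q t)) \<longlongrightarrow> L) at_top"
  proof (rule increasing_tendsto)
    show "\<forall>\<^sub>F t in at_top. G (q t) \<le> L" using eventually_ge_at_top[of 0] by eventually_elim (rule le)
    fix x assume "x < L"
    then obtain r where r: "r \<ge> 0" "x < G (q r)"
      unfolding L_def using less_cSUP_iff[OF _ bdd] by auto
    show "\<forall>\<^sub>F t in at_top. x < G (q t)"
      using eventually_ge_at_top[of r]
      by eventually_elim (use traj_G_mono[OF q r(1)] r(2) order_less_le_trans in blast)
  qed
  then show ?thesis using that le by blast
qed

text \<open>A bounded trajectory creeps towards a level of \<open>V\<close>; on a regular level \<open>V' v\<close> would decrease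
  at a uniform rate.\<close>

lemma bounded_traj_G_le:
  obtains C where "\<And>q g t. (\<And>T. traj T q) \<Longrightarrow> G (q 0) > 0 \<Longrightarrow>
     (\<And>t. t \<ge> 0 \<Longrightarrow> G (q t) \<le> g) \<Longrightarrow> t \<ge> 0 \<Longrightarrow> G (q t) \<le> C"
proof -
  obtain C where C: "\<And>L. L > C \<Longrightarrow>
    \<exists>N \<mu>. \<mu> > 0 \<and> (\<forall>x. \<bar>V x - L\<bar> \<le> 1 \<longrightarrow> \<bar>x\<bar> \<le> N \<and> \<bar>V' x\<bar> \<ge> \<mu>)"
    by (rule regular_levels) blast
  show ?thesis
  proof (rule that, rule ccontr)
    fix q g t
    assume q: "\<And>T. traj T q" and G0: "G (q 0) > 0" and g: "\<And>t. t \<ge> 0 \<Longrightarrow> G (q t) \<le> g"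
      and t: "t \<ge> 0" and "\<not> G (q t) \<le> C"
    obtain L where L: "((\<lambda>t. G (q t)) \<longlongrightarrow> L) at_top" "\<And>t. t \<ge> 0 \<Longrightarrow> G (q t) \<le> L"
      using bounded_traj_G_limit[OF q g] by blast
    have "L > C" using L(2)[OF t] \<open>\<not> _\<close> by simp
    then obtain N \<mu> where \<mu>: "\<mu> > 0" and
      N: "\<And>x. \<bar>V x - L\<bar> \<le> 1 \<Longrightarrow> \<bar>x\<bar> \<le> N" "\<And>x. \<bar>V x - L\<bar> \<le> 1 \<Longrightarrow> \<bar>V' x\<bar> \<ge> \<mu>"
      using C by blast
    define v where "v t = q t $ 2" for t
    define \<phi> where "\<phi> t = q t $ 1" for t
    define H where "H t = sqrt (G (q t))" for t
    have v0: "(v \<longlongrightarrow> 0) at_top"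
      unfolding v_def using bounded_traj_v_tendsto_0[OF q G0 g L(1)] .
    have "((\<lambda>t. G (q t) - (v t)\<^sup>2) \<longlongrightarrow> L - 0\<^sup>2) at_top" by (intro tendsto_intros L v0)
    moreover have "G (q t) - (v t)\<^sup>2 = V (\<phi> t)" for t by (simp add: G_def v_def \<phi>_def)
    ultimately have VL: "((\<lambda>t. V (\<phi> t)) \<longlongrightarrow> L) at_top" by simp
    have "bounded (V' ` {-N..N})" "bounded (V'' ` {-N..N})"
      by (intro compact_imp_bounded compact_continuous_image V'_cont continuous_on_subset[OF V''_cont];
          simp)+
    then obtain B1 B2 where B1: "\<forall>x\<in>{-N..N}. \<bar>V' x\<bar> \<le> B1" and B2: "\<forall>x\<in>{-N..N}. \<bar>V'' x\<bar> \<le> B2"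
      unfolding bounded_iff by auto
    \<comment> \<open>Half of the lower bound \<mu>^2 / (2 sqrt g) for V'^2 / (2 H).\<close>
    define \<nu> where "\<nu> = \<mu>\<^sup>2 / (4 * sqrt g)"
    have g0: "g > 0" using g[of 0] G0 by simp
    have \<nu>: "\<nu> > 0" using \<mu> g0 by (simp add: \<nu>_def)
    have "((\<lambda>t. B2 * (v t)\<^sup>2 / H 0 + k * B1 * \<bar>v t\<bar>) \<longlongrightarrow> B2 * 0\<^sup>2 / H 0 + k * B1 * \<bar>0\<bar>) at_top"
      using G0 by (intro tendsto_intros v0) (simp add: H_def)
    then have "\<forall>\<^sub>F t in at_top. B2 * (v t)\<^sup>2 / H 0 + k * B1 * \<bar>v t\<bar> < \<nu>"
      using \<nu> by (auto dest: order_tendstoD(2))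
    moreover have "\<forall>\<^sub>F t in at_top. dist (V (\<phi> t)) L < 1" using tendstoD[OF VL, of 1] by simp
    moreover have "\<forall>\<^sub>F t in at_top. dist (v t) 0 < 1" using tendstoD[OF v0, of 1] by simp
    ultimately have "\<forall>\<^sub>F t in at_top. B2 * (v t)\<^sup>2 / H 0 + k * B1 * \<bar>v t\<bar> < \<nu> \<and> \<bar>V (\<phi> t) - L\<bar> \<le> 1
        \<and> \<bar>v t\<bar> < 1 \<and> t \<ge> 0"
      using eventually_ge_at_top[of 0] by eventually_elim (auto simp: dist_real_def)
    then obtain t0 where t0: "\<And>t. t \<ge> t0 \<Longrightarrow> B2 * (v t)\<^sup>2 / H 0 + k * B1 * \<bar>v t\<bar> < \<nu>"
      "\<And>t. t \<ge> t0 \<Longrightarrow> \<bar>V (\<phi> t) - L\<bar> \<le> 1" "\<And>t. t \<ge> t0 \<Longrightarrow> \<bar>v t\<bar> < 1" "t0 \<ge> 0"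
      unfolding eventually_at_top_linorder by (metis order_refl)
    have \<phi>N: "\<phi> t \<in> {-N..N}" if "t \<ge> t0" for t using N(1)[OF t0(2)[OF that]] by auto
    \<comment> \<open>Along the trajectory P' = V'' v^2 / H + k V' v - V'^2 / (2 H). After
      \<open>t0\<close> the first two terms sum to less than \<nu> and the last is at least 2 \<nu>,
      hence P' \<le> -\<nu>.\<close>
    define P where "P t = V' (\<phi> t) * v t" for t
    have Pbound: "\<bar>P t\<bar> \<le> B1" if t: "t \<ge> t0" for t
    proof -
      have "\<bar>P t\<bar> \<le> B1 * 1"
        unfolding P_def abs_mult using B1 \<phi>N[OF t] t0(3)[OF t] by (intro mult_mono) auto
      then show ?thesis by simp
    qed
    \<comment> \<open>By then P would have dropped by 2 B1 + 1, more than |P| \<le> B1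
      permits.\<close>
    define T where "T = t0 + (2 * B1 + 1) / \<nu>"
    have B10: "B1 \<ge> 0" using Pbound[of t0] by linarith
    have T: "T \<ge> t0" using B10 \<nu> by (simp add: T_def)
    have "- P t0 - \<nu> * t0 \<le> - P T - \<nu> * T"
    proof (rule deriv_within_nonneg_imp_le[where a=t0 and b=T and g="\<lambda>t. - P t - \<nu> * t" and
         g'="\<lambda>t. - (V'' (\<phi> t) * (v t / H t) * v t + V' (\<phi> t) * (k * v t - V' (\<phi> t) / (2 * H t))) - \<nu>"])
      fix t assume t: "t \<in> {t0..T}"
      have sub: "{t0..T} \<subseteq> {0..T}" using t0 by auto
      have 1: "(\<phi> has_real_derivative v t / H t) (at t within {t0..T})"
        unfolding \<phi>_def v_def H_def
        by (rule DERIV_subset[OF traj_deriv(1)[OF q] sub]) (use t sub in auto)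
      have 2: "(v has_real_derivative k * v t - V' (\<phi> t) / (2 * H t)) (at t within {t0..T})"
        unfolding \<phi>_def v_def H_def
        by (rule DERIV_subset[OF traj_deriv(2)[OF q] sub]) (use t sub in auto)
      have "(P has_real_derivative V'' (\<phi> t) * (v t / H t) * v t
          + V' (\<phi> t) * (k * v t - V' (\<phi> t) / (2 * H t))) (at t within {t0..T})"
        unfolding P_def[abs_def]
        using DERIV_mult[OF DERIV_chain2[OF V'_deriv 1] 2] by (simp add: algebra_simps)
      then show "((\<lambda>t. - P t - \<nu> * t) has_real_derivative - (V'' (\<phi> t) * (v t / H t) * v t
          + V' (\<phi> t) * (k * v t - V' (\<phi> t) / (2 * H t))) - \<nu>) (at t within {t0..T})"
        by (auto intro!: derivative_eq_intros)
      have tt: "t \<ge> t0" "t \<ge> 0" using t t0 by auto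
      have H0: "H 0 > 0" "H 0 \<le> H t" "H t \<le> sqrt g"
        using G0 traj_G_mono[OF q, of 0 t t] tt g by (auto simp: H_def)
      have "V'' (\<phi> t) * (v t / H t) * v t = V'' (\<phi> t) * (v t)\<^sup>2 / H t" by (simp add: power2_eq_square)
      also have "\<dots> \<le> B2 * (v t)\<^sup>2 / H 0"
      proof (intro frac_le mult_right_mono)
        show "V'' (\<phi> t) \<le> B2" using B2 \<phi>N[OF tt(1)] by fastforce
        have "\<bar>V'' (\<phi> t)\<bar> \<le> B2" using B2 \<phi>N[OF tt(1)] by blast
        then show "0 \<le> B2 * (v t)\<^sup>2" by simp
      qed (use H0 in auto)
      finally have a: "V'' (\<phi> t) * (v t / H t) * v t \<le> B2 * (v t)\<^sup>2 / H 0" .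
      have "V' (\<phi> t) * v t \<le> \<bar>V' (\<phi> t)\<bar> * \<bar>v t\<bar>" by (metis abs_ge_self abs_mult)
      also have "\<dots> \<le> B1 * \<bar>v t\<bar>" using B1 \<phi>N[OF tt(1)] by (intro mult_right_mono) auto
      finally have b: "k * (V' (\<phi> t) * v t) \<le> k * B1 * \<bar>v t\<bar>" using k_pos by simp
      have "2 * \<nu> = \<mu>\<^sup>2 / (2 * sqrt g)" by (simp add: \<nu>_def)
      also have "\<dots> \<le> (V' (\<phi> t))\<^sup>2 / (2 * H t)"
      proof (intro frac_le)
        show "\<mu>\<^sup>2 \<le> (V' (\<phi> t))\<^sup>2" using N(2)[OF t0(2)[OF tt(1)]] \<mu> by (metis abs_le_square_iff abs_of_pos)
      qed (use H0 in auto)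
      finally have c: "2 * \<nu> \<le> (V' (\<phi> t))\<^sup>2 / (2 * H t)" .
      have "V' (\<phi> t) * (k * v t - V' (\<phi> t) / (2 * H t))
          = k * (V' (\<phi> t) * v t) - (V' (\<phi> t))\<^sup>2 / (2 * H t)"
        by (simp add: right_diff_distrib power2_eq_square)
      then show "0 \<le> - (V'' (\<phi> t) * (v t / H t) * v t
          + V' (\<phi> t) * (k * v t - V' (\<phi> t) / (2 * H t))) - \<nu>"
        using a b c t0(1)[OF tt(1)] by linarith
    qed (use T in auto)
    then have "\<nu> * (T - t0) \<le> P t0 - P T" by (simp add: algebra_simps)
    also have "\<nu> * (T - t0) = 2 * B1 + 1" using \<nu> by (simp add: T_def)
    finally show False using Pbound[of t0] Pbound[OF T] by linarith
  qed
qed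

section \<open>Divergence of the field and the area contradiction\<close>

text \<open>The Jacobian of \<open>X\<close>. Apart from the entry \<open>k\<close> it consists of
  the second partial derivatives of H = sqrt G arranged as for a Hamiltonian field, so the two mixed
  derivatives cancel in the trace.\<close>

definition DX :: "real^2 \<Rightarrow> real^2 \<Rightarrow> real^2" where
  "DX q x = (let H = sqrt (G q); v = q $ 2; d = V' (q $ 1) in vector
     [- (v * d / (2 * H ^ 3)) * x $ 1 + (1 / H - v\<^sup>2 / H ^ 3) * x $ 2,
      (d\<^sup>2 / (4 * H ^ 3) - V'' (q $ 1) / (2 * H)) * x $ 1 + (k + v * d / (2 * H ^ 3)) * x $ 2])"

lemma X_has_derivative:
  assumes "G q > 0"
  shows "(X has_derivative DX q) (at q)"
proof (rule has_derivative_vec2)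
  let ?H = "sqrt (G q)"
  have H: "?H > 0" "?H\<^sup>2 = G q" using assms by auto
  have c: "((\<lambda>q::real^2. q $ i) has_derivative (\<lambda>x. x $ i)) (at q)" for i
    by (rule bounded_linear.has_derivative[OF bounded_linear_vec_nth has_derivative_ident])
  have dV: "((\<lambda>q::real^2. V (q $ 1)) has_derivative (\<lambda>x. V' (q $ 1) * x $ 1)) (at q)"
    using has_derivative_compose[OF c V_deriv[unfolded has_field_derivative_def]]
    by (simp add: mult.commute)
  have dV': "((\<lambda>q::real^2. V' (q $ 1)) has_derivative (\<lambda>x. V'' (q $ 1) * x $ 1)) (at q)"
    using has_derivative_compose[OF c V'_deriv[unfolded has_field_derivative_def]]
    by (simp add: mult.commute)
  have dG: "(G has_derivative (\<lambda>x. 2 * q $ 2 * x $ 2 + V' (q $ 1) * x $ 1)) (at q)"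
    unfolding G_def[abs_def]
    by (rule has_derivative_eq_rhs[OF has_derivative_add[OF has_derivative_power[OF c] dV]]) auto
  have "((\<lambda>z. 1 / sqrt z) has_real_derivative - 1 / (2 * ?H ^ 3)) (at (G q))"
    using assms H by (auto intro!: derivative_eq_intros simp: field_simps power3_eq_cube power2_eq_square)
  then have dH: "((\<lambda>q. 1 / sqrt (G q)) has_derivative
      (\<lambda>x. - 1 / (2 * ?H ^ 3) * (2 * q $ 2 * x $ 2 + V' (q $ 1) * x $ 1))) (at q)"
    using has_derivative_compose[OF dG, of "\<lambda>z. 1 / sqrt z" "(*) (- 1 / (2 * ?H ^ 3))"]
    unfolding has_field_derivative_def by blast
  have "((\<lambda>q. q $ 2 * (1 / sqrt (G q))) has_derivative (\<lambda>x. DX q x $ 1)) (at q)"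
    by (rule has_derivative_eq_rhs[OF has_derivative_mult[OF c dH]])
      (auto simp: DX_def Let_def fun_eq_iff algebra_simps power2_eq_square add_divide_distrib diff_divide_distrib)
  then show "((\<lambda>q. X q $ 1) has_derivative (\<lambda>x. DX q x $ 1)) (at q)" by (simp add: X_def)
  have "((\<lambda>q. k * q $ 2 - V' (q $ 1) * (1 / sqrt (G q)) * (1 / 2)) has_derivative (\<lambda>x. DX q x $ 2)) (at q)"
    by (rule has_derivative_eq_rhs[OF has_derivative_diff[OF has_derivative_mult_right[OF c]
          has_derivative_mult_left[OF has_derivative_mult[OF dV' dH]]]])
      (auto simp: DX_def Let_def fun_eq_iff algebra_simps power2_eq_square add_divide_distrib diff_divide_distrib)
  then show "((\<lambda>q. X q $ 2) has_derivative (\<lambda>x. DX q x $ 2)) (at q)"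
    by (simp add: X_def mult.commute[of _ 2])
qed

lemma DX_trace: "DX q (axis 1 1) $ 1 + DX q (axis 2 1) $ 2 = k"
  by (simp add: DX_def Let_def axis_def)

lemma DX_det_bounded:
  assumes c: "c > 0"
  obtains D where "\<And>q. q \<in> region c R \<Longrightarrow> \<bar>det (matrix (DX q))\<bar> \<le> D"
proof -
  have "bounded (region c R)"
    unfolding bounded_iff
  proof (intro exI ballI)
    fix q assume "q \<in> region c R"
    then show "norm q \<le> 2 * R" using norm_le_l1_cart[of q] by (simp add: region_def sum_2)
  qed
  then have "compact (region c R)" using region_closed by (simp add: compact_eq_bounded_closed)
  moreover have "continuous_on (region c R) (\<lambda>q. det (matrix (DX q)))"
  proof -
    have ne: "sqrt (G q) \<noteq> 0" if "q \<in> region c R" for q using that c by (auto simp: region_def)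
    show ?thesis
      unfolding det_2 matrix_def DX_def Let_def
      using ne
      by (auto simp: axis_def intro!: continuous_intros G_cont continuous_on_compose2[OF V'_cont[of UNIV]]
        continuous_on_compose2[OF V''_cont])
  qed
  ultimately have "bounded ((\<lambda>q. det (matrix (DX q))) ` region c R)"
    by (intro compact_imp_bounded compact_continuous_image)
  then show ?thesis using that unfolding bounded_iff by auto
qed

text \<open>The bound G \<le> g confines v for all times but not \<phi>, which may run off at speed
  up to \<omega>. The box at time T thus has sides proportional to a + \<omega> T and to a constant,
  and the exponential growth of area overtakes it.\<close>

lemma no_bounded_ball:
  assumes c: "c > 0" and r: "r > 0"
    and bad: "\<And>p. p \<in> cball p0 r \<Longrightarrow> c \<le> G p \<and>
      (\<exists>q. q 0 = p \<and> (\<forall>T. traj T q) \<and> (\<forall>t\<ge>0. G (q t) \<le> g))"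
  shows False
proof -
  define \<omega> where "\<omega> = sqrt (1 + m / c)"
  have \<omega>: "\<omega> \<ge> 0" using c m_nonneg by (simp add: \<omega>_def)
  define a where "a = \<bar>p0 $ 1\<bar> + r + 1"
  define b where "b = sqrt (g + m) + 1"
  define \<beta> where "\<beta> = measure lebesgue (cball p0 r)"
  have \<beta>: "\<beta> > 0" using content_cball_pos[OF r, of p0] by (simp add: \<beta>_def measure_completion)
  have "c \<le> g" using bad[of p0] r by (smt (verit) centre_in_cball)
  then have pos: "a > 0" "b > 0" using r c m_nonneg by (auto simp: a_def b_def add_pos_nonneg)
  have main: "exp (k / 2 * T) * \<beta> \<le> 4 * b * (a + \<omega> * T)" if T: "T > 0" for T
  proof -
    define A where "A = a + \<omega> * T"
    have A: "A > 0" using pos \<omega> T by (auto simp: A_def intro: add_pos_nonneg)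
    define R where "R = max A b"
    \<comment> \<open>Trajectories stay in the closed set \<open>Y\<close>; the open set
      \<open>W\<close> adds a margin of 1 in each coordinate and of c/2 in G, so compactness of
      \<open>Y\<close> yields a uniform \<epsilon>. It may depend on T, because the resulting area
      bound does not contain it.\<close>
    define W where "W = {q. \<bar>q $ 1\<bar> < A} \<inter> {q. \<bar>q $ 2\<bar> < b} \<inter> {q. c / 2 < G q}"
    define Y where "Y = {q. \<bar>q $ 1\<bar> \<le> A - 1} \<inter> {q. \<bar>q $ 2\<bar> \<le> b - 1} \<inter> {q. c \<le> G q}"
    have W: "open W" unfolding W_def by (intro open_Int open_Collect_less continuous_intros G_cont)
    have Wr: "W \<subseteq> region (c / 2) R" by (auto simp: W_def region_def R_def)
    define Q where "Q = cbox (vector [- A, - b]) (vector [A, b] :: real^2)"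
    have WQ: "W \<subseteq> Q" by (auto simp: W_def Q_def mem_box_cart forall_2)
    have YW: "Y \<subseteq> W" using c by (auto simp: Y_def W_def)
    have "bounded Y" using YW WQ bounded_cbox bounded_subset unfolding Q_def by blast
    moreover have "closed Y"
      unfolding Y_def by (intro closed_Int closed_Collect_le continuous_intros G_cont)
    ultimately have "compact Y" by (simp add: compact_eq_bounded_closed)
    then obtain \<epsilon> where \<epsilon>: "\<epsilon> > 0" "(\<Union>y\<in>Y. cball y \<epsilon>) \<subseteq> W"
      using compact_subset_open_imp_cball_epsilon_subset[OF _ W YW] by blast
    obtain F L B where F: "L-lipschitz_on UNIV F" "\<And>q. norm (F q) \<le> B"
      "\<And>q. q \<in> region (c / 2) R \<Longrightarrow> F q = X q"
      using truncation[of "c / 2" R] c by (metis half_gt_zero)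
    obtain D where D: "\<And>q. q \<in> region (c / 2) R \<Longrightarrow> \<bar>det (matrix (DX q))\<bar> \<le> D"
      using DX_det_bounded[of "c / 2" R] c by (metis half_gt_zero)
    have "exp (k / 2 * T) * measure lebesgue (cball p0 r) \<le> measure lebesgue Q"
    proof (rule area_growth[OF F(1,2) k_pos T \<epsilon>(1) compact_cball _ _ _ DX_trace _ WQ])
      show "bounded W" using WQ bounded_cbox bounded_subset unfolding Q_def by blast
      show "Q \<in> lmeasurable" by (simp add: Q_def)
      show "\<bar>det (matrix (DX q))\<bar> \<le> D" if "q \<in> W" for q using D Wr that by blast
      show "(F has_derivative DX q) (at q)" if q: "q \<in> W" for q
      proof (rule has_derivative_transform_within_open[OF X_has_derivative W q])
        show "G q > 0" using q c by (auto simp: W_def)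
        show "X y = F y" if "y \<in> W" for y using F(3) Wr that by (metis subsetD)
      qed
      fix p assume p: "p \<in> cball p0 r"
      obtain q where q: "q 0 = p" "\<And>T. traj T q" "\<And>t. t \<ge> 0 \<Longrightarrow> G (q t) \<le> g" and cp: "c \<le> G p"
        using bad[OF p] by blast
      have "\<bar>p $ 1 - p0 $ 1\<bar> \<le> r"
        using p dist_vec_nth_le[of p0 1 p] by (simp add: dist_real_def abs_minus_commute)
      then have p1: "\<bar>p $ 1\<bar> \<le> a - 1" by (simp add: a_def)
      have inY: "q t \<in> Y" if t: "t \<in> {0..T}" for t
      proof -
        have "\<bar>q t $ 1 - p $ 1\<bar> \<le> \<omega> * t"
          using traj_phi_bound[OF q(2) c _ t] cp q(1) by (simp add: \<omega>_def)
        moreover have "\<omega> * t \<le> \<omega> * T" using t \<omega> by (intro mult_left_mono) auto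
        ultimately have "\<bar>q t $ 1\<bar> \<le> A - 1" using p1 by (simp add: A_def)
        moreover have "\<bar>q t $ 2\<bar> \<le> b - 1"
          using v_sq_le[of "q t"] q(3)[of t] t by (auto simp: b_def intro!: real_le_rsqrt)
        moreover have "c \<le> G (q t)" using traj_G_mono[OF q(2)[of t], of 0 t] t cp q(1) by simp
        ultimately show ?thesis by (simp add: Y_def)
      qed
      show "\<exists>y. y 0 = p \<and> (\<forall>t\<in>{0..T}. (y has_vector_derivative F (y t)) (at t within {0..T})
          \<and> cball (y t) \<epsilon> \<subseteq> W)"
      proof (intro exI[of _ q] conjI ballI q(1))
        fix t assume t: "t \<in> {0..T}"
        have "q t \<in> region (c / 2) R" using inY[OF t] YW Wr by blast
        then have "F (q t) = X (q t)" by (rule F(3))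
        then show "(q has_vector_derivative F (q t)) (at t within {0..T})"
          using q(2)[of T] t by (simp add: traj_def)
        show "cball (q t) \<epsilon> \<subseteq> W" using \<epsilon>(2) inY[OF t] by blast
      qed
    qed
    also have "measure lebesgue Q = 4 * b * A"
    proof -
      have "vector [- A, - b] \<in> Q" using A pos by (simp add: Q_def mem_box_cart forall_2)
      then have "cbox (vector [- A, - b]) (vector [A, b] :: real^2) \<noteq> {}" by (auto simp: Q_def)
      then have "measure lborel Q = (\<Prod>i\<in>UNIV. (vector [A, b] :: real^2) $ i - vector [- A, - b] $ i)"
        unfolding Q_def by (rule content_cbox_cart)
      moreover have "measure lebesgue Q = measure lborel Q" by (simp add: Q_def measure_completion)
      ultimately show ?thesis by (simp add: UNIV_2)
    qed
    finally show ?thesis by (simp add: \<beta>_def A_def)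
  qed
  \<comment> \<open>For x \<ge> 1 the bound at time T = 2 x / k gives exp x * \<beta> \<le> E x.
    With exp x \<ge> x^2 / 2 this means x \<beta> \<le> 2 E, whereas the x chosen below satisfies x
    \<beta> = \<beta> + 2 E.\<close>
  define E where "E = 4 * b * (a + 2 * \<omega> / k)"
  have E: "E > 0" using pos \<omega> k_pos by (auto simp: E_def intro!: mult_pos_pos add_pos_nonneg)
  define x where "x = 1 + 2 * E / \<beta>"
  have x: "x \<ge> 1" using E \<beta> by (simp add: x_def)
  have "x\<^sup>2 / 2 * \<beta> \<le> exp x * \<beta>"
    using exp_lower_Taylor_quadratic[of x] x \<beta> by (intro mult_right_mono) auto
  also have "\<dots> \<le> 4 * b * (a + \<omega> * (2 * x / k))" using main[of "2 * x / k"] x k_pos by simp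
  also have "\<dots> \<le> 4 * b * (a * x + \<omega> * (2 * x / k))"
    using x pos mult_left_mono[of 1 x a] by simp
  also have "\<dots> = E * x" by (simp add: E_def algebra_simps)
  finally have "x * (x * \<beta>) \<le> x * (2 * E)" by (simp add: power2_eq_square algebra_simps)
  then have "x * \<beta> \<le> 2 * E" using x by simp
  then show False using \<beta> mult_pos_pos[OF \<beta> \<beta>] by (simp add: x_def field_simps)
qed

end

subsection \<open>Change of coordinates\<close>

lemma C2D:
  assumes "C2 g"
  shows "(g has_real_derivative deriv g x) (at x)"
    and "\<exists>D. (\<forall>x. (deriv g has_real_derivative D x) (at x)) \<and> continuous_on UNIV D"
  using assms unfolding C2_def C1_differentiable_on_def has_real_derivative_iff_has_vector_derivative[symmetric]
  by (auto simp: differentiable_on_def DERIV_deriv_iff_real_differentiable)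

lemma compactificationD:
  assumes "compactification f"
  shows "\<bar>f z\<bar> < 1" and "inv f (f z) = z" and "\<bar>s\<bar> < 1 \<Longrightarrow> f (inv f s) = s"
    and "strict_mono f" and "(f has_real_derivative deriv f z) (at z)" and "deriv f z > 0"
    and "\<bar>s\<bar> < 1 \<Longrightarrow> (inv f has_real_derivative 1 / deriv f (inv f s)) (at s)"
proof -
  have bij: "bij_betw f UNIV {-1<..<1}" and sm: "strict_mono f" and C2: "C2 f"
    and pos: "\<And>z. deriv f z > 0"
    using assms by (auto simp: compactification_def)
  show 1: "\<bar>f z\<bar> < 1" for z
    using bij by (metis abs_less_iff bij_betwE greaterThanLessThan_iff iso_tuple_UNIV_I minus_less_iff)
  show 2: "inv f (f z) = z" for z using sm by (simp add: strict_mono_imp_inj_on)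
  show 3: "f (inv f s) = s" if "\<bar>s\<bar> < 1" for s
    using bij that by (intro f_inv_into_f) (auto simp: bij_betw_def)
  show "strict_mono f" by fact
  show 4: "(f has_real_derivative deriv f z) (at z)" for z using C2D(1)[OF C2] .
  show "deriv f z > 0" by fact
  assume s: "\<bar>s\<bar> < 1"
  have "isCont (inv f) (f (inv f s))"
    by (rule isCont_inverse_function[of 1]) (use 2 4 in \<open>auto intro: DERIV_isCont\<close>)
  then have "isCont (inv f) s" using 3[OF s] by simp
  then have "(inv f has_real_derivative inverse (deriv f (inv f s))) (at s)"
    using s pos[of "inv f s"] 3
    by (intro DERIV_inverse_function[OF 4, of _ _ "-1" 1]) auto
  then show "(inv f has_real_derivative 1 / deriv f (inv f s)) (at s)" by (simp add: inverse_eq_divide)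
qed

text \<open>Translates a finite limit of u at s = -1 or s = 1 into a bound for V' / (sqrt 6 V) on a
  half line in \<phi>; monotonicity of \<open>f\<close> carries neighbourhoods of s0 to half
  lines.\<close>

lemma compactification_limit_bound:
  assumes f: "compactification f" and l: "(u_raw f V \<longlongrightarrow> l) (at s0 within {-1<..<1})"
    and s0: "s0 = -1 \<or> s0 = 1"
  obtains z where
    "\<And>y. (if s0 = 1 then z \<le> y else y \<le> z) \<Longrightarrow>
      \<bar>deriv V y / (sqrt 6 * V y)\<bar> \<le> \<bar>l\<bar> + 1"
proof -
  have "\<forall>\<^sub>F s in at s0 within {-1<..<1}. dist (u_raw f V s) l < 1" using tendstoD[OF l, of 1] by simp
  then obtain d where d: "d > 0"
    "\<And>s. s \<in> {-1<..<1} \<Longrightarrow> s \<noteq> s0 \<Longrightarrow> dist s s0 < d \<Longrightarrow> dist (u_raw f V s) l < 1"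
    unfolding eventually_at by blast
  \<comment> \<open>A point of (-1, 1) within distance d of \<open>s0\<close>; everything between it
    and \<open>s0\<close> is then also within d.\<close>
  define \<sigma> where "\<sigma> = s0 * (1 - min d 1 / 2)"
  have \<sigma>: "\<bar>\<sigma>\<bar> < 1" using d s0 by (auto simp: \<sigma>_def min_def)
  show ?thesis
  proof (rule that[of "inv f \<sigma>"])
    fix y assume y: "if s0 = 1 then inv f \<sigma> \<le> y else y \<le> inv f \<sigma>"
    then have "if s0 = 1 then f (inv f \<sigma>) \<le> f y else f y \<le> f (inv f \<sigma>)"
      using strict_mono_leD[OF compactificationD(4)[OF f]] by (simp split: if_splits)
    then have "if s0 = 1 then \<sigma> \<le> f y else f y \<le> \<sigma>" unfolding compactificationD(3)[OF f \<sigma>] .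
    then have "dist (f y) s0 < d"
      using s0 d compactificationD(1)[OF f, of y] by (auto simp: \<sigma>_def dist_real_def min_def split: if_splits)
    moreover have "f y \<in> {-1<..<1}" using compactificationD(1)[OF f, of y] by auto
    ultimately have "dist (u_raw f V (f y)) l < 1" using s0 by (intro d(2)) auto
    then show "\<bar>deriv V y / (sqrt 6 * V y)\<bar> \<le> \<bar>l\<bar> + 1"
      by (simp add: u_raw_def compactificationD(2)[OF f] dist_real_def)
  qed
qed

text \<open>On a compact interval all bounds hold by continuity. Outside it V > 0 gives the lower
  bound, and boundedness of u gives |V'| \<le> const * V.\<close>

lemma assumption_V_potential:
  assumes f: "compactification f" and V: "assumption_V f V"
  obtains V'' m M R0 where "potential V (deriv V) V'' (sqrt (3/2)) m M R0"
proof -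
  have C2: "C2 V" using V by (simp add: assumption_V_def)
  obtain V'' where V'': "\<And>x. (deriv V has_real_derivative V'' x) (at x)" "continuous_on UNIV V''"
    using C2D(2)[OF C2] by blast
  have V': "(V has_real_derivative deriv V x) (at x)" for x by (rule C2D(1)[OF C2])
  have cV: "continuous_on S V" and cV': "continuous_on S (deriv V)" for S
    using V' V'' by (meson DERIV_isCont continuous_at_imp_continuous_on)+
  have ev: "\<forall>\<^sub>F x in at_infinity. V x > 0" "\<forall>\<^sub>F x in at_bot. deriv V x < 0"
    "\<forall>\<^sub>F x in at_top. deriv V x > 0"
    using V by (auto simp: assumption_V_def)
  obtain b where b: "\<And>x. \<bar>x\<bar> \<ge> b \<Longrightarrow> V x > 0" using ev(1) by (auto simp: eventually_at_infinity)
  obtain b1 where b1: "\<And>x. x \<le> b1 \<Longrightarrow> deriv V x < 0"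
    using ev(2) by (auto simp: eventually_at_bot_linorder)
  obtain b2 where b2: "\<And>x. x \<ge> b2 \<Longrightarrow> deriv V x > 0"
    using ev(3) by (auto simp: eventually_at_top_linorder)
  obtain l1 l2 where l: "(u_raw f V \<longlongrightarrow> l1) (at (-1) within {-1<..<1})"
    "(u_raw f V \<longlongrightarrow> l2) (at 1 within {-1<..<1})"
    using V by (auto simp: assumption_V_def)
  obtain z1 where z1: "\<And>y. y \<le> z1 \<Longrightarrow> \<bar>deriv V y / (sqrt 6 * V y)\<bar> \<le> \<bar>l1\<bar> + 1"
    using compactification_limit_bound[OF f l(1)] by simp blast
  obtain z2 where z2: "\<And>y. y \<ge> z2 \<Longrightarrow> \<bar>deriv V y / (sqrt 6 * V y)\<bar> \<le> \<bar>l2\<bar> + 1"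
    using compactification_limit_bound[OF f l(2)] by simp blast
  define R where "R = 1 + \<bar>b\<bar> + \<bar>b1\<bar> + \<bar>b2\<bar> + \<bar>z1\<bar> + \<bar>z2\<bar>"
  have R: "R \<ge> 1" "R \<ge> b" "R \<ge> \<bar>b1\<bar>" "R \<ge> \<bar>b2\<bar>" "R \<ge> \<bar>z1\<bar>" "R \<ge> \<bar>z2\<bar>" by (auto simp: R_def)
  have "bounded (V ` {-R..R})" "bounded (deriv V ` {-R..R})"
    by (intro compact_imp_bounded compact_continuous_image cV cV'; simp)+
  then obtain B B' where B: "\<forall>x\<in>{-R..R}. \<bar>V x\<bar> \<le> B" and B': "\<forall>x\<in>{-R..R}. \<bar>deriv V x\<bar> \<le> B'"
    unfolding bounded_iff by auto
  \<comment> \<open>The first entry serves inside [-R, R]; the second undoes the factor sqrt 6 in u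
    and serves outside.\<close>
  define M where "M = max \<bar>B'\<bar> (sqrt 6 * (max \<bar>l1\<bar> \<bar>l2\<bar> + 1))"
  have "potential V (deriv V) V'' (sqrt (3/2)) (\<bar>B\<bar>) M R"
  proof
    show "- \<bar>B\<bar> \<le> V x" for x
    proof (cases "\<bar>x\<bar> \<le> R")
      case True
      then have "x \<in> {-R..R}" by auto
      then have "\<bar>V x\<bar> \<le> B" using B by blast
      then show ?thesis by linarith
    next
      case False
      then show ?thesis using b[of x] R by auto
    qed
    show "\<bar>deriv V x\<bar> \<le> M * (1 + \<bar>V x\<bar>)" for x
    proof (cases "\<bar>x\<bar> \<le> R")
      case True
      then have "\<bar>deriv V x\<bar> \<le> M * 1" using B'[rule_format, of x] by (auto simp: M_def abs_le_iff)
      also have "\<dots> \<le> M * (1 + \<bar>V x\<bar>)" by (intro mult_left_mono) (auto simp: M_def)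
      finally show ?thesis .
    next
      case False
      then have "\<bar>deriv V x / (sqrt 6 * V x)\<bar> \<le> max \<bar>l1\<bar> \<bar>l2\<bar> + 1"
      proof -
        consider "x \<le> z1" | "x \<ge> z2" using False R by linarith
        then show ?thesis
        proof cases
          case 1
          from z1[OF this] show ?thesis by linarith
        next
          case 2
          from z2[OF this] show ?thesis by linarith
        qed
      qed
      moreover have "V x > 0" using b[of x] R False by auto
      ultimately have "\<bar>deriv V x\<bar> \<le> sqrt 6 * (max \<bar>l1\<bar> \<bar>l2\<bar> + 1) * V x"
        by (simp add: field_simps abs_divide abs_mult)
      also have "\<dots> \<le> M * (1 + \<bar>V x\<bar>)"
        using \<open>V x > 0\<close> by (intro mult_mono) (auto simp: M_def)
      finally show ?thesis .
    qed
    show "deriv V x > 0" if "x \<ge> R" for x using b2[of x] R that by auto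
    show "deriv V x < 0" if "x \<le> - R" for x using b1[of x] R that by auto
  qed (use V' V'' R in auto)
  then show ?thesis by (rule that)
qed

locale collapse = potential V "deriv V" V'' "sqrt (3/2)" m M R0
  for V V'' m M R0 +
  fixes f \<psi> :: "real \<Rightarrow> real" and \<delta> :: real
  assumes f: "compactification f" and cutoff: "cutoff f V \<delta> \<psi>"
    and field_cont: "continuous_on ({-1..1} \<times> UNIV) (flat_field f V \<psi>)"
begin

abbreviation "\<kappa> \<equiv> sqrt (3/2)"

lemmas f_less_1 = compactificationD(1)[OF f] and inv_f_f = compactificationD(2)[OF f]
  and f_inv_f = compactificationD(3)[OF f] and f_strict_mono = compactificationD(4)[OF f]
  and f_deriv = compactificationD(5)[OF f] and f_deriv_pos = compactificationD(6)[OF f]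
  and inv_f_deriv = compactificationD(7)[OF f]

text \<open>With \<open>\<Lambda>\<close> below, a pair of mutually inverse continuous maps between
  the half-plane-like set G \<ge> 1/\<open>xbar\<close>^2 of the (\<phi>, v)-plane and
  \<open>Omega\<close>. The edge x = \<open>xbar\<close> corresponds to equality.\<close>

definition \<Theta> :: "real^2 \<Rightarrow> real \<times> real \<times> real" where
  "\<Theta> q = (f (q $ 1), 1 / sqrt (G q), q $ 2 / sqrt (G q))"

definition \<Lambda> :: "real \<times> real \<times> real \<Rightarrow> real^2" where
  "\<Lambda> p = (case p of (s, x, w) \<Rightarrow> vector [inv f s, w / x])"

lemma G_\<Lambda>:
  assumes "x > 0" "V (inv f s) * x\<^sup>2 + w\<^sup>2 = 1"
  shows "G (\<Lambda> (s, x, w)) = 1 / x\<^sup>2" and "sqrt (G (\<Lambda> (s, x, w))) = 1 / x"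
proof -
  have "V (inv f s) * x\<^sup>2 = 1 - w\<^sup>2" using assms by simp
  then have "V (inv f s) = (1 - w\<^sup>2) / x\<^sup>2" using assms(1) by (simp add: field_simps)
  then show "G (\<Lambda> (s, x, w)) = 1 / x\<^sup>2"
    by (simp add: G_def \<Lambda>_def power_divide flip: add_divide_distrib)
  then show "sqrt (G (\<Lambda> (s, x, w))) = 1 / x" using assms(1) by (simp add: real_sqrt_divide)
qed

lemma G_\<Lambda>_ge:
  assumes "p \<in> Omega f V xbar"
  shows "G (\<Lambda> p) \<ge> 1 / xbar\<^sup>2" "G (\<Lambda> p) > 0"
proof -
  obtain s x w where p: "p = (s, x, w)" by (cases p) auto
  have x: "0 < x" "x \<le> xbar" "V (inv f s) * x\<^sup>2 + w\<^sup>2 = 1" using assms by (auto simp: Omega_def p)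
  show "G (\<Lambda> p) > 0" using G_\<Lambda>(1)[OF x(1,3)] x by (simp add: p)
  have "1 / xbar\<^sup>2 \<le> 1 / x\<^sup>2" using x by (intro divide_left_mono power_mono) auto
  then show "G (\<Lambda> p) \<ge> 1 / xbar\<^sup>2" using G_\<Lambda>(1)[OF x(1,3)] by (simp add: p)
qed

lemma \<Theta>_\<Lambda>:
  assumes "p \<in> Omega f V xbar"
  shows "\<Theta> (\<Lambda> p) = p"
proof -
  obtain s x w where p: "p = (s, x, w)" by (cases p) auto
  have x: "0 < x" "V (inv f s) * x\<^sup>2 + w\<^sup>2 = 1" "\<bar>s\<bar> < 1" using assms by (auto simp: Omega_def p)
  show ?thesis
    using G_\<Lambda>(2)[OF x(1,2)] x f_inv_f[OF x(3)] unfolding p \<Theta>_def by (simp add: \<Lambda>_def)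
qed

lemma \<Lambda>_\<Theta>: "G q > 0 \<Longrightarrow> \<Lambda> (\<Theta> q) = q"
  by (simp add: \<Lambda>_def \<Theta>_def inv_f_f vec_eq_iff forall_2)

lemma \<Theta>_constraint:
  assumes "G q > 0"
  shows "V (q $ 1) * (1 / sqrt (G q))\<^sup>2 + (q $ 2 / sqrt (G q))\<^sup>2 = 1"
proof -
  have "V (q $ 1) * (1 / sqrt (G q))\<^sup>2 + (q $ 2 / sqrt (G q))\<^sup>2 = (V (q $ 1) + (q $ 2)\<^sup>2) / G q"
    using assms by (simp add: power_divide add_divide_distrib)
  then show ?thesis using assms by (simp add: G_def add.commute)
qed

lemma \<Theta>_in_Omega:
  assumes "xbar > 0" "G q \<ge> 1 / xbar\<^sup>2"
  shows "\<Theta> q \<in> Omega f V xbar"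
proof -
  have G0: "G q > 0" using assms by (smt (verit) zero_less_divide_1_iff zero_less_power)
  have "1 / xbar = sqrt (1 / xbar\<^sup>2)" using assms by (simp add: real_sqrt_divide)
  also have "\<dots> \<le> sqrt (G q)" using assms by simp
  finally have "1 / sqrt (G q) \<le> xbar" using assms G0 by (simp add: field_simps)
  then show ?thesis
    using G0 \<Theta>_constraint[OF G0] f_less_1[of "q $ 1"] by (auto simp: \<Theta>_def Omega_def inv_f_f)
qed

lemma f_cont: "continuous_on S f"
  using f_deriv by (meson DERIV_isCont continuous_at_imp_continuous_on)

lemma inv_f_cont: "continuous_on {-1<..<1} (inv f)"
  by (intro continuous_at_imp_continuous_on ballI DERIV_isCont[OF inv_f_deriv]) auto

lemma \<Theta>_cont: "continuous_on {q. G q > 0} \<Theta>"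
  unfolding \<Theta>_def
  by (intro continuous_intros G_cont continuous_on_compose2[OF f_cont[of UNIV]]) auto

lemma \<Lambda>_cont: "continuous_on (Omega f V xbar) \<Lambda>"
proof -
  have eq: "\<Lambda> = (\<lambda>p. inv f (fst p) *\<^sub>R axis 1 1 + (snd (snd p) / fst (snd p)) *\<^sub>R axis 2 1)"
    by (simp add: fun_eq_iff \<Lambda>_def vec_eq_iff forall_2 axis_def)
  show ?thesis
    unfolding eq
    by (intro continuous_intros continuous_on_compose2[OF inv_f_cont]) (auto simp: Omega_def)
qed

section \<open>The cutoff and the constraint defect\<close>

lemma cutoff_cases:
  assumes "\<bar>s\<bar> < 1"
  obtains "\<psi> s = 1" | "V (inv f s) > 0"
proof -
  have "s \<in> {-1..1}" using assms by auto
  moreover have "V (inv f s) > 0" if "\<not> \<bar>s\<bar> \<le> 1 - \<delta>"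
  proof -
    have "s \<in> {-1<..<-1+\<delta>} \<union> {1-\<delta><..<1}" using that assms by auto
    then show ?thesis using cutoff by (auto simp: cutoff_def)
  qed
  moreover have "\<psi> s = 1" if "\<bar>s\<bar> \<le> 1 - \<delta>" "s \<in> {-1..1}"
    using cutoff that by (simp add: cutoff_def)
  ultimately show ?thesis using that by blast
qed

text \<open>This is V' = 2 \<kappa> u V, with 2 \<kappa> = sqrt 6, multiplied by 1 - \<psi>. Where V
  may vanish, \<psi> = 1 and both sides are 0.\<close>

lemma cutoff_u_ext:
  assumes "\<bar>s\<bar> < 1"
  shows "(1 - \<psi> s) * deriv V (inv f s) = 2 * \<kappa> * ((1 - \<psi> s) * u_ext f V s) * V (inv f s)"
proof -
  have k6: "sqrt 6 = 2 * \<kappa>"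
    using real_sqrt_mult[of 4 "3/2"] by simp
  show ?thesis
    by (rule cutoff_cases[OF assms]) (use assms in \<open>auto simp: u_ext_def u_raw_def k6\<close>)
qed

text \<open>At x = w = 0 the third component of the field is -\<kappa> (1 - \<psi>) u, continuous on
  the compact interval [-1, 1]. The bound is needed as a coefficient bound in the linear equation
  for the constraint defect.\<close>

lemma cutoff_u_ext_bounded:
  obtains U where "\<And>s. s \<in> {-1..1} \<Longrightarrow> \<bar>(1 - \<psi> s) * u_ext f V s\<bar> \<le> U"
proof -
  have "continuous_on {-1..1} (\<lambda>s. snd (snd (flat_field f V \<psi> (s, 0, 0))))"
    by (intro continuous_intros continuous_on_compose2[OF field_cont]) auto
  then have "bounded ((\<lambda>s. snd (snd (flat_field f V \<psi> (s, 0, 0)))) ` {-1..1})"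
    by (intro compact_imp_bounded compact_continuous_image) auto
  then obtain B where B: "\<forall>s\<in>{-1..1}. \<bar>snd (snd (flat_field f V \<psi> (s, 0, 0)))\<bar> \<le> B"
    unfolding bounded_iff by auto
  have "\<bar>(1 - \<psi> s) * u_ext f V s\<bar> \<le> B / \<kappa>" if "s \<in> {-1..1}" for s
  proof -
    have eq: "snd (snd (flat_field f V \<psi> (s, 0, 0))) = - (\<kappa> * ((1 - \<psi> s) * u_ext f V s))"
      by (simp add: flat_field_def theta1_def theta2_def)
    have "\<bar>snd (snd (flat_field f V \<psi> (s, 0, 0)))\<bar> \<le> B" using B that by blast
    then have "\<kappa> * \<bar>(1 - \<psi> s) * u_ext f V s\<bar> \<le> B"
      unfolding eq by (simp add: abs_mult)
    then show ?thesis using k_pos by (simp add: field_simps)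
  qed
  then show ?thesis by (rule that)
qed

text \<open>Clearing denominators by \<open>cutoff_u_ext\<close> isolates the dependence on \<psi>
  in a multiple of the constraint defect V x^2 + w^2 - 1. On the constraint surface the cutoff thus
  disappears.\<close>

lemma flat_field_w:
  assumes "\<bar>s\<bar> < 1"
  shows "snd (snd (flat_field f V \<psi> (s, x, w))) = \<kappa> * w * (1 - w\<^sup>2) - deriv V (inv f s) * x\<^sup>2 / 2
    + \<kappa> * ((1 - \<psi> s) * u_ext f V s) * (V (inv f s) * x\<^sup>2 + w\<^sup>2 - 1)"
proof -
  have "snd (snd (flat_field f V \<psi> (s, x, w))) = \<kappa> * w * (1 - w\<^sup>2)
      - \<kappa> * ((1 - \<psi> s) * u_ext f V s) * (1 - w\<^sup>2) - deriv V (inv f s) * x\<^sup>2 / 2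
      + ((1 - \<psi> s) * deriv V (inv f s)) * x\<^sup>2 / 2"
    by (simp add: flat_field_def theta1_def theta2_def field_simps)
  then show ?thesis unfolding cutoff_u_ext[OF assms] by (simp add: field_simps)
qed


section \<open>Trajectories of the planar field and solutions of the system\<close>

lemma traj_imp_solution:
  assumes q: "\<And>T. traj T q" and G0: "G (q 0) > 0"
  shows "collapsing_scalar_field f V \<psi> {0..} (\<lambda>t. \<Theta> (q t))"
  unfolding collapsing_scalar_field_def
proof (intro conjI ballI)
  have "V (q 0 $ 1) * (1 / sqrt (G (q 0)))\<^sup>2 + (q 0 $ 2 / sqrt (G (q 0)))\<^sup>2 = 1"
    by (rule \<Theta>_constraint[OF G0])
  then show "case \<Theta> (q 0) of (s, x, w) \<Rightarrow> \<bar>s\<bar> < 1 \<and> x > 0 \<and> V (inv f s) * x\<^sup>2 + w\<^sup>2 = 1"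
    using G0 f_less_1 by (simp add: \<Theta>_def inv_f_f)
  fix t :: real assume t: "t \<in> {0..}"
  show "fst (\<Theta> (q t)) \<in> {-1..1}" using f_less_1[of "q t $ 1"] by (auto simp: \<Theta>_def)
  let ?F = "at t within {0..}" and ?v = "q t $ 2" and ?H = "sqrt (G (q t))" and ?d = "deriv V (q t $ 1)"
  let ?x = "1 / ?H" and ?w = "?v / ?H"
  have nhd: "at t within {0..t+1} = ?F" by (rule at_within_nhd[of t "{..<t+1}"]) auto
  have d1: "((\<lambda>t. q t $ 1) has_real_derivative ?w) ?F"
    and d2: "((\<lambda>t. q t $ 2) has_real_derivative \<kappa> * ?v - ?d / (2 * ?H)) ?F"
    and dG: "((\<lambda>t. G (q t)) has_real_derivative 2 * \<kappa> * ?v\<^sup>2) ?F"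
    using traj_deriv[OF q, of t "t+1"] t nhd by auto
  have Gt: "G (q t) > 0" using traj_G_mono[OF q, of 0 t t] G0 t by simp
  then have H: "?H > 0" "?H\<^sup>2 = G (q t)" by auto
  have "((\<lambda>t. f (q t $ 1)) has_real_derivative deriv f (q t $ 1) * ?w) ?F"
    by (rule DERIV_chain2[OF f_deriv d1])
  then have ds: "((\<lambda>t. f (q t $ 1)) has_real_derivative f_speed f (f (q t $ 1)) * ?w) ?F"
    by (simp add: f_speed_def f_less_1 inv_f_f)
  have "((\<lambda>z. 1 / sqrt z) has_real_derivative - 1 / (2 * ?H ^ 3)) (at (G (q t)))"
    using Gt H by (auto intro!: derivative_eq_intros simp: field_simps power3_eq_cube power2_eq_square)
  from DERIV_chain2[OF this dG]
  have dx: "((\<lambda>t. 1 / sqrt (G (q t))) has_real_derivative - \<kappa> * ?x * ?w\<^sup>2) ?F"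
    by (rule DERIV_cong) (use H in \<open>simp add: field_simps power3_eq_cube power2_eq_square\<close>)
  have dw: "((\<lambda>t. q t $ 2 * (1 / sqrt (G (q t)))) has_real_derivative
      (\<kappa> * ?v - ?d / (2 * ?H)) * ?x + (- \<kappa> * ?x * ?w\<^sup>2) * ?v) ?F"
    using DERIV_mult[OF d2 dx] by (simp add: add.commute)
  have "(\<kappa> * ?v - ?d / (2 * ?H)) * ?x + (- \<kappa> * ?x * ?w\<^sup>2) * ?v = \<kappa> * ?w * (1 - ?w\<^sup>2) - ?d * ?x\<^sup>2 / 2"
  proof -
    have "(k * v - d / (2 * h)) * (1 / h) + (- k * (1 / h) * (v / h)\<^sup>2) * v
        = k * (v / h) * (1 - (v / h)\<^sup>2) - d * (1 / h)\<^sup>2 / 2" if "h > 0" for k v d h :: real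
      using that by (simp add: field_simps power2_eq_square)
    then show ?thesis using H(1) .
  qed
  also have "\<dots> = snd (snd (flat_field f V \<psi> (\<Theta> (q t))))"
    unfolding \<Theta>_def flat_field_w[OF f_less_1] inv_f_f \<Theta>_constraint[OF Gt] by simp
  finally have dw: "((\<lambda>t. q t $ 2 / sqrt (G (q t))) has_real_derivative
      snd (snd (flat_field f V \<psi> (\<Theta> (q t))))) ?F"
    using dw by simp
  have "((\<lambda>t. \<Theta> (q t)) has_vector_derivative
      (f_speed f (f (q t $ 1)) * ?w, - \<kappa> * ?x * ?w\<^sup>2, snd (snd (flat_field f V \<psi> (\<Theta> (q t)))))) ?F"
    using ds dx dw unfolding \<Theta>_def has_real_derivative_iff_has_vector_derivative
    by (intro has_vector_derivative_Pair)
  also have "(f_speed f (f (q t $ 1)) * ?w, - \<kappa> * ?x * ?w\<^sup>2, snd (snd (flat_field f V \<psi> (\<Theta> (q t)))))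
      = flat_field f V \<psi> (\<Theta> (q t))"
    by (simp add: flat_field_def \<Theta>_def)
  finally show "((\<lambda>t. \<Theta> (q t)) has_vector_derivative flat_field f V \<psi> (\<Theta> (q t))) ?F" .
qed (auto simp: is_interval_ci)

lemma flat_field_derivs:
  assumes "(y has_vector_derivative flat_field f V \<psi> (y t)) F"
  defines "s \<equiv> \<lambda>t. fst (y t)" and "x \<equiv> \<lambda>t. fst (snd (y t))" and "w \<equiv> \<lambda>t. snd (snd (y t))"
  shows "(s has_real_derivative f_speed f (s t) * w t) F"
    and "(x has_real_derivative - \<kappa> * x t * (w t)\<^sup>2) F"
    and "(w has_real_derivative snd (snd (flat_field f V \<psi> (s t, x t, w t)))) F"
proof -
  have 1: "((\<lambda>t. fst (y t)) has_vector_derivative fst (flat_field f V \<psi> (y t))) F"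
    by (rule bounded_linear.has_vector_derivative[OF bounded_linear_fst assms(1)])
  have 2: "((\<lambda>t. snd (y t)) has_vector_derivative snd (flat_field f V \<psi> (y t))) F"
    by (rule bounded_linear.has_vector_derivative[OF bounded_linear_snd assms(1)])
  note 3 = bounded_linear.has_vector_derivative[OF bounded_linear_fst 2]
    and 4 = bounded_linear.has_vector_derivative[OF bounded_linear_snd 2]
  show "(s has_real_derivative f_speed f (s t) * w t) F"
    "(x has_real_derivative - \<kappa> * x t * (w t)\<^sup>2) F"
    "(w has_real_derivative snd (snd (flat_field f V \<psi> (s t, x t, w t)))) F"
    using 1 3 4 unfolding has_real_derivative_iff_has_vector_derivative s_def x_def w_def
    by (auto simp: flat_field_def split_beta)
qed

text \<open>Each condition has its own reason: \<phi> has speed |w|, so s cannot reach -1 or 1 in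
  finite time; x solves a linear homogeneous equation and decreases weakly; the constraint defect
  solves a linear homogeneous equation with bounded coefficient and starts at 0.\<close>

lemma solution_in_Omega:
  assumes sol: "\<And>t. t \<in> {0..T} \<Longrightarrow> (y has_vector_derivative flat_field f V \<psi> (y t)) (at t within {0..T})"
    and y0: "y 0 \<in> Omega f V xbar" and T: "t \<in> {0..T}"
  shows "y t \<in> Omega f V xbar"
proof -
  define s where "s t = fst (y t)" for t
  define x where "x t = fst (snd (y t))" for t
  define w where "w t = snd (snd (y t))" for t
  have yt: "y t = (s t, x t, w t)" for t by (simp add: s_def x_def w_def)
  note ders = flat_field_derivs[OF sol, folded s_def[abs_def] x_def[abs_def] w_def[abs_def]]
  note ders = ders[unfolded s_def[symmetric] x_def[symmetric] w_def[symmetric]]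
  have conts: "continuous_on {0..T} s" and contx: "continuous_on {0..T} x"
    and contw: "continuous_on {0..T} w"
    using ders by (meson DERIV_continuous continuous_on_eq_continuous_within)+
  have init: "\<bar>s 0\<bar> < 1" "0 < x 0" "x 0 \<le> xbar" "V (inv f (s 0)) * (x 0)\<^sup>2 + (w 0)\<^sup>2 = 1"
    using y0 by (auto simp: yt Omega_def)
  have "bounded (w ` {0..T})" using contw by (intro compact_imp_bounded compact_continuous_image) auto
  then obtain B where "\<forall>t\<in>{0..T}. \<bar>w t\<bar> \<le> B" unfolding bounded_iff by auto
  then have B: "\<And>t. t \<in> {0..T} \<Longrightarrow> \<bar>w t\<bar> \<le> B" by blast
  have B0: "B \<ge> 0" using B[OF T] by linarith
  have B2: "(w r)\<^sup>2 \<le> B\<^sup>2" if "r \<in> {0..T}" for r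
    using B[OF that] power_mono[of "\<bar>w r\<bar>" B 2] by simp
  define \<phi> where "\<phi> t = inv f (s t)" for t
  have d\<phi>: "(\<phi> has_real_derivative w t) (at t within {0..T})" if "t \<in> {0..T}" "\<bar>s t\<bar> < 1" for t
  proof -
    have "(\<phi> has_real_derivative 1 / deriv f (inv f (s t)) * (f_speed f (s t) * w t)) (at t within {0..T})"
      unfolding \<phi>_def[abs_def] by (rule DERIV_chain2[OF inv_f_deriv[OF that(2)] ders(1)[OF that(1)]])
    then show ?thesis using f_deriv_pos[of "inv f (s t)"] that(2) by (simp add: f_speed_def)
  qed
  \<comment> \<open>The distance that \<phi> can travel up to time \<open>T\<close>. Its derivative
    is available only while |s| < 1, so continuous induction with \<open>U\<close> = (-1, 1) is
    used.\<close>
  define R where "R = B * T"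
  have s1: "\<bar>s t\<bar> < 1" if t: "t \<in> {0..T}" for t
  proof -
    have "s t \<in> {f (\<phi> 0 - R)..f (\<phi> 0 + R)}"
    proof (rule continuous_induction_Icc[OF conts _ _ _ _ _ t, of _ "{-1<..<1}"])
      show "{f (\<phi> 0 - R)..f (\<phi> 0 + R)} \<subseteq> {-1<..<1}"
        using f_less_1[of "\<phi> 0 - R"] f_less_1[of "\<phi> 0 + R"] by auto
      have mem: "s r \<in> {f (\<phi> 0 - R)..f (\<phi> 0 + R)}" if "\<bar>\<phi> r - \<phi> 0\<bar> \<le> R" "\<bar>s r\<bar> < 1" for r
      proof -
        have "s r = f (\<phi> r)" using f_inv_f[OF that(2)] by (simp add: \<phi>_def)
        moreover have "\<phi> 0 - R \<le> \<phi> r" "\<phi> r \<le> \<phi> 0 + R" using that by auto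
        ultimately show ?thesis using strict_mono_leD[OF f_strict_mono] by auto
      qed
      have "R \<ge> 0" using B0 T by (simp add: R_def)
      then show "s 0 \<in> {f (\<phi> 0 - R)..f (\<phi> 0 + R)}" using init by (intro mem) auto
      fix r assume r: "r \<in> {0..T}" and U: "\<And>q. q \<in> {0..r} \<Longrightarrow> s q \<in> {-1<..<1}"
      have "norm (\<phi> r - \<phi> 0) \<le> B * norm (r - 0)"
      proof (rule field_differentiable_bound[of "{0..r}" \<phi> w])
        fix q assume q: "q \<in> {0..r}"
        show "(\<phi> has_real_derivative w q) (at q within {0..r})"
          by (rule DERIV_subset[OF d\<phi>]) (use q r U[OF q] in auto)
        show "norm (w q) \<le> B" using B[of q] q r by auto
      qed (use r in auto)
      also have "\<dots> \<le> R" using r B0 by (auto simp: R_def intro: mult_left_mono)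
      finally show "s r \<in> {f (\<phi> 0 - R)..f (\<phi> 0 + R)}"
        using U[of r] r by (intro mem) (auto simp: abs_less_iff)
    qed auto
    then show ?thesis using f_less_1[of "\<phi> 0 - R"] f_less_1[of "\<phi> 0 + R"] by auto
  qed
  \<comment> \<open>Gronwall for x^2 does not presuppose the sign of x; the sign then follows from
    the intermediate value theorem.\<close>
  have x_ne: "x r \<noteq> 0" if r: "r \<in> {0..T}" for r
  proof -
    have "(x r)\<^sup>2 \<ge> (x 0)\<^sup>2 * exp (- (2 * \<kappa> * B\<^sup>2) * r)"
    proof (rule gronwall_ge[where T=T and g="\<lambda>t. (x t)\<^sup>2" and g'="\<lambda>t. - (2 * \<kappa> * (w t)\<^sup>2) * (x t)\<^sup>2"])
      fix q assume q: "q \<in> {0..T}"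
      show "((\<lambda>t. (x t)\<^sup>2) has_real_derivative - (2 * \<kappa> * (w q)\<^sup>2) * (x q)\<^sup>2) (at q within {0..T})"
        by (rule derivative_eq_intros ders(2)[OF q] refl)+ (simp add: power2_eq_square)
      show "- (2 * \<kappa> * B\<^sup>2) * (x q)\<^sup>2 \<le> - (2 * \<kappa> * (w q)\<^sup>2) * (x q)\<^sup>2"
        using B2[OF q] by (intro mult_right_mono) auto
    qed (use r in auto)
    moreover have "(x 0)\<^sup>2 * exp (- (2 * \<kappa> * B\<^sup>2) * r) > 0" using init by simp
    ultimately show ?thesis by auto
  qed
  have x_pos: "x r > 0" if r: "r \<in> {0..T}" for r
  proof (rule ccontr)
    assume "\<not> x r > 0"
    moreover have "continuous_on {0..r} x" by (rule continuous_on_subset[OF contx]) (use r in auto)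
    ultimately obtain q where "0 \<le> q" "q \<le> r" "x q = 0"
      using IVT2'[of x r 0 0] init r by auto
    then show False using x_ne[of q] r by auto
  qed
  have "- x 0 \<le> - x t"
  proof (rule deriv_within_nonneg_imp_le[where a=0 and b=T and g="\<lambda>t. - x t"
        and g'="\<lambda>t. \<kappa> * x t * (w t)\<^sup>2"])
    fix r assume r: "r \<in> {0..T}"
    show "((\<lambda>t. - x t) has_real_derivative \<kappa> * x r * (w r)\<^sup>2) (at r within {0..T})"
      using DERIV_minus[OF ders(2)[OF r]] by simp
    show "0 \<le> \<kappa> * x r * (w r)\<^sup>2" using x_pos[OF r] less_imp_le by simp
  qed (use T in auto)
  then have x1: "x t \<le> xbar" using init by simp
  \<comment> \<open>The constraint defect. By \<open>flat_field_w\<close> it satisfies W' = (2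
    \<kappa> w z - 2 \<kappa> w^2) W.\<close>
  define W where "W t = V (\<phi> t) * (x t)\<^sup>2 + (w t)\<^sup>2 - 1" for t
  obtain U where U: "\<And>s. s \<in> {-1..1} \<Longrightarrow> \<bar>(1 - \<psi> s) * u_ext f V s\<bar> \<le> U"
    by (rule cutoff_u_ext_bounded) blast
  define z where "z t = (1 - \<psi> (s t)) * u_ext f V (s t)" for t
  have z: "\<bar>z r\<bar> \<le> U" if "r \<in> {0..T}" for r 
    unfolding z_def by (rule U) (use s1[OF that] in auto)
  have "norm (W t) \<le> norm (W 0) * exp ((2 * \<kappa> * B\<^sup>2 + 2 * \<kappa> * B * U) * t)"
  proof (rule gronwall_norm[where T=T and e=W
        and e'="\<lambda>t. (2 * \<kappa> * w t * z t - 2 * \<kappa> * (w t)\<^sup>2) * W t"])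
    fix r assume r: "r \<in> {0..T}"
    have dV: "((\<lambda>t. V (\<phi> t)) has_real_derivative deriv V (\<phi> r) * w r) (at r within {0..T})"
      by (rule DERIV_chain2[OF V_deriv d\<phi>[OF r s1[OF r]]])
    have dw: "(w has_real_derivative \<kappa> * w r * (1 - (w r)\<^sup>2) - deriv V (\<phi> r) * (x r)\<^sup>2 / 2 + \<kappa> * z r * W r)
        (at r within {0..T})"
      using ders(3)[OF r] unfolding flat_field_w[OF s1[OF r]] by (simp add: \<phi>_def W_def z_def)
    have "(W has_real_derivative (2 * \<kappa> * w r * z r - 2 * \<kappa> * (w r)\<^sup>2) * W r) (at r within {0..T})"
      unfolding W_def[abs_def]
      by (rule derivative_eq_intros dV dw ders(2)[OF r] refl)+
        (simp add: W_def power2_eq_square algebra_simps)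
    then show "(W has_vector_derivative (2 * \<kappa> * w r * z r - 2 * \<kappa> * (w r)\<^sup>2) * W r) (at r within {0..T})"
      by (simp add: has_real_derivative_iff_has_vector_derivative)
    have "\<bar>w r * z r\<bar> \<le> B * U"
      unfolding abs_mult using B[OF r] z[OF r] B0 by (intro mult_mono) auto
    then have "\<bar>2 * \<kappa> * w r * z r\<bar> \<le> 2 * \<kappa> * B * U"
      using k_pos by (simp add: abs_mult)
    moreover have "\<bar>2 * \<kappa> * (w r)\<^sup>2\<bar> \<le> 2 * \<kappa> * B\<^sup>2" using B2[OF r] by simp
    ultimately have "\<bar>2 * \<kappa> * w r * z r - 2 * \<kappa> * (w r)\<^sup>2\<bar> \<le> 2 * \<kappa> * B\<^sup>2 + 2 * \<kappa> * B * U"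
      by linarith
    then show "norm ((2 * \<kappa> * w r * z r - 2 * \<kappa> * (w r)\<^sup>2) * W r)
        \<le> (2 * \<kappa> * B\<^sup>2 + 2 * \<kappa> * B * U) * norm (W r)"
      unfolding real_norm_def abs_mult[of _ "W r"] by (intro mult_right_mono) auto
  qed (use T in auto)
  moreover have "W 0 = 0" using init by (simp add: W_def \<phi>_def)
  ultimately have "W t = 0" by simp
  then show ?thesis using s1[OF T] x_pos[OF T] x1 by (auto simp: yt Omega_def W_def \<phi>_def)
qed

text \<open>Holds for an arbitrary solution starting in \<open>Omega\<close>, so statements about
  all solutions reduce to the planar field. Once the constraint is known at every time, the cutoff
  term in w' vanishes and the quotient rule gives v'.\<close>

lemma solution_imp_traj:
  assumes sol: "collapsing_scalar_field f V \<psi> {0..} y" and y0: "y 0 \<in> Omega f V xbar"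
  shows "\<And>t. t \<ge> 0 \<Longrightarrow> y t \<in> Omega f V xbar" and "\<And>T. traj T (\<lambda>t. \<Lambda> (y t))"
proof -
  have der: "(y has_vector_derivative flat_field f V \<psi> (y t)) (at t within {0..T})" if "t \<in> {0..T}" for t T
    by (rule has_vector_derivative_within_subset[of _ _ _ "{0..}"])
      (use sol that in \<open>auto simp: collapsing_scalar_field_def\<close>)
  show Om: "y t \<in> Omega f V xbar" if "t \<ge> 0" for t
    by (rule solution_in_Omega[of t, OF der y0]) (use that in auto)
  show "traj T (\<lambda>t. \<Lambda> (y t))" for T
    unfolding traj_def
  proof
    fix t assume t: "t \<in> {0..T}"
    define s where "s t = fst (y t)" for t
    define x where "x t = fst (snd (y t))" for t
    define w where "w t = snd (snd (y t))" for t
    have yt: "y t = (s t, x t, w t)" for t by (simp add: s_def x_def w_def)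
    note ders = flat_field_derivs[OF der[OF t], folded s_def[abs_def] x_def[abs_def] w_def[abs_def]]
    note ders = ders[unfolded s_def[symmetric] x_def[symmetric] w_def[symmetric]]
    have in_Om: "\<bar>s t\<bar> < 1" "x t > 0" "V (inv f (s t)) * (x t)\<^sup>2 + (w t)\<^sup>2 = 1"
      using Om[of t] t by (auto simp: yt Omega_def)
    have H: "sqrt (G (\<Lambda> (y t))) = 1 / x t" unfolding yt by (rule G_\<Lambda>(2)[OF in_Om(2,3)])
    have "((\<lambda>t. inv f (s t)) has_real_derivative 1 / deriv f (inv f (s t)) * (f_speed f (s t) * w t))
        (at t within {0..T})"
      by (rule DERIV_chain2[OF inv_f_deriv[OF in_Om(1)] ders(1)])
    then have 1: "((\<lambda>t. inv f (s t)) has_real_derivative w t) (at t within {0..T})"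
      using f_deriv_pos[of "inv f (s t)"] in_Om(1) by (simp add: f_speed_def)
    have dw: "(w has_real_derivative \<kappa> * w t * (1 - (w t)\<^sup>2) - deriv V (inv f (s t)) * (x t)\<^sup>2 / 2)
        (at t within {0..T})"
      using ders(3) unfolding flat_field_w[OF in_Om(1)] in_Om(3) by simp
    have 2: "((\<lambda>t. w t / x t) has_real_derivative \<kappa> * (w t / x t) - deriv V (inv f (s t)) * x t / 2)
        (at t within {0..T})"
      by (rule DERIV_cong[OF DERIV_divide[OF dw ders(2)]])
        (use in_Om(2) in \<open>auto simp: field_simps power2_eq_square\<close>)
    show "((\<lambda>t. \<Lambda> (y t)) has_vector_derivative X (\<Lambda> (y t))) (at t within {0..T})"
      unfolding has_vector_derivative_vec2 X_def H
      using 1 2 in_Om(2) by (simp add: yt \<Lambda>_def)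
  qed
qed


subsection \<open>Generic behaviour\<close>

text \<open>Along a solution G = 1/x^2 is nondecreasing, so it tends to infinity as soon as it is
  unbounded. Positivity of x makes the limit one from the right.\<close>

lemma x_tendsto_0_iff:
  assumes sol: "collapsing_scalar_field f V \<psi> {0..} y" and y0: "y 0 \<in> Omega f V xbar"
  shows "filterlim (\<lambda>t. fst (snd (y t))) (at_right 0) at_top \<longleftrightarrow>
    ((\<lambda>t. fst (snd (y t))) \<longlongrightarrow> 0) at_top"
    and "((\<lambda>t. fst (snd (y t))) \<longlongrightarrow> 0) at_top \<longleftrightarrow> \<not> (\<exists>g. \<forall>t\<ge>0. G (\<Lambda> (y t)) \<le> g)"
proof -
  define x where "x t = fst (snd (y t))" for t
  note Om = solution_imp_traj(1)[OF sol y0] and tr = solution_imp_traj(2)[OF sol y0]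
  have x: "x t > 0" "G (\<Lambda> (y t)) = 1 / (x t)\<^sup>2" if "t \<ge> 0" for t
  proof -
    obtain s w where yt: "y t = (s, x t, w)" unfolding x_def by (metis prod.collapse)
    show "x t > 0" using Om[OF that] by (simp add: yt Omega_def)
    then show "G (\<Lambda> (y t)) = 1 / (x t)\<^sup>2"
      unfolding yt using Om[OF that] by (intro G_\<Lambda>) (auto simp: yt Omega_def)
  qed
  show "filterlim (\<lambda>t. fst (snd (y t))) (at_right 0) at_top \<longleftrightarrow> ((\<lambda>t. fst (snd (y t))) \<longlongrightarrow> 0) at_top"
  proof
    assume "filterlim (\<lambda>t. fst (snd (y t))) (at_right 0) at_top"
    then show "((\<lambda>t. fst (snd (y t))) \<longlongrightarrow> 0) at_top" by (simp add: filterlim_at)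
  next
    assume "((\<lambda>t. fst (snd (y t))) \<longlongrightarrow> 0) at_top"
    then show "filterlim (\<lambda>t. fst (snd (y t))) (at_right 0) at_top"
      by (rule tendsto_imp_filterlim_at_right)
        (rule eventually_mono[OF eventually_ge_at_top[of 0]], use x(1) in \<open>simp add: x_def\<close>)
  qed
  have "(x \<longlongrightarrow> 0) at_top \<longleftrightarrow> \<not> (\<exists>g. \<forall>t\<ge>0. G (\<Lambda> (y t)) \<le> g)"
  proof (intro iffI notI)
    assume x0: "(x \<longlongrightarrow> 0) at_top" and "\<exists>g. \<forall>t\<ge>0. G (\<Lambda> (y t)) \<le> g"
    then obtain g where g: "\<And>t. t \<ge> 0 \<Longrightarrow> 1 / (x t)\<^sup>2 \<le> g" using x(2) by auto
    have "g > 0" using g[of 0] x(1)[of 0] by (smt (verit) zero_less_divide_1_iff zero_less_power order_refl)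
    have "((\<lambda>t. g * (x t)\<^sup>2) \<longlongrightarrow> g * 0\<^sup>2) at_top" by (intro tendsto_intros x0)
    then have "\<forall>\<^sub>F t in at_top. g * (x t)\<^sup>2 < 1" by (auto dest: order_tendstoD(2)[of _ _ _ 1])
    then obtain N where "\<And>t. t \<ge> N \<Longrightarrow> g * (x t)\<^sup>2 < 1" unfolding eventually_at_top_linorder by blast
    then have t: "max N 0 \<ge> 0" "g * (x (max N 0))\<^sup>2 < 1" by auto
    then show False using g[OF t(1)] x(1)[OF t(1)] by (simp add: field_simps)
  next
    assume unb: "\<not> (\<exists>g. \<forall>t\<ge>0. G (\<Lambda> (y t)) \<le> g)"
    show "(x \<longlongrightarrow> 0) at_top"
    proof (rule tendstoI)
      fix e :: real assume e: "e > 0"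
      obtain t0 where t0: "t0 \<ge> 0" "G (\<Lambda> (y t0)) > 1 / e\<^sup>2" using unb by (meson not_le)
      show "\<forall>\<^sub>F t in at_top. dist (x t) 0 < e"
        using eventually_ge_at_top[of t0]
      proof eventually_elim
        fix t assume t: "t0 \<le> t"
        have "1 / e\<^sup>2 < 1 / (x t)\<^sup>2"
          using traj_G_mono[OF tr, of t0 t t] t t0 x(2)[of t] by simp
        then have "(x t)\<^sup>2 < e\<^sup>2" using e x(1)[of t] t t0 by (simp add: field_simps)
        then show "dist (x t) 0 < e" using e x(1)[of t] t t0 by (simp add: power2_less_imp_less)
      qed
    qed
  qed
  then show "((\<lambda>t. fst (snd (y t))) \<longlongrightarrow> 0) at_top \<longleftrightarrow> \<not> (\<exists>g. \<forall>t\<ge>0. G (\<Lambda> (y t)) \<le> g)"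
    by (simp add: x_def[abs_def])
qed

lemma Omega_bounds:
  assumes "(s, x, w) \<in> Omega f V xbar"
  shows "\<bar>w\<bar> \<le> sqrt (1 + m * xbar\<^sup>2)"
proof (rule real_le_rsqrt)
  have x: "0 < x" "x \<le> xbar" "V (inv f s) * x\<^sup>2 + w\<^sup>2 = 1" using assms by (auto simp: Omega_def)
  have "- V (inv f s) * x\<^sup>2 \<le> m * x\<^sup>2" using V_ge[of "inv f s"] by (intro mult_right_mono) auto
  also have "\<dots> \<le> m * xbar\<^sup>2" using x m_nonneg by (intro mult_left_mono power_mono) auto
  finally show "\<bar>w\<bar>\<^sup>2 \<le> 1 + m * xbar\<^sup>2" using x(3) by simp
qed

text \<open>Since \<open>V\<close> is finite at interior points, \<open>x \<rightarrow> 0\<close> in the constraint forces \<open>w\<^sup>2 \<rightarrow> 1\<close>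
  unless \<open>\<bar>s\<bar> \<rightarrow> 1\<close>.\<close>

lemma limit_in_M0:
  assumes Om: "\<And>n. p n \<in> Omega f V xbar" and lim: "p \<longlonglongrightarrow> z"
    and x0: "(\<lambda>n. fst (snd (p n))) \<longlonglongrightarrow> 0"
  shows "z \<in> M0 f V xbar"
proof -
  obtain s x w where z: "z = (s, x, w)" by (cases z) auto
  have ls: "(\<lambda>n. fst (p n)) \<longlonglongrightarrow> s" and lx: "(\<lambda>n. fst (snd (p n))) \<longlonglongrightarrow> x"
    and lw: "(\<lambda>n. snd (snd (p n))) \<longlonglongrightarrow> w"
    using tendsto_fst[OF lim] tendsto_fst[OF tendsto_snd[OF lim]] tendsto_snd[OF tendsto_snd[OF lim]]
    by (auto simp: z)
  have x: "x = 0" using LIMSEQ_unique[OF lx x0] .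
  have constr: "V (inv f (fst (p n))) * (fst (snd (p n)))\<^sup>2 + (snd (snd (p n)))\<^sup>2 = 1"
    and s_in: "\<bar>fst (p n)\<bar> < 1" for n
    using Om[of n] by (auto simp: Omega_def split_beta)
  have "\<bar>s\<bar> \<le> 1"
    by (rule LIMSEQ_le_const2[OF tendsto_rabs[OF ls]]) (use s_in in \<open>auto intro: less_imp_le\<close>)
  moreover have "\<bar>w\<bar> = 1" if s: "\<bar>s\<bar> < 1"
  proof -
    have "isCont (inv f) s" by (rule DERIV_isCont[OF inv_f_deriv[OF s]])
    from isCont_tendsto_compose[OF DERIV_isCont[OF V_deriv] isCont_tendsto_compose[OF this ls]]
    have "(\<lambda>n. V (inv f (fst (p n)))) \<longlonglongrightarrow> V (inv f s)" .
    then have "(\<lambda>n. V (inv f (fst (p n))) * (fst (snd (p n)))\<^sup>2 + (snd (snd (p n)))\<^sup>2)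
        \<longlonglongrightarrow> V (inv f s) * 0\<^sup>2 + w\<^sup>2"
      by (intro tendsto_intros lw x0)
    then have "1 = V (inv f s) * 0\<^sup>2 + w\<^sup>2" unfolding constr by (simp add: LIMSEQ_const_iff)
    then show ?thesis by (simp add: abs_square_eq_1)
  qed
  moreover have "z \<in> closure (Omega f V xbar)"
    unfolding closure_sequential using Om lim by blast
  ultimately show ?thesis using x by (force simp: M0_def z)
qed

text \<open>\<open>Omega\<close> lies in a compact box, w being bounded because V \<ge> -m. The
  accumulation points serve twice: they show that \<open>M0\<close> is nonempty and that no sequence
  of late times stays away from it.\<close>

lemma subsequence_to_M0:
  assumes sol: "collapsing_scalar_field f V \<psi> {0..} y" and y0: "y 0 \<in> Omega f V xbar"
    and x0: "((\<lambda>t. fst (snd (y t))) \<longlongrightarrow> 0) at_top" and \<tau>: "\<And>n. \<tau> n \<ge> real n"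
  obtains r z where "strict_mono r" "z \<in> M0 f V xbar" "(\<lambda>n. y (\<tau> (r n))) \<longlonglongrightarrow> z"
proof -
  note Om = solution_imp_traj(1)[OF sol y0]
  have \<tau>0: "\<tau> n \<ge> 0" for n using \<tau>[of n] by linarith
  define \<omega> where "\<omega> = sqrt (1 + m * xbar\<^sup>2)"
  have "compact ({-1..1::real} \<times> {0..xbar} \<times> {-\<omega>..\<omega>})" by (intro compact_Times compact_Icc)
  moreover have "y (\<tau> n) \<in> {-1..1} \<times> {0..xbar} \<times> {-\<omega>..\<omega>}" for n
  proof -
    obtain s x w where yt: "y (\<tau> n) = (s, x, w)" by (cases "y (\<tau> n)") auto
    then have "(s, x, w) \<in> Omega f V xbar" using Om[OF \<tau>0[of n]] by simp
    then show ?thesis unfolding yt using Omega_bounds[of s x w xbar] by (auto simp: Omega_def \<omega>_def)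
  qed
  ultimately obtain z r where r: "strict_mono r" "((\<lambda>n. y (\<tau> n)) \<circ> r) \<longlonglongrightarrow> z"
    unfolding compact_def by metis
  have "filterlim (\<lambda>n. \<tau> (r n)) at_top sequentially"
  proof (rule filterlim_at_top_mono[OF filterlim_real_sequentially])
    show "\<forall>\<^sub>F n in sequentially. real n \<le> \<tau> (r n)"
      using \<tau> strict_mono_imp_increasing[OF r(1)] by (intro always_eventually) (meson of_nat_le_iff order_trans)
  qed
  then have "(\<lambda>n. fst (snd (y (\<tau> (r n))))) \<longlonglongrightarrow> 0" by (rule filterlim_compose[OF x0])
  then have "z \<in> M0 f V xbar"
    using limit_in_M0[of "\<lambda>n. y (\<tau> (r n))"] r(2) Om \<tau>0 by (simp add: comp_def)
  then show ?thesis using that r by (simp add: comp_def)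
qed

text \<open>Forwards, x is 1-Lipschitz and vanishes on \<open>M0\<close>. Backwards, times tending
  to infinity with distance at least e from \<open>M0\<close> would have a subsequence converging
  into \<open>M0\<close>.\<close>

lemma approaches_iff:
  assumes sol: "collapsing_scalar_field f V \<psi> {0..} y" and y0: "y 0 \<in> Omega f V xbar"
  shows "approaches y (M0 f V xbar) \<longleftrightarrow> ((\<lambda>t. fst (snd (y t))) \<longlongrightarrow> 0) at_top"
proof
  note Om = solution_imp_traj(1)[OF sol y0]
  assume ap: "approaches y (M0 f V xbar)"
  have le: "norm (fst (snd (y t))) \<le> infdist (y t) (M0 f V xbar)" for t
  proof -
    have "\<bar>fst (snd (y t))\<bar> \<le> dist (y t) z" if "z \<in> M0 f V xbar" for z
    proof -
      have "dist (fst (snd (y t))) (fst (snd z)) \<le> dist (y t) z"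
        by (meson dist_fst_le dist_snd_le order_trans)
      moreover have "fst (snd z) = 0" using that by (auto simp: M0_def)
      ultimately show ?thesis by simp
    qed
    then show ?thesis
      using ap by (auto simp: approaches_def infdist_notempty intro!: cINF_greatest)
  qed
  show "((\<lambda>t. fst (snd (y t))) \<longlongrightarrow> 0) at_top"
    by (rule Lim_null_comparison[of _ "\<lambda>t. infdist (y t) (M0 f V xbar)"])
      (use ap le in \<open>auto simp: approaches_def\<close>)
next
  assume x0: "((\<lambda>t. fst (snd (y t))) \<longlongrightarrow> 0) at_top"
  note sub = subsequence_to_M0[OF sol y0 x0]
  have "M0 f V xbar \<noteq> {}" using sub[of real] by blast
  moreover have "((\<lambda>t. infdist (y t) (M0 f V xbar)) \<longlongrightarrow> 0) at_top"
  proof (rule tendstoI, rule ccontr)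
    fix e :: real assume e: "e > 0"
      and "\<not> (\<forall>\<^sub>F t in at_top. dist (infdist (y t) (M0 f V xbar)) 0 < e)"
    then have "\<exists>t\<ge>real n. infdist (y t) (M0 f V xbar) \<ge> e" for n
      unfolding eventually_at_top_linorder by (auto simp: infdist_nonneg not_less)
    then obtain \<tau> where \<tau>: "\<And>n. \<tau> n \<ge> real n" "\<And>n. infdist (y (\<tau> n)) (M0 f V xbar) \<ge> e" by metis
    obtain r z where r: "z \<in> M0 f V xbar" "(\<lambda>n. y (\<tau> (r n))) \<longlonglongrightarrow> z" using sub[OF \<tau>(1)] by blast
    have "(\<lambda>n. infdist (y (\<tau> (r n))) (M0 f V xbar)) \<longlonglongrightarrow> infdist z (M0 f V xbar)"
      by (intro tendsto_infdist r)
    then have "e \<le> infdist z (M0 f V xbar)" by (rule LIMSEQ_le_const) (use \<tau> in auto)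
    then show False using r(1) e by simp
  qed
  ultimately show "approaches y (M0 f V xbar)" by (simp add: approaches_def)
qed

text \<open>Both halves are carried out in the (\<phi>, v)-plane. The relatively open subsets of
  \<open>Omega\<close> near the edge x = \<open>xbar\<close> need care, since there a full planar
  ball need not map into \<open>Omega\<close>.\<close>

lemma generic_x_tendsto_0:
  assumes xbar: "xbar > 0"
  shows "generically_in (Omega f V xbar) (\<lambda>p.
    \<forall>y. collapsing_scalar_field f V \<psi> {0..} y \<and> y 0 = p \<longrightarrow>
      ((\<lambda>t. fst (snd (y t))) \<longlongrightarrow> 0) at_top)" (is "generically_in ?\<Omega> ?P")
proof -
  define c where "c = 1 / xbar\<^sup>2"
  have c: "c > 0" using xbar by (simp add: c_def)
  obtain C where C: "\<And>q g t. (\<And>T. traj T q) \<Longrightarrow> G (q 0) > 0 \<Longrightarrow>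
     (\<And>t. t \<ge> 0 \<Longrightarrow> G (q t) \<le> g) \<Longrightarrow> t \<ge> 0 \<Longrightarrow> G (q t) \<le> C"
    by (rule bounded_traj_G_le) blast
  \<comment> \<open>A bounded G never exceeds \<open>C\<close> and an unbounded one does, so the
    limit is decided by a single finite time.\<close>
  have iff: "((\<lambda>t. fst (snd (y t))) \<longlongrightarrow> 0) at_top \<longleftrightarrow> (\<exists>t\<ge>0. G (\<Lambda> (y t)) > C)"
    if "collapsing_scalar_field f V \<psi> {0..} y" "y 0 \<in> ?\<Omega>" for y
    unfolding x_tendsto_0_iff(2)[OF that]
    using C[OF solution_imp_traj(2)[OF that] G_\<Lambda>_ge(2)[OF that(2)]] by (meson not_le)
  have open_good: "\<exists>e>0. ball p e \<inter> ?\<Omega> \<subseteq> {p \<in> ?\<Omega>. ?P p}" if p: "p \<in> ?\<Omega>" "?P p" for p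
  proof -
    obtain q where q: "q 0 = \<Lambda> p" "\<And>T. traj T q"
      using traj_exists[OF G_\<Lambda>_ge(2)[OF p(1)]] by blast
    have y: "collapsing_scalar_field f V \<psi> {0..} (\<lambda>t. \<Theta> (q t))" "\<Theta> (q 0) = p"
      using traj_imp_solution[OF q(2)] G_\<Lambda>_ge(2)[OF p(1)] \<Theta>_\<Lambda>[OF p(1)] by (auto simp: q(1))
    obtain T where T: "T \<ge> 0" "G (\<Lambda> (\<Theta> (q T))) > C" using iff[OF y(1)] y p by auto
    have "G (q T) > 0" using traj_G_mono[OF q(2), of 0 T T] T(1) G_\<Lambda>_ge(2)[OF p(1)] q(1) by simp
    then have GT: "G (q T) > C" using T(2) by (simp add: \<Lambda>_\<Theta>)
    define r where "r = \<bar>q 0 $ 1\<bar> + 1"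
    define g where "g = G (q 0) + 1"
    obtain L where L: "\<And>q q' t. traj T q \<Longrightarrow> traj T q' \<Longrightarrow> c \<le> G (q 0) \<Longrightarrow> c \<le> G (q' 0) \<Longrightarrow>
       \<bar>q 0 $ 1\<bar> \<le> r \<Longrightarrow> \<bar>q' 0 $ 1\<bar> \<le> r \<Longrightarrow> G (q 0) \<le> g \<Longrightarrow> G (q' 0) \<le> g \<Longrightarrow> t \<in> {0..T} \<Longrightarrow>
       dist (q t) (q' t) \<le> dist (q 0) (q' 0) * exp (L * t)"
      by (rule traj_diff_bound[OF c]) blast
    have "open {q. C < G q}" by (intro open_Collect_less continuous_intros G_cont)
    then obtain \<eta> where \<eta>: "\<eta> > 0" "ball (q T) \<eta> \<subseteq> {q. C < G q}"
      using GT by (metis (mono_tags, lifting) mem_Collect_eq openE)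
    \<comment> \<open>The radius compensates the factor exp(L T) by which distances may grow up to
      time T.\<close>
    define N where "N = {q'. \<bar>q' $ 1\<bar> < r} \<inter> {q'. G q' < g} \<inter> ball (q 0) (\<eta> * exp (- (L * T)))"
    have "open N" unfolding N_def by (intro open_Int open_Collect_less continuous_intros G_cont open_ball)
    moreover have "\<Lambda> p \<in> N" using \<eta> by (simp add: N_def r_def g_def q(1))
    moreover have "\<exists>d>0. \<forall>p'\<in>?\<Omega>. dist p' p < d \<longrightarrow> dist (\<Lambda> p') (\<Lambda> p) < e" if "e > 0" for e
      using \<Lambda>_cont p(1) that unfolding continuous_on_iff by blast
    ultimately obtain e where e: "e > 0" "\<And>p'. p' \<in> ?\<Omega> \<Longrightarrow> dist p' p < e \<Longrightarrow> \<Lambda> p' \<in> N"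
      by (metis open_dist)
    have "?P p'" if p': "p' \<in> ?\<Omega>" "dist p' p < e" for p'
    proof (intro allI impI)
      fix y' assume y': "collapsing_scalar_field f V \<psi> {0..} y' \<and> y' 0 = p'"
      then have y'Om: "y' 0 \<in> ?\<Omega>" using p' by simp
      let ?q' = "\<lambda>t. \<Lambda> (y' t)"
      have q': "traj T ?q'" using solution_imp_traj(2) y' y'Om by blast
      have N': "?q' 0 \<in> N" using e(2)[OF p'] y' by simp
      have "dist (q T) (?q' T) \<le> dist (q 0) (?q' 0) * exp (L * T)"
        by (rule L[OF q(2) q']) (use N' G_\<Lambda>_ge(1)[OF y'Om] G_\<Lambda>_ge(1)[OF p(1)] T(1) in
            \<open>auto simp: N_def r_def g_def c_def q(1)\<close>)
      also have "\<dots> < \<eta> * exp (- (L * T)) * exp (L * T)"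
        using N' by (intro mult_strict_right_mono) (auto simp: N_def)
      also have "\<dots> = \<eta>" by (simp add: exp_minus)
      finally have "C < G (?q' T)" using \<eta>(2) by auto
      then show "((\<lambda>t. fst (snd (y' t))) \<longlongrightarrow> 0) at_top" using iff[of y'] y' y'Om T(1) by blast
    qed
    then show ?thesis using e(1) by (intro exI[of _ e]) (auto simp: dist_commute)
  qed
  have dense: "\<exists>p'\<in>{p \<in> ?\<Omega>. ?P p}. dist p' p < e" if p: "p \<in> ?\<Omega>" and e: "e > 0" for p e
  proof (rule ccontr)
    assume "\<not> ?thesis"
    then have bad: "\<not> ?P p'" if "p' \<in> ?\<Omega>" "dist p' p < e" for p' using that by blast
    define q0 where "q0 = \<Lambda> p"
    have G0: "G q0 > 0" "G q0 \<ge> c" using G_\<Lambda>_ge[OF p] by (auto simp: q0_def c_def)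
    have "open {q. G q > 0}" by (intro open_Collect_less continuous_intros G_cont)
    then have "isCont \<Theta> q0"
      using \<Theta>_cont G0 continuous_on_eq_continuous_at by blast
    then obtain \<rho> where \<rho>: "\<rho> > 0" "\<And>q. dist q q0 < \<rho> \<Longrightarrow> dist (\<Theta> q) (\<Theta> q0) < e"
      using e unfolding continuous_at_eps_delta by metis
    \<comment> \<open>The point may lie on the edge G = c. Pushing v away from 0 strictly raises G,
      so that a whole ball around the new centre lies in G > c. The shift \<rho>/2 and the radius
      \<rho>/4 stay within \<rho>.\<close>
    define \<sigma> where "\<sigma> = (if q0 $ 2 \<ge> 0 then \<rho> / 2 else - \<rho> / 2)"
    define q1 where "q1 = q0 + axis 2 \<sigma>"
    have q1: "q1 $ 1 = q0 $ 1" "q1 $ 2 = q0 $ 2 + \<sigma>" by (auto simp: q1_def axis_def)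
    have d1: "dist q1 q0 \<le> \<rho> / 2"
      using norm_le_l1_cart[of "axis 2 \<sigma> :: real^2"] \<rho>
      by (simp add: q1_def dist_norm \<sigma>_def sum_2 axis_def split: if_splits)
    have "(q0 $ 2 + \<sigma>)\<^sup>2 > (q0 $ 2)\<^sup>2"
    proof -
      have "\<bar>q0 $ 2\<bar> < \<bar>q0 $ 2 + \<sigma>\<bar>" using \<rho> by (auto simp: \<sigma>_def)
      then show ?thesis by (simp add: power2_strict_mono)
    qed
    then have "G q1 > c" using G0 by (simp add: G_def q1)
    moreover have "open {q. G q > c}" by (intro open_Collect_less continuous_intros G_cont)
    ultimately obtain \<rho>1 where \<rho>1: "\<rho>1 > 0" "cball q1 \<rho>1 \<subseteq> {q. G q > c}"
      using open_contains_cball by blast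
    define r where "r = min \<rho>1 (\<rho> / 4)"
    show False
    proof (rule no_bounded_ball[OF c, of r q1 C])
      show "r > 0" using \<rho> \<rho>1 by (simp add: r_def)
      fix q assume q: "q \<in> cball q1 r"
      have Gq: "G q \<ge> c" using \<rho>1 q by (auto simp: r_def)
      then have G0: "G q > 0" using c by simp
      have "dist q q0 < \<rho>"
        using q d1 \<rho> dist_triangle[of q q0 q1] by (auto simp: r_def dist_commute)
      then have "dist (\<Theta> q) p < e" using \<rho>(2) \<Theta>_\<Lambda>[OF p] by (simp add: q0_def)
      moreover have Om: "\<Theta> q \<in> ?\<Omega>" using \<Theta>_in_Omega[OF xbar] Gq by (simp add: c_def)
      ultimately have "\<not> ?P (\<Theta> q)" using bad by blast
      then obtain y where y: "collapsing_scalar_field f V \<psi> {0..} y" "y 0 = \<Theta> q"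
        "\<not> ((\<lambda>t. fst (snd (y t))) \<longlongrightarrow> 0) at_top" by blast
      have yOm: "y 0 \<in> ?\<Omega>" using y Om by simp
      have "\<forall>t\<ge>0. G (\<Lambda> (y t)) \<le> C" using iff[OF y(1) yOm] y(3) by (meson not_le)
      moreover have "\<forall>T. traj T (\<lambda>t. \<Lambda> (y t))" using solution_imp_traj(2)[OF y(1) yOm] by blast
      moreover have "\<Lambda> (y 0) = q" using y(2) \<Lambda>_\<Theta>[OF G0] by simp
      ultimately show "c \<le> G q \<and> (\<exists>q'. q' 0 = q \<and> (\<forall>T. traj T q') \<and> (\<forall>t\<ge>0. G (q' t) \<le> C))"
        using Gq by (intro conjI exI[of _ "\<lambda>t. \<Lambda> (y t)"])
    qed
  qed
  show ?thesis
    unfolding generically_in_def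
  proof
    show "openin (top_of_set ?\<Omega>) {p \<in> ?\<Omega>. ?P p}"
      unfolding openin_contains_ball using open_good by blast
    show "?\<Omega> \<subseteq> closure {p \<in> ?\<Omega>. ?P p}"
      unfolding closure_approachable subset_iff using dense by blast
  qed
qed

end

theorem theorem3p2:
  fixes f V \<psi> :: "real \<Rightarrow> real" and \<delta> xbar :: real
  assumes "compactification f"
    and "assumption_V f V"
    and "cutoff f V \<delta> \<psi>"
    and "continuous_on ({-1..1} \<times> UNIV) (flat_field f V \<psi>)"
    and "xbar > 0"
  shows
    "(\<forall>p \<in> Omega f V xbar. \<exists>y. collapsing_scalar_field f V \<psi> {0..} y \<and> y 0 = p) \<and>
     (\<forall>I y. collapsing_scalar_field f V \<psi> I y \<and> y 0 \<in> Omega f V xbar \<longrightarrow>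
        (\<forall>t\<in>I. y t \<in> Omega f V xbar)) \<and>
     M0 f V xbar \<subseteq> closure (Omega f V xbar) - Omega f V xbar \<and>
     generically_in (Omega f V xbar) (\<lambda>p.
        \<forall>y. collapsing_scalar_field f V \<psi> {0..} y \<and> y 0 = p \<longrightarrow>
          approaches y (M0 f V xbar)) \<and>
     generically_in (Omega f V xbar) (\<lambda>p.
        \<forall>y. collapsing_scalar_field f V \<psi> {0..} y \<and> y 0 = p \<longrightarrow>
          filterlim (\<lambda>t. fst (snd (y t))) (at_right 0) at_top)"
proof -
  obtain V'' m M R0 where "potential V (deriv V) V'' (sqrt (3/2)) m M R0"
    using assumption_V_potential[OF assms(1,2)] by blast
  then interpret collapse V V'' m M R0 f \<psi> \<delta>
    using assms by (intro collapse.intro collapse_axioms.intro)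
  let ?\<Omega> = "Omega f V xbar" and ?sol = "collapsing_scalar_field f V \<psi>"
  \<comment> \<open>Existence on the whole half line keeps the generic statements, which quantify
    over all solutions, from being vacuous.\<close>
  have ex: "\<exists>y. ?sol {0..} y \<and> y 0 = p" if p: "p \<in> ?\<Omega>" for p
  proof -
    obtain q where q: "q 0 = \<Lambda> p" "\<And>T. traj T q"
      using traj_exists[OF G_\<Lambda>_ge(2)[OF p]] by blast
    show ?thesis
      using traj_imp_solution[OF q(2)] G_\<Lambda>_ge(2)[OF p] \<Theta>_\<Lambda>[OF p]
      by (intro exI[of _ "\<lambda>t. \<Theta> (q t)"]) (auto simp: q(1))
  qed
  have inv: "y t \<in> ?\<Omega>" if y: "?sol I y" "y 0 \<in> ?\<Omega>" and t: "t \<in> I" for I y t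
  proof -
    have I: "is_interval I" "0 \<in> I" "I \<subseteq> {0..}" using y by (auto simp: collapsing_scalar_field_def)
    have sub: "{0..t} \<subseteq> I" using mem_is_interval_1_I[OF I(1,2) t] by auto
    have "t \<ge> 0" using I t by auto
    show ?thesis
    proof (rule solution_in_Omega[where T=t and y=y and t=t, OF _ y(2)])
      show "(y has_vector_derivative flat_field f V \<psi> (y r)) (at r within {0..t})" if "r \<in> {0..t}" for r
        by (rule has_vector_derivative_within_subset[OF _ sub])
          (use y that sub in \<open>auto simp: collapsing_scalar_field_def\<close>)
      show "t \<in> {0..t}" using \<open>t \<ge> 0\<close> by simp
    qed
  qed
  \<comment> \<open>The limit from the right, the limit 0 and the approach to \<open>M0\<close>
    single out the same initial data, so one genericity result covers them.\<close>
  have cong: "generically_in ?\<Omega> P \<longleftrightarrow> generically_in ?\<Omega> Q" if "\<And>p. p \<in> ?\<Omega> \<Longrightarrow> P p \<longleftrightarrow> Q p" for P Q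
  proof -
    have "{p \<in> ?\<Omega>. P p} = {p \<in> ?\<Omega>. Q p}" using that by blast
    then show ?thesis by (simp add: generically_in_def)
  qed
  note generic = generic_x_tendsto_0[OF \<open>xbar > 0\<close>]
  have "generically_in ?\<Omega> (\<lambda>p. \<forall>y. ?sol {0..} y \<and> y 0 = p \<longrightarrow> approaches y (M0 f V xbar))"
    by (rule cong[THEN iffD2, OF _ generic]) (use approaches_iff in blast)
  moreover have "generically_in ?\<Omega> (\<lambda>p. \<forall>y. ?sol {0..} y \<and> y 0 = p \<longrightarrow>
      filterlim (\<lambda>t. fst (snd (y t))) (at_right 0) at_top)"
    by (rule cong[THEN iffD2, OF _ generic]) (use x_tendsto_0_iff(1) in blast)
  moreover have "M0 f V xbar \<subseteq> closure ?\<Omega> - ?\<Omega>" by (auto simp: M0_def Omega_def)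
  moreover have "\<forall>p\<in>?\<Omega>. \<exists>y. ?sol {0..} y \<and> y 0 = p" using ex by blast
  moreover have "\<forall>I y. ?sol I y \<and> y 0 \<in> ?\<Omega> \<longrightarrow> (\<forall>t\<in>I. y t \<in> ?\<Omega>)" using inv by blast
  ultimately show ?thesis by (intro conjI)
qed

end
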